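(* Let $M$ be a smooth closed manifold, and let $X \subsetneq M$ be a finite simplicial subcomplex. Then there exists a $C^{\infty}$ Reeb function $f\colon M \to [0,1]$, having $0$ and $1$ as extrema, such that $f^{-1}(0)= X$.
   Context: Smooth means $C^\infty$. "Finite simplicial subcomplex" of $M$ is used in the usual sense of a finite (PL) subcomplex of the manifold $M$, i.e. with respect to a triangulation of $M$. Definition (Reeb function). Let $M$ be a smooth closed manifold and let $f\colon M\to[a,b]$ be a $C^k$ function with $k\ge 2$ and $a<b$. Then $f$ is a Reeb function on $M$ if $f$ has $a$ and $b$ as the only critical values; these are called the extrema of $f$. The subsets $f^{-1}(a)$ and $f^{-1}(b)$ are the critical levels of $f$. *)

theory Defs
  imports "HOL-Analysis.Analysis"
begin

section \<open>Differentiability on open subsets of finite-dimensional spaces\<close>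

text \<open>
  The following is meant for an open set \<open>S\<close> in a finite-dimensional domain: a map is of class
  \<open>C^(k+1)\<close> iff it is differentiable and all its directional derivatives are of class \<open>C^k\<close>.
  Only the values of \<open>f\<close> on \<open>S\<close> matter.
\<close>

primrec Ck_on :: "nat \<Rightarrow> 'v::real_normed_vector set \<Rightarrow> ('v \<Rightarrow> 'w::real_normed_vector) \<Rightarrow> bool" where
  "Ck_on 0 S f \<longleftrightarrow> continuous_on S f"
| "Ck_on (Suc k) S f \<longleftrightarrow>
     (\<forall>x\<in>S. f differentiable (at x)) \<and>
     (\<forall>v. Ck_on k S (\<lambda>x. frechet_derivative f (at x) v))"

definition smooth_on :: "'v::real_normed_vector set \<Rightarrow> ('v \<Rightarrow> 'w::real_normed_vector) \<Rightarrow> bool" where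
  "smooth_on S f \<longleftrightarrow> (\<forall>k. Ck_on k S f)"

section \<open>Smooth manifolds\<close>

text \<open>
  A chart is a pair of a domain and a coordinate map. The model space \<open>'e\<close> is a normed space that
  is required to be finite-dimensional in \<open>closed_smooth_manifold\<close> below. The class
  \<^class>\<open>euclidean_space\<close> is not used for it because it excludes the zero-dimensional space, hence
  manifolds of dimension zero.
\<close>

type_synonym ('a, 'e) chart = "'a set \<times> ('a \<Rightarrow> 'e)"

definition is_chart :: "'a topology \<Rightarrow> ('a, 'e::real_normed_vector) chart \<Rightarrow> bool" where
  "is_chart M = (\<lambda>(U, \<phi>). openin M U \<and> open (\<phi> ` U) \<and>
     homeomorphic_map (subtopology M U) (top_of_set (\<phi> ` U)) \<phi>)"

definition smooth_atlas :: "'a topology \<Rightarrow> ('a, 'e::real_normed_vector) chart set \<Rightarrow> bool" where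
  "smooth_atlas M A \<longleftrightarrow>
     (\<forall>c\<in>A. is_chart M c) \<and>
     (\<Union>(U, \<phi>)\<in>A. U) = topspace M \<and>
     (\<forall>(U, \<phi>)\<in>A. \<forall>(V, \<psi>)\<in>A. smooth_on (\<phi> ` (U \<inter> V)) (\<psi> \<circ> inv_into U \<phi>))"

text \<open>
  The atlas need not be maximal: all notions below are the same for any atlas defining the same
  smooth structure. Closed means compact and without boundary; charts are onto open sets of \<open>'e\<close>,
  so there is no boundary.
\<close>

definition closed_smooth_manifold ::
    "'a topology \<Rightarrow> ('a, 'e::real_normed_vector) chart set \<Rightarrow> bool" where
  "closed_smooth_manifold M A \<longleftrightarrow>
     (\<exists>B::'e set. finite B \<and> span B = UNIV) \<and>
     Hausdorff_space M \<and> second_countable M \<and> compact_space M \<and> smooth_atlas M A"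

definition Ck_function ::
    "nat \<Rightarrow> ('a, 'e::real_normed_vector) chart set \<Rightarrow> ('a \<Rightarrow> real) \<Rightarrow> bool" where
  "Ck_function k A f \<longleftrightarrow> (\<forall>(U, \<phi>)\<in>A. Ck_on k (\<phi> ` U) (f \<circ> inv_into U \<phi>))"

definition smooth_function ::
    "('a, 'e::real_normed_vector) chart set \<Rightarrow> ('a \<Rightarrow> real) \<Rightarrow> bool" where
  "smooth_function A f \<longleftrightarrow> (\<forall>(U, \<phi>)\<in>A. smooth_on (\<phi> ` U) (f \<circ> inv_into U \<phi>))"

text \<open>By the chain rule, the choice of the chart around \<open>p\<close> is irrelevant.\<close>

definition critical_point ::
    "('a, 'e::real_normed_vector) chart set \<Rightarrow> ('a \<Rightarrow> real) \<Rightarrow> 'a \<Rightarrow> bool" where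
  "critical_point A f p \<longleftrightarrow>
     (\<exists>(U, \<phi>)\<in>A. p \<in> U \<and> ((f \<circ> inv_into U \<phi>) has_derivative (\<lambda>_. 0)) (at (\<phi> p)))"

definition critical_values ::
    "'a topology \<Rightarrow> ('a, 'e::real_normed_vector) chart set \<Rightarrow> ('a \<Rightarrow> real) \<Rightarrow> real set" where
  "critical_values M A f = f ` {p \<in> topspace M. critical_point A f p}"

definition Reeb_function ::
    "'a topology \<Rightarrow> ('a, 'e::real_normed_vector) chart set \<Rightarrow> real \<Rightarrow> real \<Rightarrow> ('a \<Rightarrow> real) \<Rightarrow> bool" where
  "Reeb_function M A a b f \<longleftrightarrow>
     a < b \<and> f \<in> topspace M \<rightarrow> {a..b} \<and> (\<exists>k\<ge>2. Ck_function k A f) \<and>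
     critical_values M A f = {a, b}"

section \<open>Smooth triangulations\<close>

text \<open>
  \<open>h\<close> is a smooth triangulation in the sense of Whitehead: a homeomorphism from the polyhedron of
  a finite simplicial complex \<open>K\<close> onto \<open>M\<close> whose restriction to every closed simplex \<open>S\<close> is smooth
  with injective differential. Smoothness on the closed simplex \<open>S\<close> at \<open>x\<close> means that, in a chart,
  the map extends from \<open>S\<close> to a smooth map \<open>g\<close> on a neighbourhood \<open>W\<close> of \<open>x\<close> in the ambient space;
  the span of the differences \<open>y - x\<close> is the direction space of the affine hull of \<open>S\<close>.
  Such triangulations define the piecewise linear structure underlying the smooth manifold.
\<close>

definition smooth_triangulation ::
    "'a topology \<Rightarrow> ('a, 'e::real_normed_vector) chart set \<Rightarrow>
     'b::euclidean_space set set \<Rightarrow> ('b \<Rightarrow> 'a) \<Rightarrow> bool" where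
  "smooth_triangulation M A K h \<longleftrightarrow>
     simplicial_complex K \<and>
     homeomorphic_map (top_of_set (\<Union>K)) M h \<and>
     (\<forall>S\<in>K. \<forall>x\<in>S. \<exists>(U, \<phi>)\<in>A. \<exists>W g.
        open W \<and> x \<in> W \<and> h ` (S \<inter> W) \<subseteq> U \<and>
        smooth_on W g \<and> (\<forall>y \<in> S \<inter> W. g y = \<phi> (h y)) \<and>
        inj_on (frechet_derivative g (at x)) (span ((\<lambda>y. y - x) ` S)))"

text \<open>
  \<open>X\<close> is a subcomplex of \<open>M\<close> with respect to the triangulation \<open>h\<close> by \<open>K\<close>, given by the
  subcomplex \<open>L\<close> of \<open>K\<close>. Finiteness is part of \<^const>\<open>simplicial_complex\<close>.
\<close>

definition simplicial_subcomplex_via ::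
    "'a topology \<Rightarrow> ('a, 'e::real_normed_vector) chart set \<Rightarrow>
     'b::euclidean_space set set \<Rightarrow> ('b \<Rightarrow> 'a) \<Rightarrow> 'b set set \<Rightarrow> 'a set \<Rightarrow> bool" where
  "simplicial_subcomplex_via M A K h L X \<longleftrightarrow>
     smooth_triangulation M A K h \<and> simplicial_complex L \<and> L \<subseteq> K \<and> X = h ` (\<Union>L)"

end

theory Submission
  imports Defs
begin

text \<open>
  In barycentric coordinates let \<open>u\<close> be the sum, over all simplices outside \<open>L\<close>, of the
  product of the coordinates belonging to the vertices of the simplex. It vanishes exactly on the
  polyhedron of \<open>L\<close>, and at every other point close to it there is a direction, tangent to all
  simplices containing the point, along which \<open>u\<close> grows. Since the triangulation is an immersion
  on every closed simplex, the continuous function \<open>u \<circ> h\<^sup>-\<^sup>1\<close> grows at a definite rate along a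
  whole open cone of directions at every point near \<open>X\<close>.

  This property survives mollification in charts and averaging with a partition of unity, so
  there are smooth functions uniformly close to \<open>u \<circ> h\<^sup>-\<^sup>1\<close> that increase along the same
  directions on any given region \<open>0 < a \<le> u \<le> b\<close>. Composing them with smooth steps located at
  levels tending to \<open>0\<close> and summing with rapidly decreasing weights gives a function that is
  smooth everywhere, \<open>0\<close> exactly on \<open>X\<close>, constantly \<open>1\<close> away from \<open>X\<close> and has nonzero
  differential in between.
\<close>

subsection \<open>Calculus of smooth maps\<close>

text \<open>The function obtained from barycentric coordinates is smooth on each simplex but need
  not be differentiable across the walls between them, so growth is phrased by increments: from any
  point near q, a step s along any direction near v gains at least c s. Quantifying over nearby
  points lets this survive averaging; quantifying over nearby directions lets it survive nonlinear
  changes of coordinates. No lower bound for the rate c is available up to X, so a single smoothing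
  does not suffice; the n-th of infinitely many is used only at levels comparable to
  \<open>(1 / 4) ^ n\<close>. Several smoothings may be active at one point and their differentials
  could cancel in the sum. They do not, because the direction v comes from the original function
  alone, so all sufficiently fine smoothings grow along it; compactness of each band of levels turns
  "sufficiently fine" into finitely many conditions for each n. The transitions overlap, so every
  point outside X is regular or has value 1, and points of value 1 are maxima, hence legitimately
  critical.\<close>

lemma Ck_on_cong:
  assumes "open S" and "\<And>x. x \<in> S \<Longrightarrow> f x = g x"
  shows "Ck_on k S f \<longleftrightarrow> Ck_on k S g"
  using assms(2)
proof (induction k arbitrary: f g)
  case 0
  then show ?case by (simp cong: continuous_on_cong)
next
  case (Suc k)
  have hd: "(f has_derivative D) (at x) \<longleftrightarrow> (g has_derivative D) (at x)" if "x \<in> S" for x D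
    using has_derivative_transform_within_open[OF _ assms(1) that, of f D UNIV g]
      has_derivative_transform_within_open[OF _ assms(1) that, of g D UNIV f] Suc.prems by auto
  have fd: "frechet_derivative f (at x) = frechet_derivative g (at x)" if "x \<in> S" for x
    unfolding frechet_derivative_def hd[OF that] ..
  have df: "f differentiable (at x) \<longleftrightarrow> g differentiable (at x)" if "x \<in> S" for x
    unfolding differentiable_def hd[OF that] ..
  have "Ck_on k S (\<lambda>x. frechet_derivative f (at x) v) \<longleftrightarrow> Ck_on k S (\<lambda>x. frechet_derivative g (at x) v)" for v
    by (rule Suc.IH) (simp add: fd)
  then show ?case by (simp add: df)
qed

lemma Ck_on_subset: "Ck_on k S f \<Longrightarrow> T \<subseteq> S \<Longrightarrow> Ck_on k T f"
  by (induction k arbitrary: f) (auto intro: continuous_on_subset)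

lemma Ck_on_local:
  assumes "\<And>x. x \<in> S \<Longrightarrow> \<exists>T. open T \<and> x \<in> T \<and> Ck_on k T f"
  shows "Ck_on k S f"
  using assms
proof (induction k arbitrary: f)
  case 0
  have "isCont f x" if "x \<in> S" for x
    using 0[OF that] continuous_on_eq_continuous_at by auto
  then show ?case by (simp add: continuous_at_imp_continuous_on)
next
  case (Suc k)
  have "f differentiable (at x)" if "x \<in> S" for x
    using Suc.prems[OF that] by auto
  moreover have "Ck_on k S (\<lambda>x. frechet_derivative f (at x) v)" for v
    by (rule Suc.IH) (use Suc.prems in fastforce)
  ultimately show ?case by simp
qed

text \<open>\<open>frechet_derivative\<close> is a choice operator; by uniqueness of derivatives any
  explicit formula may replace it. The closure properties below then only have to exhibit a
  derivative built from functions of the same kind.\<close>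

lemma Ck_on_SucI:
  assumes "open S" and der: "\<And>x. x \<in> S \<Longrightarrow> (f has_derivative f' x) (at x)"
    and "\<And>v. Ck_on k S (\<lambda>x. f' x v)"
  shows "Ck_on (Suc k) S f"
proof -
  have "frechet_derivative f (at x) = f' x" if "x \<in> S" for x
    using frechet_derivative_at[OF der[OF that]] by simp
  then have "Ck_on k S (\<lambda>x. frechet_derivative f (at x) v)" for v
    using Ck_on_cong[OF assms(1), of "\<lambda>x. frechet_derivative f (at x) v" "\<lambda>x. f' x v" k] assms(3) by auto
  then show ?thesis using der by (auto simp: differentiable_def)
qed

lemma Ck_on_Suc_has_derivative:
  "Ck_on (Suc k) S f \<Longrightarrow> x \<in> S \<Longrightarrow> (f has_derivative frechet_derivative f (at x)) (at x)"
  by (simp add: frechet_derivative_works)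

lemma Ck_on_imp_continuous_on: "Ck_on k S f \<Longrightarrow> continuous_on S f"
proof (cases k)
  case (Suc n)
  moreover assume "Ck_on k S f"
  ultimately show ?thesis
    by (auto intro!: continuous_at_imp_continuous_on differentiable_imp_continuous_within)
qed simp

lemma Ck_on_Suc_imp: "Ck_on (Suc k) S f \<Longrightarrow> Ck_on k S f"
proof (induction k arbitrary: f)
  case 0
  then show ?case using Ck_on_imp_continuous_on[OF 0] by simp
next
  case (Suc k)
  from Suc.prems have "\<forall>x\<in>S. f differentiable (at x)" by simp
  moreover have "Ck_on k S (\<lambda>x. frechet_derivative f (at x) v)" for v
    using Suc.prems by (intro Suc.IH) simp
  ultimately show ?case by simp
qed

lemma Ck_on_const: "Ck_on k S (\<lambda>x. c)"
  by (induction k arbitrary: c) (auto simp: frechet_derivative_const)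

lemma Ck_on_linear_compose:
  assumes "bounded_linear L" "open S"
  shows "Ck_on k S f \<Longrightarrow> Ck_on k S (\<lambda>x. L (f x))"
proof (induction k arbitrary: f)
  case 0
  then show ?case
    using bounded_linear.continuous_on[OF assms(1)] by auto
next
  case (Suc k)
  show ?case
  proof (rule Ck_on_SucI[OF assms(2)])
    show "((\<lambda>x. L (f x)) has_derivative (\<lambda>v. L (frechet_derivative f (at x) v))) (at x)" if "x \<in> S" for x
      using bounded_linear.has_derivative[OF assms(1) Ck_on_Suc_has_derivative[OF Suc.prems that]] .
    show "Ck_on k S (\<lambda>x. L (frechet_derivative f (at x) v))" for v
      using Suc.prems by (intro Suc.IH) simp
  qed
qed

lemma Ck_on_bounded_linear:
  assumes "bounded_linear L" "open S"
  shows "Ck_on k S L"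
proof (cases k)
  case 0
  then show ?thesis using linear_continuous_on[OF assms(1)] by simp
next
  case (Suc n)
  show ?thesis unfolding Suc
    by (rule Ck_on_SucI[OF assms(2)])
       (auto intro: bounded_linear_imp_has_derivative[OF assms(1)] Ck_on_const)
qed

lemma Ck_on_add:
  assumes "open S"
  shows "Ck_on k S f \<Longrightarrow> Ck_on k S g \<Longrightarrow> Ck_on k S (\<lambda>x. f x + g x)"
proof (induction k arbitrary: f g)
  case 0
  then show ?case by (auto intro: continuous_intros)
next
  case (Suc k)
  show ?case
  proof (rule Ck_on_SucI[OF assms])
    show "((\<lambda>x. f x + g x) has_derivative (\<lambda>v. frechet_derivative f (at x) v + frechet_derivative g (at x) v)) (at x)"
      if "x \<in> S" for x
      using has_derivative_add[OF Suc.prems(1)[THEN Ck_on_Suc_has_derivative, OF that] Suc.prems(2)[THEN Ck_on_Suc_has_derivative, OF that]] .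
    show "Ck_on k S (\<lambda>x. frechet_derivative f (at x) v + frechet_derivative g (at x) v)" for v
      using Suc.prems by (intro Suc.IH) simp_all
  qed
qed

lemma Ck_on_sum:
  assumes "open S" "\<And>i. i \<in> I \<Longrightarrow> Ck_on k S (f i)"
  shows "Ck_on k S (\<lambda>x. \<Sum>i\<in>I. f i x)"
  using assms(2)
  by (induction I rule: infinite_finite_induct) (auto intro: Ck_on_const Ck_on_add[OF assms(1)])

lemma Ck_on_bilinear:
  assumes "bounded_bilinear B" "open S"
  shows "Ck_on k S f \<Longrightarrow> Ck_on k S g \<Longrightarrow> Ck_on k S (\<lambda>x. B (f x) (g x))"
proof (induction k arbitrary: f g)
  case 0
  then show ?case by (auto intro: bounded_bilinear.continuous_on[OF assms(1)])
next
  case (Suc k)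
  show ?case
  proof (rule Ck_on_SucI[OF assms(2)])
    show "((\<lambda>x. B (f x) (g x)) has_derivative
       (\<lambda>v. B (f x) (frechet_derivative g (at x) v) + B (frechet_derivative f (at x) v) (g x))) (at x)"
      if "x \<in> S" for x
      using bounded_bilinear.FDERIV[OF assms(1) Suc.prems(1)[THEN Ck_on_Suc_has_derivative, OF that] Suc.prems(2)[THEN Ck_on_Suc_has_derivative, OF that]] .
    show "Ck_on k S (\<lambda>x. B (f x) (frechet_derivative g (at x) v) + B (frechet_derivative f (at x) v) (g x))" for v
      using Suc.prems by (intro Ck_on_add[OF assms(2)] Suc.IH Ck_on_Suc_imp[of k S f] Ck_on_Suc_imp[of k S g]) simp_all
  qed
qed

lemmas Ck_on_mult = Ck_on_bilinear[OF bounded_bilinear_mult]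

text \<open>Kept apart from general composition because no basis enters: the inner derivative is the
  constant map \<open>R\<close>, so the direction \<open>R v\<close> does not move with x. This is
  what relates an abstract model space to a Euclidean one.\<close>

lemma Ck_on_precompose_linear:
  assumes "bounded_linear R" "open S"
  shows "Ck_on k T f \<Longrightarrow> R ` S \<subseteq> T \<Longrightarrow> Ck_on k S (\<lambda>x. f (R x))"
proof (induction k arbitrary: f)
  case 0
  then show ?case
    by (auto intro!: continuous_on_compose2[of T f S R] linear_continuous_on[OF assms(1)])
next
  case (Suc k)
  show ?case
  proof (rule Ck_on_SucI[OF assms(2)])
    show "((\<lambda>x. f (R x)) has_derivative (\<lambda>v. frechet_derivative f (at (R x)) (R v))) (at x)" if "x \<in> S" for x
      using has_derivative_compose[OF bounded_linear_imp_has_derivative[OF assms(1)] Ck_on_Suc_has_derivative[OF Suc.prems(1)]]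
        Suc.prems(2) that by auto
    show "Ck_on k S (\<lambda>x. frechet_derivative f (at (R x)) (R v))" for v
      using Suc.prems Suc.IH[of "\<lambda>x. frechet_derivative f (at x) (R v)"] by simp
  qed
qed

lemma linear_sum_Basis:
  fixes D :: "'c::euclidean_space \<Rightarrow> 'd::real_vector"
  assumes "linear D" shows "D h = (\<Sum>b\<in>Basis. (h \<bullet> b) *\<^sub>R D b)"
proof -
  have "D h = D (\<Sum>b\<in>Basis. (h \<bullet> b) *\<^sub>R b)" by (simp add: euclidean_representation)
  also have "\<dots> = (\<Sum>b\<in>Basis. (h \<bullet> b) *\<^sub>R D b)"
    using assms by (simp only: linear_sum linear_scale)
  finally show ?thesis .
qed

text \<open>In the chain rule the outer derivative is taken along a direction that varies with x,
  whereas the induction hypothesis speaks about fixed directions. Expanding the varying direction in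
  the basis of the intermediate space leaves a finite sum of products with fixed directions; this is
  where that space has to be Euclidean.\<close>

lemma Ck_on_compose:
  fixes g :: "'c::real_normed_vector \<Rightarrow> 'd::euclidean_space" and f :: "'d \<Rightarrow> 'w::real_normed_vector"
  assumes "open S" "open T"
  shows "Ck_on k T f \<Longrightarrow> Ck_on k S g \<Longrightarrow> g ` S \<subseteq> T \<Longrightarrow> Ck_on k S (\<lambda>x. f (g x))"
proof (induction k arbitrary: f)
  case 0
  then show ?case by (auto intro!: continuous_on_compose2[of T f S g])
next
  case (Suc k)
  let ?Df = "\<lambda>x. frechet_derivative f (at x)" and ?Dg = "\<lambda>x. frechet_derivative g (at x)"
  have g: "Ck_on k S g" using Suc.prems(2) by (rule Ck_on_Suc_imp)
  show ?case
  proof (rule Ck_on_SucI[OF assms(1)])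
    fix x assume x: "x \<in> S"
    then have fx: "(f has_derivative ?Df (g x)) (at (g x))"
      using Suc.prems by (auto intro!: Ck_on_Suc_has_derivative[of k T])
    have gx: "(g has_derivative ?Dg x) (at x)"
      using Suc.prems x by (auto intro!: Ck_on_Suc_has_derivative[of k S])
    note rep = linear_sum_Basis[OF has_derivative_linear[OF fx]]
    show "((\<lambda>x. f (g x)) has_derivative (\<lambda>v. \<Sum>b\<in>Basis. (?Dg x v \<bullet> b) *\<^sub>R ?Df (g x) b)) (at x)"
      by (intro has_derivative_eq_rhs[OF has_derivative_compose[OF gx fx]] ext rep)
  next
    fix v
    show "Ck_on k S (\<lambda>x. \<Sum>b\<in>Basis. (?Dg x v \<bullet> b) *\<^sub>R ?Df (g x) b)"
    proof (intro Ck_on_sum[OF assms(1)] Ck_on_bilinear[OF bounded_bilinear_scaleR assms(1)])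
      fix b :: 'd
      show "Ck_on k S (\<lambda>x. ?Dg x v \<bullet> b)"
        by (rule Ck_on_linear_compose[OF bounded_linear_inner_left assms(1)]) (use Suc.prems in simp)
      show "Ck_on k S (\<lambda>x. ?Df (g x) b)"
        by (rule Suc.IH) (use Suc.prems g in simp_all)
    qed
  qed
qed

lemma Ck_on_inverse: "Ck_on k (- {0::real}) inverse"
proof (induction k)
  case 0
  then show ?case by (auto intro: continuous_intros)
next
  case (Suc k)
  have o: "open (- {0::real})" by auto
  show ?case
  proof (rule Ck_on_SucI[OF o])
    show "(inverse has_derivative (\<lambda>h. - (inverse x * h * inverse x))) (at x)" if "x \<in> - {0::real}" for x
      using has_derivative_inverse'[of x UNIV] that by simp
    have *: "Ck_on k (- {0::real}) (\<lambda>x. (- v) *\<^sub>R (inverse x * inverse x))" for v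
      by (intro Ck_on_linear_compose[OF bounded_linear_scaleR_right o] Ck_on_mult o Suc.IH)
    show "Ck_on k (- {0::real}) (\<lambda>x. - (inverse x * v * inverse x))" for v
      using *[of v] by (simp add: mult_ac)
  qed
qed

section \<open>Closure properties of smooth maps\<close>

lemma smooth_onD: "smooth_on S f \<Longrightarrow> x \<in> S \<Longrightarrow> (f has_derivative frechet_derivative f (at x)) (at x)"
  unfolding smooth_on_def using Ck_on_Suc_has_derivative by blast

lemma smooth_on_continuous_on: "smooth_on S f \<Longrightarrow> continuous_on S f"
  unfolding smooth_on_def using Ck_on_imp_continuous_on by blast

lemma smooth_on_deriv: "smooth_on S f \<Longrightarrow> smooth_on S (\<lambda>x. frechet_derivative f (at x) v)"
  unfolding smooth_on_def by (metis Ck_on.simps(2))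

lemma smooth_on_subset: "smooth_on S f \<Longrightarrow> T \<subseteq> S \<Longrightarrow> smooth_on T f"
  unfolding smooth_on_def using Ck_on_subset by blast

lemma smooth_on_cong: "open S \<Longrightarrow> (\<And>x. x \<in> S \<Longrightarrow> f x = g x) \<Longrightarrow> smooth_on S f \<longleftrightarrow> smooth_on S g"
  unfolding smooth_on_def using Ck_on_cong by blast

lemma smooth_on_local:
  "(\<And>x. x \<in> S \<Longrightarrow> \<exists>T. open T \<and> x \<in> T \<and> smooth_on T f) \<Longrightarrow> smooth_on S f"
  unfolding smooth_on_def by (meson Ck_on_local)

lemma smooth_on_const: "smooth_on S (\<lambda>x. c)"
  unfolding smooth_on_def using Ck_on_const by blast

lemma smooth_on_add: "open S \<Longrightarrow> smooth_on S f \<Longrightarrow> smooth_on S g \<Longrightarrow> smooth_on S (\<lambda>x. f x + g x)"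
  unfolding smooth_on_def using Ck_on_add by blast

lemma smooth_on_sum: "open S \<Longrightarrow> (\<And>i. i \<in> I \<Longrightarrow> smooth_on S (f i)) \<Longrightarrow> smooth_on S (\<lambda>x. \<Sum>i\<in>I. f i x)"
  unfolding smooth_on_def by (auto intro!: Ck_on_sum)

lemma smooth_on_mult:
  fixes f g :: "'c::real_normed_vector \<Rightarrow> real"
  shows "open S \<Longrightarrow> smooth_on S f \<Longrightarrow> smooth_on S g \<Longrightarrow> smooth_on S (\<lambda>x. f x * g x)"
  unfolding smooth_on_def using Ck_on_mult by blast

lemma smooth_on_bounded_linear: "bounded_linear L \<Longrightarrow> open S \<Longrightarrow> smooth_on S L"
  unfolding smooth_on_def using Ck_on_bounded_linear by blast

lemma smooth_on_linear_compose: "bounded_linear L \<Longrightarrow> open S \<Longrightarrow> smooth_on S f \<Longrightarrow> smooth_on S (\<lambda>x. L (f x))"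
  unfolding smooth_on_def using Ck_on_linear_compose by blast

lemma smooth_on_precompose_linear:
  "bounded_linear R \<Longrightarrow> open S \<Longrightarrow> smooth_on T f \<Longrightarrow> R ` S \<subseteq> T \<Longrightarrow> smooth_on S (\<lambda>x. f (R x))"
  unfolding smooth_on_def using Ck_on_precompose_linear by blast

lemma smooth_on_compose:
  fixes g :: "'c::real_normed_vector \<Rightarrow> 'd::euclidean_space"
  shows "open S \<Longrightarrow> open T \<Longrightarrow> smooth_on T f \<Longrightarrow> smooth_on S g \<Longrightarrow> g ` S \<subseteq> T \<Longrightarrow> smooth_on S (\<lambda>x. f (g x))"
  unfolding smooth_on_def using Ck_on_compose by blast

lemma smooth_on_inverse:
  fixes f :: "'c::real_normed_vector \<Rightarrow> real"
  assumes "open S" "smooth_on S f" "\<And>x. x \<in> S \<Longrightarrow> f x \<noteq> 0"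
  shows "smooth_on S (\<lambda>x. inverse (f x))"
  by (rule smooth_on_compose[where T = "- {0}"]) (use assms Ck_on_inverse in \<open>auto simp: smooth_on_def\<close>)

lemma smooth_on_divide:
  fixes f g :: "'c::real_normed_vector \<Rightarrow> real"
  assumes "open S" "smooth_on S f" "smooth_on S g" "\<And>x. x \<in> S \<Longrightarrow> g x \<noteq> 0"
  shows "smooth_on S (\<lambda>x. f x / g x)"
  unfolding divide_inverse by (intro smooth_on_mult smooth_on_inverse assms)

subsection \<open>Smooth steps and bumps\<close>

text \<open>The family is closed under differentiation, which makes every member smooth.\<close>

definition flat :: "nat \<Rightarrow> real \<Rightarrow> real" where
  "flat m t = (if t > 0 then inverse t ^ m * exp (- inverse t) else 0)"

lemma flat_nonneg: "flat m t \<ge> 0" by (simp add: flat_def)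
lemma flat_pos: "t > 0 \<Longrightarrow> flat m t > 0" by (simp add: flat_def)
lemma flat_zero: "t \<le> 0 \<Longrightarrow> flat m t = 0" by (simp add: flat_def)

lemma power_times_exp_minus_tendsto_0: "((\<lambda>s::real. s ^ m * exp (- s)) \<longlongrightarrow> 0) at_top"
  using tendsto_power_div_exp_0[of m] by (simp add: exp_minus divide_inverse)

lemma flat_tendsto_0: "(flat m \<longlongrightarrow> 0) (at 0)"
proof -
  have "((\<lambda>t. inverse t ^ m * exp (- inverse t)) \<longlongrightarrow> 0) (at_right (0::real))"
    using filterlim_compose[OF power_times_exp_minus_tendsto_0 filterlim_inverse_at_top_right] .
  moreover have "eventually (\<lambda>t. inverse t ^ m * exp (- inverse t) = flat m t) (at_right 0)"
    by (auto simp: eventually_at_filter flat_def)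
  ultimately have "(flat m \<longlongrightarrow> 0) (at_right 0)" by (rule Lim_transform_eventually)
  moreover have "(flat m \<longlongrightarrow> 0) (at_left 0)"
    by (rule Lim_transform_eventually[OF tendsto_const]) (auto simp: eventually_at_filter flat_def)
  ultimately show ?thesis using filterlim_split_at by blast
qed

lemma flat_deriv: "(flat m has_real_derivative (flat (m + 2) t - m * flat (m + 1) t)) (at t)"
proof (cases t "0::real" rule: linorder_cases)
  case less
  have "((\<lambda>t. 0) has_real_derivative 0) (at t)" by simp
  then have "(flat m has_real_derivative 0) (at t)"
    by (rule has_field_derivative_transform_within_open[of _ _ _ "{..<0}"]) (use less in \<open>auto simp: flat_def\<close>)
  then show ?thesis using less by (simp add: flat_def)
next
  case greater
  have "((\<lambda>t. inverse t ^ m * exp (- inverse t)) has_real_derivative (flat (m + 2) t - m * flat (m + 1) t)) (at t)"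
    using greater
    apply (auto intro!: derivative_eq_intros simp: flat_def power2_eq_square algebra_simps)
    apply (cases m; simp add: algebra_simps power2_eq_square)
    done
  then show ?thesis
    by (rule has_field_derivative_transform_within_open[of _ _ _ "{0<..}"]) (use greater in \<open>auto simp: flat_def\<close>)
next
  case equal
  \<comment> \<open>The difference quotient of \<open>flat m\<close> at 0 is
    \<open>flat (m + 1)\<close>, whose limit is already known.\<close>
  have "((\<lambda>h. (flat m (0 + h) - flat m 0) / h) \<longlongrightarrow> 0) (at 0)"
    using flat_tendsto_0[of "m + 1"]
    by (rule Lim_transform_eventually) (auto simp: eventually_at_filter flat_def field_simps)
  then show ?thesis using equal by (simp add: DERIV_def flat_def)
qed

lemma Ck_on_flat: "Ck_on k UNIV (flat m)"
proof (induction k arbitrary: m)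
  case 0
  show ?case using flat_deriv[THEN DERIV_isCont] by (simp add: continuous_at_imp_continuous_on)
next
  case (Suc k)
  show ?case
  proof (rule Ck_on_SucI)
    show "(flat m has_derivative (\<lambda>v. v * (flat (m + 2) x + (- real m) * flat (m + 1) x))) (at x)" for x
      using flat_deriv[of m x] by (simp add: has_field_derivative_def mult.commute[of _ "_ - _"])
    show "Ck_on k UNIV (\<lambda>x. v * (flat (m + 2) x + (- real m) * flat (m + 1) x))" for v
      by (intro Ck_on_mult Ck_on_add Ck_on_const Suc.IH) auto
  qed simp
qed

lemma smooth_on_flat: "smooth_on S (flat m)"
  unfolding smooth_on_def using Ck_on_flat Ck_on_subset by blast

definition step :: "real \<Rightarrow> real \<Rightarrow> real \<Rightarrow> real" where
  "step a b t = flat 0 (t - a) / (flat 0 (t - a) + flat 0 (b - t))"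

lemma step_denominator_pos: "a < b \<Longrightarrow> flat 0 (t - a) + flat 0 (b - t) > 0"
  using flat_pos[of "t - a" 0] flat_pos[of "b - t" 0] flat_nonneg[of 0 "t - a"] flat_nonneg[of 0 "b - t"]
  by (cases "t > a"; fastforce)

lemma step_range: "a < b \<Longrightarrow> 0 \<le> step a b t" "a < b \<Longrightarrow> step a b t \<le> 1"
  using step_denominator_pos[of a b t] flat_nonneg[of 0 "t - a"] flat_nonneg[of 0 "b - t"]
  by (auto simp: step_def divide_simps)

lemma step_eq_0: "t \<le> a \<Longrightarrow> step a b t = 0" by (simp add: step_def flat_zero)
lemma step_pos: "a < b \<Longrightarrow> t > a \<Longrightarrow> step a b t > 0"
  using step_denominator_pos[of a b t] flat_pos[of "t - a" 0] by (auto simp: step_def)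
lemma step_eq_1: "a < b \<Longrightarrow> t \<ge> b \<Longrightarrow> step a b t = 1"
  using flat_pos[of "t - a" 0] by (simp add: step_def flat_zero[of "b - t"])

lemma smooth_on_translate_flat: "smooth_on UNIV (\<lambda>t. flat m (c * t + d))"
proof (rule smooth_on_compose[where T = UNIV and f = "flat m" and g = "\<lambda>t. c * t + d"])
  show "smooth_on UNIV (\<lambda>t. c * t + d)"
    by (intro smooth_on_add smooth_on_const smooth_on_bounded_linear bounded_linear_mult_right) auto
qed (auto intro: smooth_on_flat)

lemma smooth_on_step: "a < b \<Longrightarrow> smooth_on UNIV (step a b)"
  unfolding step_def
  using smooth_on_translate_flat[of 0 1 "-a"] smooth_on_translate_flat[of 0 "-1" b] step_denominator_pos[of a b]
  by (intro smooth_on_divide smooth_on_add) (auto simp: less_imp_neq[symmetric] add.commute)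

text \<open>The exact range of positivity is what counts later: a step contributes to a differential
  only where its argument lies strictly between the two levels, and there with a definite
  sign.\<close>

lemma step_deriv:
  assumes "a < b"
  obtains d where "(step a b has_real_derivative d) (at t)" "d \<ge> 0" "a < t \<Longrightarrow> t < b \<Longrightarrow> d > 0" "\<not> (a < t \<and> t < b) \<Longrightarrow> d = 0"
proof -
  let ?p = "flat 0 (t - a)" and ?q = "flat 0 (b - t)" and ?p' = "flat 2 (t - a)" and ?q' = "flat 2 (b - t)"
  have fl: "(flat 0 has_real_derivative flat 2 s) (at s)" for s
    using flat_deriv[of 0 s] by (simp add: numeral_2_eq_2)
  have p: "((\<lambda>t. flat 0 (t - a)) has_real_derivative ?p') (at t)"
    using DERIV_chain2[where g = "\<lambda>t. t - a" and x = t and s = UNIV, OF fl[of "t - a"], of 1]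
      DERIV_diff[OF DERIV_ident DERIV_const[of a]] by simp
  have q: "((\<lambda>t. flat 0 (b - t)) has_real_derivative - ?q') (at t)"
    using DERIV_chain2[where g = "\<lambda>t. b - t" and x = t and s = UNIV, OF fl[of "b - t"], of "-1"]
      DERIV_diff[OF DERIV_const[of b] DERIV_ident] by simp
  have pos: "?p + ?q > 0" by (rule step_denominator_pos[OF assms])
  \<comment> \<open>In the numerator of the quotient rule the two products \<open>?p' * ?p\<close>
    cancel, and only nonnegative summands remain.\<close>
  let ?d = "(?p' * ?q + ?p * ?q') / (?p + ?q)^2"
  have "(step a b has_real_derivative ?d) (at t)"
    unfolding step_def using pos
    by (auto intro!: derivative_eq_intros p q simp: power2_eq_square divide_simps) (simp add: algebra_simps)
  moreover have "?d \<ge> 0" using flat_nonneg by (intro divide_nonneg_nonneg add_nonneg_nonneg mult_nonneg_nonneg) auto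
  moreover have "?d > 0" if "a < t" "t < b"
    using that pos by (intro divide_pos_pos add_pos_pos mult_pos_pos flat_pos) auto
  moreover have "?d = 0" if "\<not> (a < t \<and> t < b)"
    using that by (auto simp: not_less flat_zero)
  ultimately show ?thesis using that by blast
qed

section \<open>Smooth bump functions on balls\<close>

lemma smooth_on_norm_square: "smooth_on S (\<lambda>x::'c::real_inner. c - (x - a) \<bullet> (x - a))"
proof -
  have l: "smooth_on UNIV (\<lambda>x. x - a)"
    using smooth_on_add[of UNIV "\<lambda>x. x" "\<lambda>x. - a"] by (simp add: smooth_on_const smooth_on_bounded_linear)
  have "smooth_on UNIV (\<lambda>x. (x - a) \<bullet> (x - a))"
    using l Ck_on_bilinear[OF bounded_bilinear_inner open_UNIV] unfolding smooth_on_def by blast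
  then have "smooth_on UNIV (\<lambda>x. c + - ((x - a) \<bullet> (x - a)))"
    by (intro smooth_on_add smooth_on_const smooth_on_linear_compose[OF bounded_linear_minus[OF bounded_linear_ident]]) auto
  then show ?thesis using smooth_on_subset by force
qed

definition bump :: "'c::real_inner \<Rightarrow> real \<Rightarrow> 'c \<Rightarrow> real" where
  "bump a r x = flat 0 (r\<^sup>2 - (x - a) \<bullet> (x - a))"

lemma smooth_on_bump: "smooth_on S (bump a r)"
  unfolding bump_def
  using smooth_on_compose[OF open_UNIV open_UNIV smooth_on_flat smooth_on_norm_square] smooth_on_subset by blast

lemma bump_nonneg: "bump a r x \<ge> 0" by (simp add: bump_def flat_nonneg)

lemma bump_pos_iff: "r > 0 \<Longrightarrow> bump a r x > 0 \<longleftrightarrow> dist a x < r"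
proof -
  assume "r > 0"
  have "dist a x < r \<longleftrightarrow> (x - a) \<bullet> (x - a) < r\<^sup>2"
    unfolding dist_norm norm_minus_commute[of a x] dot_square_norm
    using \<open>r > 0\<close> power_strict_mono[of "norm (x - a)" r 2] power2_less_imp_less[of "norm (x - a)" r] by auto
  then show ?thesis
    unfolding bump_def using flat_pos[of "r\<^sup>2 - (x - a) \<bullet> (x - a)" 0] flat_zero[of "r\<^sup>2 - (x - a) \<bullet> (x - a)" 0] by fastforce
qed

subsection \<open>Strict differentiability and increasing directions\<close>

text \<open>Both points of the estimate vary, unlike in \<open>has_derivative\<close>. The growth
  conditions below compare two arbitrary points near x, and the injectivity of a differential on a
  simplex is exploited for such pairs.\<close>

definition strict_derivative ::
    "('c::real_normed_vector \<Rightarrow> 'd::real_normed_vector) \<Rightarrow> ('c \<Rightarrow> 'd) \<Rightarrow> 'c \<Rightarrow> bool" where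
  "strict_derivative f D x \<longleftrightarrow> bounded_linear D \<and>
     (\<forall>e>0. \<exists>d>0. \<forall>y\<in>ball x d. \<forall>z\<in>ball x d. norm (f y - f z - D (y - z)) \<le> e * norm (y - z))"

lemma strict_derivativeE:
  assumes "strict_derivative f D x" "e > 0"
  obtains d where "d > 0" "\<And>y z. y \<in> ball x d \<Longrightarrow> z \<in> ball x d \<Longrightarrow> norm (f y - f z - D (y - z)) \<le> e * norm (y - z)"
  using assms unfolding strict_derivative_def by meson

text \<open>Continuity of the finitely many partial derivatives makes the derivative continuous in
  the operator norm; the mean value inequality on a ball, which contains the segments between its
  points, then gives the two-point estimate.\<close>

lemma smooth_on_strict_derivative:
  fixes f :: "'c::euclidean_space \<Rightarrow> 'd::real_normed_vector"
  assumes "smooth_on S f" "open S" "x \<in> S"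
  shows "strict_derivative f (frechet_derivative f (at x)) x"
  unfolding strict_derivative_def
proof (intro conjI allI impI)
  let ?D = "\<lambda>y. frechet_derivative f (at y)"
  have der: "(f has_derivative ?D y) (at y)" if "y \<in> S" for y
    using smooth_onD[OF assms(1) that] .
  then show "bounded_linear (?D x)" using assms(3) has_derivative_bounded_linear by blast
  fix e :: real assume "e > 0"
  define e' where "e' = e / DIM('c)"
  have e': "e' > 0" using \<open>e > 0\<close> by (simp add: e'_def)
  have "\<exists>d>0. \<forall>y\<in>ball x d. norm (?D y b - ?D x b) < e'" for b
  proof -
    have "continuous_on S (\<lambda>y. ?D y b)"
      using smooth_on_continuous_on[OF smooth_on_deriv[OF assms(1)]] .
    then have "isCont (\<lambda>y. ?D y b) x"
      using assms by (simp add: continuous_on_eq_continuous_at)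
    then show ?thesis using e' unfolding continuous_at_eps_delta
      by (metis dist_commute dist_norm mem_ball)
  qed
  then obtain d where d: "\<And>b. d b > 0" "\<And>b y. y \<in> ball x (d b) \<Longrightarrow> norm (?D y b - ?D x b) < e'"
    by metis
  obtain d0 where d0: "d0 > 0" "ball x d0 \<subseteq> S" using assms openE by blast
  define \<delta> where "\<delta> = Min (insert d0 (d ` Basis))"
  have \<delta>: "\<delta> > 0" "\<delta> \<le> d0" "\<And>b. b \<in> Basis \<Longrightarrow> \<delta> \<le> d b"
    using d(1) d0(1) by (auto simp: \<delta>_def intro: min.coboundedI2)
  have on: "onorm (?D y - ?D x) \<le> e" if y: "y \<in> ball x \<delta>" for y
  proof (rule onorm_bound)
    have yS: "y \<in> S" using y d0 \<delta> by auto
    fix v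
    have "linear (?D y - ?D x)"
      unfolding fun_diff_def
      using has_derivative_linear[OF der[OF yS]] has_derivative_linear[OF der[OF assms(3)]]
      by (rule linear_compose_sub)
    then have "(?D y - ?D x) v = (\<Sum>b\<in>Basis. (v \<bullet> b) *\<^sub>R (?D y - ?D x) b)"
      by (rule linear_sum_Basis)
    also have "norm \<dots> \<le> (\<Sum>b::'c\<in>Basis. norm v * e')"
    proof (rule sum_norm_le)
      fix b :: 'c assume b: "b \<in> Basis"
      have "norm ((?D y - ?D x) b) \<le> e'"
        using d(2)[of y b] y \<delta>(3)[OF b] by (auto intro: less_imp_le)
      then show "norm ((v \<bullet> b) *\<^sub>R (?D y - ?D x) b) \<le> norm v * e'"
        using Basis_le_norm[OF b, of v] by (auto intro!: mult_mono)
    qed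
    also have "\<dots> = e * norm v" by (simp add: e'_def)
    finally show "norm ((?D y - ?D x) v) \<le> e * norm v" .
  qed (use \<open>e > 0\<close> in simp)
  have "norm (f y - f z - ?D x (y - z)) \<le> e * norm (y - z)" if yz: "y \<in> ball x \<delta>" "z \<in> ball x \<delta>" for y z
  proof -
    have "norm (f y - f z - ?D x (y - z)) \<le> norm (y - z) * e"
    proof (rule differentiable_bound_linearization[where S = "ball x \<delta>"])
      show "z + t *\<^sub>R (y - z) \<in> ball x \<delta>" if "t \<in> {0..1}" for t
      proof -
        have "(1 - t) *\<^sub>R z + t *\<^sub>R y \<in> ball x \<delta>"
          using convexD_alt[OF convex_ball yz(2,1)] that by auto
        then show ?thesis by (simp add: algebra_simps)
      qed
      show "(f has_derivative ?D w) (at w within ball x \<delta>)" if "w \<in> ball x \<delta>" for w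
      proof -
        have "w \<in> S" using that d0 \<delta> by auto
        then show ?thesis using has_derivative_at_withinI[OF der] by blast
      qed
    qed (use on \<delta> in auto)
    then show ?thesis by (simp add: mult.commute)
  qed
  then show "\<exists>d>0. \<forall>y\<in>ball x d. \<forall>z\<in>ball x d. norm (f y - f z - ?D x (y - z)) \<le> e * norm (y - z)"
    using \<delta>(1) by blast
qed

lemma strict_derivative_imp_has_derivative:
  assumes "strict_derivative f D x" shows "(f has_derivative D) (at x)"
  unfolding has_derivative_at_alt
proof (intro conjI allI impI)
  show "bounded_linear D" using assms strict_derivative_def by blast
  fix e :: real assume "e > 0"
  then obtain d where "d > 0" "\<And>y z. y \<in> ball x d \<Longrightarrow> z \<in> ball x d \<Longrightarrow> norm (f y - f z - D (y - z)) \<le> e * norm (y - z)"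
    using strict_derivativeE[OF assms] by blast
  then show "\<exists>d>0. \<forall>y. norm (y - x) < d \<longrightarrow> norm (f y - f x - D (y - x)) \<le> e * norm (y - x)"
    by (intro exI[of _ d]) (auto simp: dist_norm norm_minus_commute)
qed

lemma strict_derivative_imp_isCont: "strict_derivative f D x \<Longrightarrow> isCont f x"
  using strict_derivative_imp_has_derivative has_derivative_continuous by blast

lemma strict_derivative_compose:
  assumes f: "strict_derivative f D x" and g: "strict_derivative g E (f x)"
  shows "strict_derivative (\<lambda>x. g (f x)) (\<lambda>v. E (D v)) x"
  unfolding strict_derivative_def
proof (intro conjI allI impI)
  have bD: "bounded_linear D" and bE: "bounded_linear E" using f g strict_derivative_def by auto
  then show "bounded_linear (\<lambda>v. E (D v))" by (rule bounded_linear_compose[rotated])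
  obtain KD where KD: "KD > 0" "\<And>v. norm (D v) \<le> norm v * KD" using bounded_linear.pos_bounded[OF bD] by blast
  obtain KE where KE: "KE > 0" "\<And>v. norm (E v) \<le> norm v * KE" using bounded_linear.pos_bounded[OF bE] by blast
  fix e :: real assume "e > 0"
  \<comment> \<open>The error of the composite is that of \<open>g\<close> plus \<open>E\<close>
    applied to that of \<open>f\<close>; \<open>e2\<close> and \<open>e1\<close> give each of them
    half of e. The cap 1 in \<open>e1\<close> makes \<open>KD + 1\<close> a Lipschitz constant of
    \<open>f\<close> near x.\<close>
  define e1 where "e1 = min 1 (e / (2 * KE))"
  define e2 where "e2 = e / (2 * (KD + 1))"
  have e12: "e1 > 0" "e2 > 0" using \<open>e > 0\<close> KD(1) KE(1) by (auto simp: e1_def e2_def)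
  obtain d1 where d1: "d1 > 0" "\<And>y z. y \<in> ball x d1 \<Longrightarrow> z \<in> ball x d1 \<Longrightarrow> norm (f y - f z - D (y - z)) \<le> e1 * norm (y - z)"
    using strict_derivativeE[OF f e12(1)] by blast
  obtain d2 where d2: "d2 > 0" "\<And>y z. y \<in> ball (f x) d2 \<Longrightarrow> z \<in> ball (f x) d2 \<Longrightarrow> norm (g y - g z - E (y - z)) \<le> e2 * norm (y - z)"
    using strict_derivativeE[OF g e12(2)] by blast
  obtain d3 where d3: "d3 > 0" "\<And>y. y \<in> ball x d3 \<Longrightarrow> f y \<in> ball (f x) d2"
    using strict_derivative_imp_isCont[OF f] d2(1) unfolding continuous_at_eps_delta
    by (metis dist_commute mem_ball)
  have "norm (g (f y) - g (f z) - E (D (y - z))) \<le> e * norm (y - z)"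
    if yz: "y \<in> ball x (min d1 d3)" "z \<in> ball x (min d1 d3)" for y z
  proof -
    let ?n = "norm (y - z)"
    have a: "norm (f y - f z - D (y - z)) \<le> e1 * ?n" using d1(2) yz by auto
    have "norm (f y - f z) \<le> norm (f y - f z - D (y - z)) + norm (D (y - z))"
      using norm_triangle_sub[of "f y - f z" "D (y - z)"] by linarith
    also have "\<dots> \<le> e1 * ?n + ?n * KD" using a KD(2)[of "y - z"] by linarith
    also have "\<dots> \<le> (KD + 1) * ?n"
      using mult_right_mono[of e1 1 ?n] by (auto simp: algebra_simps e1_def)
    finally have b: "norm (f y - f z) \<le> (KD + 1) * ?n" .
    have "norm (g (f y) - g (f z) - E (f y - f z)) \<le> e2 * norm (f y - f z)"
      using d2(2) d3(2) yz by auto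
    also have "\<dots> \<le> e2 * ((KD + 1) * ?n)" using b e12 by simp
    also have "\<dots> = e / 2 * ?n" using KD(1) by (simp add: e2_def field_simps)
    finally have c: "norm (g (f y) - g (f z) - E (f y - f z)) \<le> e / 2 * ?n" .
    have "norm (E (f y - f z - D (y - z))) \<le> e1 * ?n * KE"
      using KE(2)[of "f y - f z - D (y - z)"] a KE(1) by (meson mult_right_mono less_imp_le order_trans)
    also have "\<dots> \<le> e / (2 * KE) * ?n * KE"
      using KE(1) by (intro mult_right_mono) (auto simp: e1_def)
    also have "\<dots> = e / 2 * ?n" using KE(1) by (simp add: field_simps)
    finally have d: "norm (E (f y - f z - D (y - z))) \<le> e / 2 * ?n" .
    have "g (f y) - g (f z) - E (D (y - z)) = (g (f y) - g (f z) - E (f y - f z)) + E (f y - f z - D (y - z))"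
      using linear_diff[OF bounded_linear.linear[OF bE], of "f y - f z" "D (y - z)"] by simp
    then have "norm (g (f y) - g (f z) - E (D (y - z))) \<le> e / 2 * ?n + e / 2 * ?n"
      using norm_triangle_mono[OF c d] by (simp only:)
    then show ?thesis by simp
  qed
  then show "\<exists>d>0. \<forall>y\<in>ball x d. \<forall>z\<in>ball x d. norm (g (f y) - g (f z) - E (D (y - z))) \<le> e * norm (y - z)"
    using d1(1) d3(1) by (intro exI[of _ "min d1 d3"]) auto
qed

text \<open>
  A form of ``the derivative of \<open>F\<close> along \<open>v\<close> is at least \<open>c\<close> near \<open>z\<close>'' for functions that need
  not be differentiable; it is uniform in the direction, which makes it independent of coordinates.
\<close>

definition increasing_along :: "('c::real_normed_vector \<Rightarrow> real) \<Rightarrow> real \<Rightarrow> 'c \<Rightarrow> 'c \<Rightarrow> bool" where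
  "increasing_along F c v z \<longleftrightarrow>
     (\<exists>r>0. \<forall>x\<in>ball z r. \<forall>w\<in>ball v r. \<forall>s. 0 \<le> s \<and> s \<le> r \<longrightarrow> F x + c * s \<le> F (x + s *\<^sub>R w))"

lemma increasing_alongE:
  assumes "increasing_along F c v z"
  obtains r where "r > 0"
    "\<And>x w s. x \<in> ball z r \<Longrightarrow> w \<in> ball v r \<Longrightarrow> 0 \<le> s \<Longrightarrow> s \<le> r \<Longrightarrow> F x + c * s \<le> F (x + s *\<^sub>R w)"
  using assms unfolding increasing_along_def by metis

text \<open>Local hypotheses have to hold at the end of a step as well as at its start. The radius
  works because start and step together deviate by less than
  \<open>r * (norm v + 2)\<close>.\<close>

lemma short_step_in_ball:
  fixes v z :: "'c::real_normed_vector"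
  assumes "e > 0"
  obtains r where "r > 0" "r \<le> e" "r \<le> 1"
    "\<And>x w s. x \<in> ball z r \<Longrightarrow> w \<in> ball v r \<Longrightarrow> 0 \<le> s \<Longrightarrow> s \<le> r \<Longrightarrow> x + s *\<^sub>R w \<in> ball z e"
proof
  let ?r = "min 1 (e / (norm v + 3))"
  have pos: "norm v + 3 > 0" using norm_ge_zero[of v] by linarith
  have le: "e / (norm v + 3) \<le> e"
    using mult_left_mono[of 1 "norm v + 3" e] assms pos by (simp add: pos_divide_le_eq)
  show "?r > 0" using assms pos by simp
  show "?r \<le> e" using le by linarith
  show "?r \<le> 1" by simp
  fix x w s assume x: "x \<in> ball z ?r" and w: "w \<in> ball v ?r" and s: "0 \<le> s" "s \<le> ?r"
  have nw: "norm w \<le> norm v + 1"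
    using w norm_triangle_sub[of w v] by (auto simp: dist_norm norm_minus_commute)
  have "dist z (x + s *\<^sub>R w) \<le> dist z x + norm (s *\<^sub>R w)"
    using dist_triangle[of z "x + s *\<^sub>R w" x] by (simp add: dist_norm)
  also have "norm (s *\<^sub>R w) \<le> ?r * (norm v + 1)"
    using s nw by (auto intro!: mult_mono)
  finally have "dist z (x + s *\<^sub>R w) < ?r + ?r * (norm v + 1)" using x unfolding mem_ball by linarith
  also have "\<dots> = ?r * (norm v + 2)" by (simp add: algebra_simps)
  also have "\<dots> \<le> e / (norm v + 3) * (norm v + 2)" by (intro mult_right_mono) auto
  also have "\<dots> \<le> e" using assms pos by (simp add: field_simps)
  finally show "x + s *\<^sub>R w \<in> ball z e" by simp
qed

lemma increasing_along_cong:
  assumes F: "increasing_along F c v z" and e: "e > 0" and eq: "\<And>x. x \<in> ball z e \<Longrightarrow> G x = F x"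
  shows "increasing_along G c v z"
proof -
  obtain r where r: "r > 0" "\<And>x w s. x \<in> ball z r \<Longrightarrow> w \<in> ball v r \<Longrightarrow> 0 \<le> s \<Longrightarrow> s \<le> r \<Longrightarrow> F x + c * s \<le> F (x + s *\<^sub>R w)"
    using increasing_alongE[OF F] by blast
  obtain r' where r': "r' > 0" "r' \<le> e"
    "\<And>x w s. x \<in> ball z r' \<Longrightarrow> w \<in> ball v r' \<Longrightarrow> 0 \<le> s \<Longrightarrow> s \<le> r' \<Longrightarrow> x + s *\<^sub>R w \<in> ball z e"
    using short_step_in_ball[OF e, of z v] by metis
  show ?thesis unfolding increasing_along_def
    by (rule exI[of _ "min r r'"]) (use r r' eq in \<open>auto simp: eq\<close>)
qed

text \<open>A step with parameter s along w becomes a step with the same parameter along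
  \<open>u\<close>, the difference quotient of \<open>\<tau>\<close>, and strict differentiability
  puts \<open>u\<close> near \<open>D v\<close>. As \<open>u\<close> varies with the point and with
  s, growth along \<open>D v\<close> alone would not be enough.\<close>

lemma increasing_along_compose:
  assumes T: "strict_derivative \<tau> D z" and F: "increasing_along F c (D v) (\<tau> z)"
  shows "increasing_along (\<lambda>x. F (\<tau> x)) c v z"
proof -
  have bD: "bounded_linear D" using T strict_derivative_def by blast
  obtain K where K: "K > 0" "\<And>v. norm (D v) \<le> norm v * K" using bounded_linear.pos_bounded[OF bD] by blast
  obtain r where r: "r > 0"
    "\<And>x w s. x \<in> ball (\<tau> z) r \<Longrightarrow> w \<in> ball (D v) r \<Longrightarrow> 0 \<le> s \<Longrightarrow> s \<le> r \<Longrightarrow> F x + c * s \<le> F (x + s *\<^sub>R w)"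
    using increasing_alongE[OF F] by metis
  define e where "e = r / (2 * (norm v + 1))"
  have pv: "norm v + 1 > 0" using norm_ge_zero[of v] by linarith
  have e: "e > 0" using r(1) pv by (simp add: e_def)
  obtain d where d: "d > 0" "\<And>y x. y \<in> ball z d \<Longrightarrow> x \<in> ball z d \<Longrightarrow> norm (\<tau> y - \<tau> x - D (y - x)) \<le> e * norm (y - x)"
    using strict_derivativeE[OF T e] by blast
  obtain d' where d': "d' > 0" "\<And>y. y \<in> ball z d' \<Longrightarrow> \<tau> y \<in> ball (\<tau> z) r"
    using strict_derivative_imp_isCont[OF T] r(1) unfolding continuous_at_eps_delta
    by (metis dist_commute mem_ball)
  obtain q where q: "q > 0" "q \<le> min d d'" "q \<le> 1"
    "\<And>x w s. x \<in> ball z q \<Longrightarrow> w \<in> ball v q \<Longrightarrow> 0 \<le> s \<Longrightarrow> s \<le> q \<Longrightarrow> x + s *\<^sub>R w \<in> ball z (min d d')"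
    using short_step_in_ball[of "min d d'" z v] d(1) d'(1) by (metis min_less_iff_conj)
  define \<rho> where "\<rho> = min (min q r) (r / (2 * K))"
  have \<rho>: "\<rho> > 0" "\<rho> \<le> q" "\<rho> \<le> r" "\<rho> \<le> r / (2 * K)" using q(1) r(1) K(1) by (auto simp: \<rho>_def)
  have "F (\<tau> x) + c * s \<le> F (\<tau> (x + s *\<^sub>R w))"
    if x: "x \<in> ball z \<rho>" and w: "w \<in> ball v \<rho>" and s: "0 \<le> s" "s \<le> \<rho>" for x w s
  proof (cases "s = 0")
    case False
    then have s0: "s > 0" using s by simp
    have nw: "norm w < norm v + 1"
      using w \<rho> q(3) norm_triangle_sub[of w v] by (auto simp: dist_norm norm_minus_commute)
    have in1: "x \<in> ball z (min d d')" using x \<rho> q(2) by auto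
    have in2: "x + s *\<^sub>R w \<in> ball z (min d d')" using q(4)[of x w s] x w s \<rho> by auto
    define u where "u = (1 / s) *\<^sub>R (\<tau> (x + s *\<^sub>R w) - \<tau> x)"
    have "norm (\<tau> (x + s *\<^sub>R w) - \<tau> x - D (s *\<^sub>R w)) \<le> e * norm (s *\<^sub>R w)"
      using d(2)[of "x + s *\<^sub>R w" x] in1 in2 by simp
    then have "norm (s *\<^sub>R (u - D w)) \<le> s * (e * norm w)"
      using s0 linear_scale[OF bounded_linear.linear[OF bD], of s w] by (simp add: u_def algebra_simps)
    then have a: "norm (u - D w) \<le> e * norm w" using s0 by simp
    also have "e * norm w < e * (norm v + 1)" using nw e by simp
    also have "\<dots> = r / 2" using pv by (simp add: e_def field_simps)
    finally have a: "norm (u - D w) < r / 2" .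
    have "norm (D w - D v) \<le> norm (w - v) * K"
      using K(2)[of "w - v"] linear_diff[OF bounded_linear.linear[OF bD], of w v] by simp
    also have "\<dots> \<le> r / (2 * K) * K"
      using w \<rho> K(1) by (intro mult_right_mono) (auto simp: dist_norm norm_minus_commute)
    also have "\<dots> = r / 2" using K(1) by simp
    finally have "norm (D w - D v) \<le> r / 2" .
    then have "norm (u - D v) < r" using a norm_triangle_ineq[of "u - D w" "D w - D v"] by simp
    then have u: "u \<in> ball (D v) r" by (simp add: dist_norm norm_minus_commute)
    have "F (\<tau> x) + c * s \<le> F (\<tau> x + s *\<^sub>R u)"
      using r(2)[OF d'(2) u, of x s] in1 s \<rho> by auto
    then show ?thesis using s0 by (simp add: u_def)
  qed simp
  then show ?thesis unfolding increasing_along_def using \<rho>(1) by blast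
qed

lemma has_derivative_ge_of_increments:
  fixes F :: "'c::real_normed_vector \<Rightarrow> real"
  assumes "(F has_derivative D) (at x)" "r > 0"
    and "\<And>s. 0 < s \<Longrightarrow> s < r \<Longrightarrow> F x + c * s \<le> F (x + s *\<^sub>R w)"
  shows "c \<le> D w"
proof -
  have "((\<lambda>s. F (x + s *\<^sub>R w)) has_derivative (\<lambda>s. D (s *\<^sub>R w))) (at (0::real))"
    by (rule has_derivative_compose[of "\<lambda>s. x + s *\<^sub>R w" "\<lambda>s. s *\<^sub>R w"])
       (use assms(1) in \<open>auto intro!: derivative_eq_intros\<close>)
  moreover have "D (s *\<^sub>R w) = s * D w" for s
    using linear_scale[OF has_derivative_linear[OF assms(1)], of s w] by simp
  ultimately have "((\<lambda>s. F (x + s *\<^sub>R w)) has_real_derivative D w) (at 0)"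
    by (simp add: has_field_derivative_def mult_commute_abs)
  then have "((\<lambda>s. (F (x + s *\<^sub>R w) - F x) / s) \<longlongrightarrow> D w) (at_right 0)"
    unfolding DERIV_def by (auto intro: tendsto_within_subset)
  moreover have "eventually (\<lambda>s. c \<le> (F (x + s *\<^sub>R w) - F x) / s) (at_right 0)"
  proof -
    have "eventually (\<lambda>s. s \<in> {0<..<r}) (at_right (0::real))"
      using assms(2) eventually_at_right_real by blast
    then show ?thesis
    proof eventually_elim
      case (elim s)
      then show ?case using assms(3)[of s] by (simp add: field_simps)
    qed
  qed
  ultimately show ?thesis by (rule tendsto_lowerbound) simp
qed

subsection \<open>Mollification\<close>

text \<open>Under the integral all derivatives fall on the kernel, so continuity of \<open>W\<close>
  suffices. The derivative along v is an integral of the same form, with the kernel replaced by its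
  own derivative along \<open>- v\<close>; hence the induction over all smooth kernels.\<close>

lemma Ck_on_convolution:
  fixes W :: "'c::euclidean_space \<Rightarrow> real"
  assumes W: "continuous_on (cbox p q) W"
  shows "smooth_on UNIV \<sigma> \<Longrightarrow> Ck_on k UNIV (\<lambda>x. integral (cbox p q) (\<lambda>y. \<sigma> (y - x) * W y))"
proof (induction k arbitrary: \<sigma>)
  case (Suc k)
  let ?D = "\<lambda>y. frechet_derivative \<sigma> (at y)"
  have der: "(\<sigma> has_derivative ?D y) (at y)" for y using smooth_onD[OF Suc.prems] by simp
  have lin: "bounded_linear (\<lambda>v. ?D y (- v) * W z)" for y z
    using bounded_linear_mult_const[OF bounded_linear_compose[OF has_derivative_bounded_linear[OF der[of y]]
        bounded_linear_minus[OF bounded_linear_ident]]] .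
  have contD: "continuous_on UNIV (\<lambda>y. ?D y v)" for v
    using smooth_on_continuous_on[OF smooth_on_deriv[OF Suc.prems]] .
  have cont\<sigma>: "continuous_on UNIV \<sigma>" using smooth_on_continuous_on[OF Suc.prems] .
  let ?fx = "\<lambda>x y. Blinfun (\<lambda>v. ?D (y - x) (- v) * W y)"
  have appf: "blinfun_apply (?fx x y) = (\<lambda>v. ?D (y - x) (- v) * W y)" for x y
    by (rule bounded_linear_Blinfun_apply[OF lin])
  then have app: "blinfun_apply (?fx x y) v = ?D (y - x) (- v) * W y" for x y v by simp
  have cfx: "continuous_on (UNIV \<times> cbox p q) (\<lambda>(x, y). ?fx x y)"
  proof (rule continuous_on_blinfun_componentwise)
    fix i :: 'c assume "i \<in> Basis"
    have "continuous_on (UNIV \<times> cbox p q) (\<lambda>z. ?D (snd z - fst z) (- i) * W (snd z))"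
      by (intro continuous_on_mult continuous_on_compose2[OF contD] continuous_on_compose2[OF W] continuous_intros) auto
    then show "continuous_on (UNIV \<times> cbox p q) (\<lambda>x. blinfun_apply (case x of (x, y) \<Rightarrow> ?fx x y) i)"
      by (simp add: split_beta app)
  qed
  have D: "((\<lambda>x. integral (cbox p q) (\<lambda>y. \<sigma> (y - x) * W y)) has_derivative blinfun_apply (integral (cbox p q) (?fx x))) (at x)" for x
  proof (rule leibniz_rule[where U = UNIV and fx = ?fx and ?x0.0 = x, simplified])
    fix x y assume "y \<in> cbox p q"
    have "((\<lambda>x. \<sigma> (y - x)) has_derivative (\<lambda>v. ?D (y - x) (- v))) (at x)"
      by (rule has_derivative_compose[OF _ der]) (auto intro!: derivative_eq_intros)
    then show "((\<lambda>x. \<sigma> (y - x) * W y) has_derivative blinfun_apply (?fx x y)) (at x)"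
      unfolding appf by (rule has_derivative_mult_left)
  next
    show "(\<lambda>y. \<sigma> (y - x) * W y) integrable_on cbox p q" for x
      by (intro integrable_continuous continuous_intros W continuous_on_compose2[OF cont\<sigma>]) auto
  qed (use cfx in auto)
  have eq: "blinfun_apply (integral (cbox p q) (?fx x)) v = integral (cbox p q) (\<lambda>y. ?D (y - x) (- v) * W y)" for x v
  proof -
    have "?fx x integrable_on cbox p q"
    proof (rule integrable_continuous)
      have "continuous_on (cbox p q) (\<lambda>y. (x, y))" by (intro continuous_intros)
      from continuous_on_compose2[OF cfx this] show "continuous_on (cbox p q) (?fx x)" by force
    qed
    from integral_linear[OF this blinfun.bounded_linear_left[of v]]
    show ?thesis by (simp add: o_def app)
  qed
  show ?case
  proof (rule Ck_on_SucI)
    show "((\<lambda>x. integral (cbox p q) (\<lambda>y. \<sigma> (y - x) * W y)) has_derivative (\<lambda>v. integral (cbox p q) (\<lambda>y. ?D (y - x) (- v) * W y))) (at x)" for x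
      by (intro has_derivative_eq_rhs[OF D[of x]] ext eq)
    show "Ck_on k UNIV (\<lambda>x. integral (cbox p q) (\<lambda>y. ?D (y - x) (- v) * W y))" for v
      by (rule Suc.IH) (rule smooth_on_deriv[OF Suc.prems])
  qed simp
next
  case 0
  have cont\<sigma>: "continuous_on UNIV \<sigma>" using smooth_on_continuous_on[OF 0] .
  have "continuous_on UNIV (\<lambda>x. integral (cbox p q) (\<lambda>y. \<sigma> (y - x) * W y))"
  proof (rule integral_continuous_on_param)
    show "continuous_on (UNIV \<times> cbox p q) (\<lambda>(x, y). \<sigma> (y - x) * W y)"
      unfolding split_beta
      by (intro continuous_on_mult continuous_on_compose2[OF cont\<sigma>] continuous_on_compose2[OF W] continuous_intros) auto
  qed
  then show ?case by simp
qed

text \<open>The variable x sits in \<open>W\<close> and not in the kernel, so that mollifications at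
  two points are compared by comparing integrands over the same box. The bump is not normalised,
  hence the denominator.\<close>

definition mollify :: "real \<Rightarrow> ('c::euclidean_space \<Rightarrow> real) \<Rightarrow> 'c \<Rightarrow> real" where
  "mollify e W x = integral (cbox (- e *\<^sub>R One) (e *\<^sub>R One)) (\<lambda>y. bump 0 e y * W (x + y)) /
     integral (cbox (- e *\<^sub>R One) (e *\<^sub>R One)) (bump (0::'c) e)"

lemma ball_subset_mollify_box: "ball (0::'c::euclidean_space) e \<subseteq> cbox (- e *\<^sub>R One) (e *\<^sub>R One)"
proof
  fix y :: 'c assume "y \<in> ball 0 e"
  then have "\<bar>y \<bullet> b\<bar> \<le> e" if "b \<in> Basis" for b
    using Basis_le_norm[OF that, of y] by simp
  then show "y \<in> cbox (- e *\<^sub>R One) (e *\<^sub>R One)"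
    by (fastforce simp: mem_box abs_le_iff)
qed

lemma bump_outside: "e > 0 \<Longrightarrow> dist a x \<ge> e \<Longrightarrow> bump a e x = 0"
  using bump_pos_iff[of e a x] bump_nonneg[of a e x] by linarith

lemma continuous_on_bump: "continuous_on S (bump a e)"
  using smooth_on_continuous_on[OF smooth_on_bump] .

lemma mollify_denominator_pos:
  assumes "e > 0"
  shows "integral (cbox (- e *\<^sub>R One) (e *\<^sub>R One)) (bump (0::'c::euclidean_space) e) > 0"
proof -
  let ?B = "cbox (- e *\<^sub>R One) (e *\<^sub>R One) :: 'c set"
  have int: "bump 0 e integrable_on ?B" by (intro integrable_continuous continuous_on_bump)
  then have "integral ?B (bump 0 e) \<ge> 0" by (rule integral_nonneg) (rule bump_nonneg)
  moreover have "integral ?B (bump 0 e) \<noteq> 0"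
  proof
    assume "integral ?B (bump 0 e) = 0"
    then have hi: "(bump 0 e has_integral 0) ?B" using int by (simp add: has_integral_integral)
    have "bump 0 e (0::'c) = 0"
      by (rule has_integral_0_cbox_imp_0[OF continuous_on_bump bump_nonneg hi])
         (use assms in \<open>auto simp: box_ne_empty mem_box\<close>)
    then show False using bump_pos_iff[of e 0 "0::'c"] assms by simp
  qed
  ultimately show ?thesis by simp
qed

lemma mollify_integrable:
  fixes W :: "'c::euclidean_space \<Rightarrow> real"
  assumes "continuous_on UNIV W"
  shows "(\<lambda>y. bump 0 e y * W (x + y)) integrable_on cbox p q"
  by (intro integrable_continuous continuous_intros continuous_on_bump continuous_on_compose2[OF assms]) auto

lemma smooth_on_mollify:
  fixes W :: "'c::euclidean_space \<Rightarrow> real"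
  assumes W: "continuous_on UNIV W" and e: "e > 0"
  shows "smooth_on UNIV (mollify e W)"
proof (rule smooth_on_local)
  fix x0 :: 'c
  let ?B = "cbox (- e *\<^sub>R One) (e *\<^sub>R One) :: 'c set"
  let ?c = "integral ?B (bump 0 e)"
  \<comment> \<open>Replacing y by \<open>y - x\<close> moves x from \<open>W\<close> into the
    kernel. The new box must not depend on x; enlarging e by 1 makes one box serve all x within
    distance 1 of \<open>x0\<close>.\<close>
  define p q where "p = x0 - (e + 1) *\<^sub>R One" and "q = x0 + (e + 1) *\<^sub>R One"
  have eq: "mollify e W x = integral (cbox p q) (\<lambda>y. bump 0 e (y - x) * W y) * inverse ?c" if x: "x \<in> ball x0 1" for x
  proof -
    have sub: "?B \<subseteq> cbox (p - x) (q - x)"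
    proof
      fix y assume y: "y \<in> ?B"
      have "\<bar>(x0 - x) \<bullet> b\<bar> \<le> 1" if "b \<in> Basis" for b
        using Basis_le_norm[OF that, of "x0 - x"] x by (simp add: dist_norm)
      then show "y \<in> cbox (p - x) (q - x)"
        using y by (fastforce simp: mem_box p_def q_def algebra_simps abs_le_iff)
    qed
    let ?g = "\<lambda>y. bump 0 e y * W (x + y)"
    have "?g integrable_on ?B" by (rule mollify_integrable[OF W])
    moreover have "?g y = 0" if "y \<notin> ?B" for y
    proof -
      have "y \<notin> ball 0 e" using that ball_subset_mollify_box by blast
      then show ?thesis using bump_outside[OF e, of 0 y] by simp
    qed
    ultimately have "integral ?B ?g = integral (cbox (p - x) (q - x)) ?g"
      using has_integral_on_superset[OF _ _ sub] by (metis (no_types, lifting) has_integral_integral integral_unique)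
    also have "\<dots> = integral (cbox p q) (\<lambda>y. bump 0 e (y - x) * W y)"
      using integral_shift_cbox[of p x q "\<lambda>y. bump 0 e (y - x) * W y"] by (simp add: add.commute)
    finally show ?thesis unfolding mollify_def by (simp add: divide_inverse)
  qed
  have "smooth_on UNIV (\<lambda>x. integral (cbox p q) (\<lambda>y. bump 0 e (y - x) * W y) * inverse ?c)"
    by (intro smooth_on_mult smooth_on_const)
       (use Ck_on_convolution[OF continuous_on_subset[OF W subset_UNIV] smooth_on_bump] in \<open>auto simp: smooth_on_def\<close>)
  then have "smooth_on (ball x0 1) (\<lambda>x. integral (cbox p q) (\<lambda>y. bump 0 e (y - x) * W y) * inverse ?c)"
    by (rule smooth_on_subset) simp
  then have "smooth_on (ball x0 1) (mollify e W)"
    using smooth_on_cong[of "ball x0 1" "mollify e W"] eq by auto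
  then show "\<exists>T. open T \<and> x0 \<in> T \<and> smooth_on T (mollify e W)"
    by (intro exI[of _ "ball x0 1"]) auto
qed

lemma mollify_mono:
  fixes W :: "'c::euclidean_space \<Rightarrow> real"
  assumes W: "continuous_on UNIV W" and e: "e > 0"
    and le: "\<And>y. y \<in> ball 0 e \<Longrightarrow> W (x + y) + c \<le> W (x' + y)"
  shows "mollify e W x + c \<le> mollify e W x'"
proof -
  let ?B = "cbox (- e *\<^sub>R One) (e *\<^sub>R One) :: 'c set"
  note int = mollify_integrable[OF W, of e]
  have intb: "(\<lambda>y. bump 0 e y * c) integrable_on ?B"
    by (intro integrable_continuous continuous_intros continuous_on_bump)
  have "integral ?B (\<lambda>y. bump 0 e y * W (x + y)) + integral ?B (bump 0 e) * c
      = integral ?B (\<lambda>y. bump 0 e y * W (x + y) + bump 0 e y * c)"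
    using integral_add[OF int intb] by simp
  also have "\<dots> \<le> integral ?B (\<lambda>y. bump 0 e y * W (x' + y))"
  proof (rule integral_le[OF integrable_add[OF int intb] int])
    fix y assume "y \<in> ?B"
    show "bump 0 e y * W (x + y) + bump 0 e y * c \<le> bump 0 e y * W (x' + y)"
    proof (cases "y \<in> ball 0 e")
      case True
      from mult_left_mono[OF le[OF this] bump_nonneg[of 0 e y]] show ?thesis by (simp add: algebra_simps)
    next
      case False
      then show ?thesis using bump_outside[OF e, of 0 y] by simp
    qed
  qed
  finally have "(integral ?B (\<lambda>y. bump 0 e y * W (x + y)) + integral ?B (bump 0 e) * c) / integral ?B (bump 0 e)
      \<le> integral ?B (\<lambda>y. bump 0 e y * W (x' + y)) / integral ?B (bump 0 e)"
    using mollify_denominator_pos[OF e, where 'c = 'c] by (intro divide_right_mono) auto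
  then show ?thesis
    unfolding mollify_def using mollify_denominator_pos[OF e, where 'c = 'c]
    by (simp add: add_divide_distrib)
qed

lemma mollify_close:
  fixes W :: "'c::euclidean_space \<Rightarrow> real"
  assumes W: "continuous_on UNIV W" and e: "e > 0"
    and le: "\<And>y. y \<in> ball 0 e \<Longrightarrow> \<bar>W (x + y) - W x\<bar> \<le> \<eta>"
  shows "\<bar>mollify e W x - W x\<bar> \<le> \<eta>"
proof -
  let ?B = "cbox (- e *\<^sub>R One) (e *\<^sub>R One) :: 'c set"
  let ?c = "integral ?B (bump 0 e)"
  note int = mollify_integrable[OF W, of e]
  have intb: "(\<lambda>y. bump 0 e y * c) integrable_on ?B" for c
    by (intro integrable_continuous continuous_intros continuous_on_bump)
  have pt: "bump 0 e y * (W x - \<eta>) \<le> bump 0 e y * W (x + y)" "bump 0 e y * W (x + y) \<le> bump 0 e y * (W x + \<eta>)" for y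
  proof -
    have "y \<in> ball 0 e \<Longrightarrow> W x - \<eta> \<le> W (x + y) \<and> W (x + y) \<le> W x + \<eta>" using le[of y] by linarith
    then show "bump 0 e y * (W x - \<eta>) \<le> bump 0 e y * W (x + y)" "bump 0 e y * W (x + y) \<le> bump 0 e y * (W x + \<eta>)"
      using bump_nonneg[of 0 e y] bump_outside[OF e, of 0 y] by (cases "y \<in> ball 0 e"; simp add: mult_left_mono)+
  qed
  have "?c * (W x - \<eta>) \<le> integral ?B (\<lambda>y. bump 0 e y * W (x + y))"
    using integral_le[OF intb int pt(1)] by simp
  moreover have "integral ?B (\<lambda>y. bump 0 e y * W (x + y)) \<le> ?c * (W x + \<eta>)"
    using integral_le[OF int intb pt(2)] by simp
  ultimately have "W x - \<eta> \<le> mollify e W x" "mollify e W x \<le> W x + \<eta>"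
    unfolding mollify_def using mollify_denominator_pos[OF e, where 'c = 'c] by (simp_all add: field_simps)
  then show ?thesis by linarith
qed

lemma mollify_uniform_limit:
  fixes W :: "'c::euclidean_space \<Rightarrow> real"
  assumes W: "continuous_on UNIV W" and \<eta>: "\<eta> > 0"
  obtains d where "d > 0" "\<And>e x. 0 < e \<Longrightarrow> e < d \<Longrightarrow> x \<in> cball a R \<Longrightarrow> \<bar>mollify e W x - W x\<bar> \<le> \<eta>"
proof -
  have "uniformly_continuous_on (cball a (R + 1)) W"
    by (rule compact_uniformly_continuous[OF continuous_on_subset[OF W]]) auto
  then obtain d where d: "d > 0"
    "\<And>x y. x \<in> cball a (R + 1) \<Longrightarrow> y \<in> cball a (R + 1) \<Longrightarrow> dist y x < d \<Longrightarrow> dist (W y) (W x) < \<eta>"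
    using \<eta> unfolding uniformly_continuous_on_def by metis
  show ?thesis
  proof
    show "min d 1 > 0" using d by simp
    fix e x assume e: "0 < e" "e < min d 1" and x: "x \<in> cball a R"
    show "\<bar>mollify e W x - W x\<bar> \<le> \<eta>"
    proof (rule mollify_close[OF W e(1)])
      fix y :: 'c assume y: "y \<in> ball 0 e"
      have "dist a (x + y) \<le> dist a x + norm y"
        using dist_triangle[of a "x + y" x] by (simp add: dist_norm)
      then have "dist (W (x + y)) (W x) < \<eta>"
        using x y e by (intro d(2)) (auto simp: dist_norm)
      then show "\<bar>W (x + y) - W x\<bar> \<le> \<eta>" by (simp add: dist_norm)
    qed
  qed
qed

text \<open>Each translate of \<open>W\<close> by y in the ball of radius e satisfies the same
  increment inequality, and an average keeps it; as the average is differentiable, the inequality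
  becomes a bound on its derivative. Half of r is spent on x and half on y.\<close>

lemma mollify_increasing_along:
  fixes W :: "'c::euclidean_space \<Rightarrow> real"
  assumes W: "continuous_on UNIV W" and inc: "increasing_along W c v z"
  obtains d where "d > 0"
    "\<And>e x w. 0 < e \<Longrightarrow> e < d \<Longrightarrow> x \<in> ball z d \<Longrightarrow> w \<in> ball v d \<Longrightarrow>
       c \<le> frechet_derivative (mollify e W) (at x) w"
proof -
  obtain r where r: "r > 0" "\<And>x w s. x \<in> ball z r \<Longrightarrow> w \<in> ball v r \<Longrightarrow> 0 \<le> s \<Longrightarrow> s \<le> r \<Longrightarrow> W x + c * s \<le> W (x + s *\<^sub>R w)"
    using increasing_alongE[OF inc] by blast
  show ?thesis
  proof
    show "r / 2 > 0" using r by simp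
    fix e x w assume e: "0 < e" "e < r / 2" and x: "x \<in> ball z (r / 2)" and w: "w \<in> ball v (r / 2)"
    show "c \<le> frechet_derivative (mollify e W) (at x) w"
    proof (rule has_derivative_ge_of_increments[OF smooth_onD[OF smooth_on_mollify[OF W e(1)]]])
      fix s :: real assume s: "0 < s" "s < r"
      show "mollify e W x + c * s \<le> mollify e W (x + s *\<^sub>R w)"
      proof (rule mollify_mono[OF W e(1)])
        fix y :: 'c assume y: "y \<in> ball 0 e"
        have "dist z (x + y) \<le> dist z x + norm y"
          using dist_triangle[of z "x + y" x] by (simp add: dist_norm)
        then have "x + y \<in> ball z r" using x y e by auto
        then show "W (x + y) + c * s \<le> W (x + s *\<^sub>R w + y)"
          using r(2)[of "x + y" w s] w s r(1) by (simp add: add_ac)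
      qed
    qed (use r in auto)
  qed
qed

subsection \<open>Series of smooth functions\<close>

primrec iterated_deriv :: "'c::real_normed_vector list \<Rightarrow> ('c \<Rightarrow> real) \<Rightarrow> 'c \<Rightarrow> real" where
  "iterated_deriv [] g = g"
| "iterated_deriv (b # bs) g = iterated_deriv bs (\<lambda>x. frechet_derivative g (at x) b)"

lemma smooth_on_iterated_deriv: "smooth_on S g \<Longrightarrow> smooth_on S (iterated_deriv bs g)"
  by (induction bs arbitrary: g) (auto intro: smooth_on_deriv)

text \<open>The bounds on partial derivatives bound the whole n-th derivative by \<open>T n\<close>,
  and the tails of the sum of \<open>T\<close> supply the uniform convergence for termwise
  differentiation. The third conclusion reduces an arbitrary direction to basis directions, the only
  ones for which higher bounds are at hand.\<close>

lemma series_has_derivative: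
  fixes g :: "nat \<Rightarrow> 'c::euclidean_space \<Rightarrow> real"
  assumes S: "open S" "convex S" and g: "\<And>n. smooth_on S (g n)"
    and B0: "summable B0" "\<And>n x. x \<in> S \<Longrightarrow> \<bar>c n * g n x\<bar> \<le> B0 n"
    and B: "\<And>b. b \<in> Basis \<Longrightarrow> summable (B b)"
      "\<And>b n x. b \<in> Basis \<Longrightarrow> x \<in> S \<Longrightarrow> \<bar>c n * frechet_derivative (g n) (at x) b\<bar> \<le> B b n"
    and x: "x \<in> S"
  shows "((\<lambda>x. \<Sum>n. c n * g n x) has_derivative (\<lambda>v. \<Sum>n. c n * frechet_derivative (g n) (at x) v)) (at x)"
    and "summable (\<lambda>n. c n * frechet_derivative (g n) (at x) v)"
    and "(\<Sum>n. c n * frechet_derivative (g n) (at x) v) =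
           (\<Sum>b\<in>Basis. (v \<bullet> b) * (\<Sum>n. c n * frechet_derivative (g n) (at x) b))"
proof -
  let ?D = "\<lambda>n x. frechet_derivative (g n) (at x)"
  define T where "T n = (\<Sum>b\<in>Basis. B b n)" for n
  have sT: "summable T" unfolding T_def using B(1) by (intro summable_sum) auto
  have lin: "linear (?D n x)" if "x \<in> S" for n x
    using smooth_onD[OF g that] has_derivative_linear by blast
  have bound: "\<bar>c n * ?D n x h\<bar> \<le> T n * norm h" if x: "x \<in> S" for n x h
  proof -
    have "c n * ?D n x h = (\<Sum>b\<in>Basis. (h \<bullet> b) * (c n * ?D n x b))"
      using linear_sum_Basis[OF lin[OF x], of n h] by (simp add: sum_distrib_left mult_ac)
    also have "\<bar>\<dots>\<bar> \<le> (\<Sum>b\<in>Basis. norm h * B b n)"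
    proof (rule order_trans[OF sum_abs], rule sum_mono)
      fix b :: 'c assume "b \<in> Basis"
      then show "\<bar>(h \<bullet> b) * (c n * ?D n x b)\<bar> \<le> norm h * B b n"
        unfolding abs_mult[of "h \<bullet> b"] using B(2)[of b x n] x Basis_le_norm[of b h]
        by (intro mult_mono) auto
    qed
    finally show ?thesis by (simp add: T_def sum_distrib_left mult.commute)
  qed
  have summ: "summable (\<lambda>n. c n * ?D n x h)" if "x \<in> S" for x h
    by (rule summable_comparison_test'[of "\<lambda>n. T n * norm h" 0])
       (use bound[OF that] sT in \<open>auto intro: summable_mult2\<close>)
  show "summable (\<lambda>n. c n * frechet_derivative (g n) (at x) v)" using summ[OF x] .
  have summ0: "summable (\<lambda>n. c n * g n x)" if "x \<in> S" for x
    by (rule summable_comparison_test'[of B0 0]) (use B0 that in auto)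
  show "(\<Sum>n. c n * ?D n x v) = (\<Sum>b\<in>Basis. (v \<bullet> b) * (\<Sum>n. c n * ?D n x b))"
  proof -
    have "(\<Sum>n. c n * ?D n x v) = (\<Sum>n. \<Sum>b\<in>Basis. (v \<bullet> b) * (c n * ?D n x b))"
      using linear_sum_Basis[OF lin[OF x], of _ v] by (simp add: sum_distrib_left mult_ac)
    also have "\<dots> = (\<Sum>b\<in>Basis. \<Sum>n. (v \<bullet> b) * (c n * ?D n x b))"
      by (rule suminf_sum) (intro summable_mult summ x)
    also have "\<dots> = (\<Sum>b\<in>Basis. (v \<bullet> b) * (\<Sum>n. c n * ?D n x b))"
      by (intro sum.cong refl suminf_mult summ x)
    finally show ?thesis .
  qed
  have "\<exists>G. \<forall>x\<in>S. (\<lambda>n. c n * g n x) sums (G x) \<and>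
      (G has_derivative (\<lambda>h. \<Sum>n. c n * ?D n x h)) (at x within S)"
  proof (rule has_derivative_series[OF S(2)])
    show "((\<lambda>x. c n * g n x) has_derivative (\<lambda>h. c n * ?D n x h)) (at x within S)" if "x \<in> S" for n x
      using has_derivative_mult_right[OF has_derivative_at_withinI[OF smooth_onD[OF g that]]] .
    show "(\<lambda>n. c n * g n x) sums (\<Sum>n. c n * g n x)" using summ0[OF x] by (rule summable_sums)
    fix e :: real assume "e > 0"
    have "(\<lambda>n. suminf T - sum T {..<n}) \<longlonglongrightarrow> suminf T - suminf T"
      by (intro tendsto_diff tendsto_const summable_LIMSEQ sT)
    then have "eventually (\<lambda>n. suminf T - sum T {..<n} < e) sequentially"
      using order_tendstoD(2) \<open>e > 0\<close> by fastforce
    then show "\<forall>\<^sub>F n in sequentially. \<forall>x\<in>S. \<forall>h::'c. norm ((\<Sum>i<n. c i * ?D i x h) - (\<Sum>i. c i * ?D i x h)) \<le> e * norm h"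
    proof eventually_elim
      case (elim n)
      show ?case
      proof (intro ballI allI)
        fix x h :: 'c assume x: "x \<in> S"
        have sT': "summable (\<lambda>i. T (i + n) * norm h)"
          using sT by (intro summable_mult2) (simp add: summable_iff_shift)
        have "(\<Sum>i. c i * ?D i x h) = (\<Sum>i. c (i + n) * ?D (i + n) x h) + (\<Sum>i<n. c i * ?D i x h)"
          by (rule suminf_split_initial_segment[OF summ[OF x]])
        then have "norm ((\<Sum>i<n. c i * ?D i x h) - (\<Sum>i. c i * ?D i x h)) = norm (\<Sum>i. c (i + n) * ?D (i + n) x h)"
          by simp
        also have "\<dots> \<le> (\<Sum>i. T (i + n) * norm h)"
          by (rule norm_suminf_le[OF _ sT']) (use bound[OF x] in simp)
        also have "\<dots> = (\<Sum>i. T (i + n)) * norm h"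
          using sT by (intro suminf_mult2[symmetric]) (simp add: summable_iff_shift)
        also have "(\<Sum>i. T (i + n)) = suminf T - sum T {..<n}"
          using suminf_minus_initial_segment[OF sT] .
        also have "(suminf T - sum T {..<n}) * norm h \<le> e * norm h"
          using elim by (intro mult_right_mono) auto
        finally show "norm ((\<Sum>i<n. c i * ?D i x h) - (\<Sum>i. c i * ?D i x h)) \<le> e * norm h" .
      qed
    qed
  qed (use x in auto)
  then obtain G where G: "\<And>x. x \<in> S \<Longrightarrow> (\<lambda>n. c n * g n x) sums (G x)"
    "\<And>x. x \<in> S \<Longrightarrow> (G has_derivative (\<lambda>h. \<Sum>n. c n * ?D n x h)) (at x within S)" by blast
  have "(G has_derivative (\<lambda>h. \<Sum>n. c n * ?D n x h)) (at x)"
    using G(2)[OF x] unfolding at_within_open[OF x S(1)] .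
  then show "((\<lambda>x. \<Sum>n. c n * g n x) has_derivative (\<lambda>v. \<Sum>n. c n * ?D n x v)) (at x)"
    by (rule has_derivative_transform_within_open[OF _ S(1) x]) (rule sums_unique[OF G(1)])
qed

lemma first_order_bounds:
  fixes g :: "nat \<Rightarrow> 'c::euclidean_space \<Rightarrow> real"
  assumes "\<And>bs. set bs \<subseteq> Basis \<Longrightarrow> \<exists>B. summable B \<and> (\<forall>n. \<forall>x\<in>S. \<bar>c n * iterated_deriv bs (g n) x\<bar> \<le> B n)"
  obtains B0 B where "summable B0" "\<And>n x. x \<in> S \<Longrightarrow> \<bar>c n * g n x\<bar> \<le> B0 n"
    "\<And>b. b \<in> Basis \<Longrightarrow> summable (B b)"
    "\<And>b n x. b \<in> Basis \<Longrightarrow> x \<in> S \<Longrightarrow> \<bar>c n * frechet_derivative (g n) (at x) b\<bar> \<le> B b n"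
proof -
  obtain B0 where B0: "summable B0" "\<And>n x. x \<in> S \<Longrightarrow> \<bar>c n * g n x\<bar> \<le> B0 n"
    using assms[of "[]"] by auto
  have "\<forall>b\<in>Basis. \<exists>B. summable B \<and> (\<forall>n. \<forall>x\<in>S. \<bar>c n * frechet_derivative (g n) (at x) b\<bar> \<le> B n)"
  proof
    fix b :: 'c assume "b \<in> Basis"
    then show "\<exists>B. summable B \<and> (\<forall>n. \<forall>x\<in>S. \<bar>c n * frechet_derivative (g n) (at x) b\<bar> \<le> B n)"
      using assms[of "[b]"] by simp
  qed
  then obtain B where B: "\<And>b. b \<in> Basis \<Longrightarrow> summable (B b)"
      "\<And>b n x. b \<in> Basis \<Longrightarrow> x \<in> S \<Longrightarrow> \<bar>c n * frechet_derivative (g n) (at x) b\<bar> \<le> B b n"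
    by metis
  show ?thesis using that[OF B0 B] by blast
qed

text \<open>The bound for \<open>b # bs\<close> is the bound for \<open>bs\<close> applied to the
  derivative along \<open>b\<close>, so the hypothesis over all lists reproduces itself in the
  induction.\<close>

lemma Ck_on_series:
  fixes g :: "nat \<Rightarrow> 'c::euclidean_space \<Rightarrow> real"
  assumes S: "open S" "convex S"
  shows "(\<And>n. smooth_on S (g n)) \<Longrightarrow>
    (\<And>bs. set bs \<subseteq> Basis \<Longrightarrow> \<exists>B. summable B \<and> (\<forall>n. \<forall>x\<in>S. \<bar>c n * iterated_deriv bs (g n) x\<bar> \<le> B n)) \<Longrightarrow>
    Ck_on k S (\<lambda>x. \<Sum>n. c n * g n x)"
proof (induction k arbitrary: g)
  case (Suc k)
  obtain B0 B where B0: "summable B0" "\<And>n x. x \<in> S \<Longrightarrow> \<bar>c n * g n x\<bar> \<le> B0 n"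
    and B: "\<And>b. b \<in> Basis \<Longrightarrow> summable (B b)"
      "\<And>b n x. b \<in> Basis \<Longrightarrow> x \<in> S \<Longrightarrow> \<bar>c n * frechet_derivative (g n) (at x) b\<bar> \<le> B b n"
    by (rule first_order_bounds[OF Suc.prems(2)]) (assumption, rule that)
  show ?case
  proof (rule Ck_on_SucI[OF S(1)])
    show "((\<lambda>x. \<Sum>n. c n * g n x) has_derivative (\<lambda>v. \<Sum>n. c n * frechet_derivative (g n) (at x) v)) (at x)"
      if "x \<in> S" for x
      by (rule series_has_derivative(1)[where ?B0.0 = B0 and B = B])
         (use S Suc.prems(1) B0 B that in auto)
    fix v
    have "Ck_on k S (\<lambda>x. \<Sum>b\<in>Basis. (v \<bullet> b) * (\<Sum>n. c n * frechet_derivative (g n) (at x) b))"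
    proof (intro Ck_on_sum Ck_on_mult Ck_on_const S(1))
      fix b :: 'c assume b: "b \<in> Basis"
      show "Ck_on k S (\<lambda>x. \<Sum>n. c n * frechet_derivative (g n) (at x) b)"
      proof (rule Suc.IH)
        show "smooth_on S (\<lambda>x. frechet_derivative (g n) (at x) b)" for n
          by (rule smooth_on_deriv[OF Suc.prems(1)])
        show "\<exists>B. summable B \<and> (\<forall>n. \<forall>x\<in>S. \<bar>c n * iterated_deriv bs (\<lambda>x. frechet_derivative (g n) (at x) b) x\<bar> \<le> B n)"
          if "set bs \<subseteq> Basis" for bs
          using Suc.prems(2)[of "b # bs"] that b by simp
      qed
    qed
    moreover have "(\<Sum>b\<in>Basis. (v \<bullet> b) * (\<Sum>n. c n * frechet_derivative (g n) (at x) b)) =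
        (\<Sum>n. c n * frechet_derivative (g n) (at x) v)" if "x \<in> S" for x
      by (rule series_has_derivative(3)[where ?B0.0 = B0 and B = B, symmetric])
         (use S Suc.prems(1) B0 B that in auto)
    ultimately show "Ck_on k S (\<lambda>x. \<Sum>n. c n * frechet_derivative (g n) (at x) v)"
      by (rule Ck_on_cong[OF S(1), THEN iffD1, rotated])
  qed
next
  case 0
  obtain B0 B where B0: "summable B0" "\<And>n x. x \<in> S \<Longrightarrow> \<bar>c n * g n x\<bar> \<le> B0 n"
    and B: "\<And>b. b \<in> Basis \<Longrightarrow> summable (B b)"
      "\<And>b n x. b \<in> Basis \<Longrightarrow> x \<in> S \<Longrightarrow> \<bar>c n * frechet_derivative (g n) (at x) b\<bar> \<le> B b n"
    by (rule first_order_bounds[OF 0(2)]) (assumption, rule that)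
  have "isCont (\<lambda>x. \<Sum>n. c n * g n x) x" if "x \<in> S" for x
    using series_has_derivative(1)[OF S 0(1) B0 B that] has_derivative_continuous by blast
  then show ?case by (simp add: continuous_at_imp_continuous_on)
qed

text \<open>
  The \<open>n\<close>-th weight only takes care of the derivatives of order at most \<open>n\<close>, so that every
  fixed derivative is taken care of by almost all weights.
\<close>

lemma summable_weights:
  fixes f :: "'j \<Rightarrow> nat \<Rightarrow> 'c::euclidean_space \<Rightarrow> real"
  assumes J: "finite J" and sm: "\<And>j n. j \<in> J \<Longrightarrow> smooth_on (S j) (f j n)"
    and C: "\<And>j. j \<in> J \<Longrightarrow> compact (C j)" "\<And>j. j \<in> J \<Longrightarrow> C j \<subseteq> S j"
  obtains c :: "nat \<Rightarrow> real" where "\<And>n. c n > 0" "c sums 1"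
    "\<And>j bs. j \<in> J \<Longrightarrow> set bs \<subseteq> Basis \<Longrightarrow>
       \<exists>B. summable B \<and> (\<forall>n. \<forall>x\<in>C j. \<bar>c n * iterated_deriv bs (f j n) x\<bar> \<le> B n)"
proof -
  have "\<exists>b. 0 \<le> b \<and> (\<forall>x\<in>C j. \<bar>iterated_deriv bs (f j n) x\<bar> \<le> b)" if j: "j \<in> J" for j n bs
  proof -
    have "continuous_on (C j) (iterated_deriv bs (f j n))"
      using smooth_on_continuous_on[OF smooth_on_iterated_deriv[OF sm[OF j]]] C(2)[OF j] continuous_on_subset by blast
    then have "bounded (iterated_deriv bs (f j n) ` C j)"
      using C(1)[OF j] compact_continuous_image compact_imp_bounded by blast
    then obtain b where "\<forall>x\<in>C j. \<bar>iterated_deriv bs (f j n) x\<bar> \<le> b"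
      by (auto simp: bounded_iff)
    then show ?thesis by (intro exI[of _ "\<bar>b\<bar>"]) auto
  qed
  note ex = this
  define b where "b j n bs = (SOME b. 0 \<le> b \<and> (\<forall>x\<in>C j. \<bar>iterated_deriv bs (f j n) x\<bar> \<le> b))" for j n bs
  have b: "0 \<le> b j n bs" "x \<in> C j \<Longrightarrow> \<bar>iterated_deriv bs (f j n) x\<bar> \<le> b j n bs" if "j \<in> J" for j n bs x
    using someI_ex[OF ex[OF that, where n = n and bs = bs]] unfolding b_def by blast+
  define L where "L n = {bs :: 'c list. set bs \<subseteq> Basis \<and> length bs \<le> n}" for n
  have finL: "finite (L n)" for n unfolding L_def by (rule finite_lists_length_le) simp
  \<comment> \<open>The sum over the finite sets \<open>J\<close> and \<open>L n\<close> dominates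
    each single bound of order at most n; the summand 1 keeps \<open>M n\<close> away from 0, so
    that \<open>a n\<close> stays below a geometric sequence.\<close>
  define M where "M n = 1 + (\<Sum>j\<in>J. \<Sum>bs\<in>L n. b j n bs)" for n
  have M1: "M n \<ge> 1" for n unfolding M_def using b(1) by (auto intro!: sum_nonneg)
  have bM: "b j n bs \<le> M n" if "j \<in> J" "bs \<in> L n" for j n bs
  proof -
    have "b j n bs \<le> (\<Sum>bs\<in>L n. b j n bs)" using b(1) that finL by (intro member_le_sum) auto
    also have "\<dots> \<le> (\<Sum>j\<in>J. \<Sum>bs\<in>L n. b j n bs)"
      using b(1) that J by (intro member_le_sum[of j J "\<lambda>j. \<Sum>bs\<in>L n. b j n bs"]) (auto intro: sum_nonneg)
    finally show ?thesis by (simp add: M_def)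
  qed
  define a where "a n = (1 / 2) ^ n / M n" for n
  have a_pos: "a n > 0" for n using M1[of n] by (simp add: a_def)
  have a_le: "a n \<le> (1 / 2) ^ n" for n using M1[of n] by (simp add: a_def field_simps)
  have sa: "summable a"
    by (rule summable_comparison_test'[of "\<lambda>n. (1 / 2) ^ n" 0])
       (use a_pos a_le in \<open>auto simp: abs_of_pos intro: summable_geometric\<close>)
  have s_pos: "suminf a > 0" by (rule suminf_pos[OF sa a_pos])
  \<comment> \<open>Total weight 1 makes the weighted series equal to 1 wherever all its functions
    are 1.\<close>
  define c where "c n = a n / suminf a" for n
  show ?thesis
  proof
    show "c n > 0" for n using a_pos s_pos by (simp add: c_def)
    show "c sums 1"
      using sums_divide[OF summable_sums[OF sa], of "suminf a"] s_pos by (simp add: c_def[abs_def])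
    fix j and bs :: "'c list" assume j: "j \<in> J" and bs: "set bs \<subseteq> Basis"
    define B where "B n = c n * b j n bs" for n
    have "summable B"
    proof (rule summable_comparison_test'[of "\<lambda>n. (1 / 2) ^ n / suminf a" "length bs"])
      fix n assume "length bs \<le> n"
      then have "b j n bs \<le> M n" using bM[OF j] bs by (simp add: L_def)
      then have "a n * b j n bs \<le> (1 / 2) ^ n"
        using M1[of n] by (simp add: a_def field_simps)
      then show "norm (B n) \<le> (1 / 2) ^ n / suminf a"
        using s_pos a_pos[of n] b(1)[OF j, of n bs] by (simp add: B_def c_def field_simps)
    qed (auto intro!: summable_divide summable_geometric)
    moreover have "\<bar>c n * iterated_deriv bs (f j n) x\<bar> \<le> B n" if "x \<in> C j" for n x
      using b(2)[OF j that, of bs n] a_pos[of n] s_pos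
      by (auto simp: B_def c_def abs_mult intro!: divide_right_mono mult_left_mono)
    ultimately show "\<exists>B. summable B \<and> (\<forall>n. \<forall>x\<in>C j. \<bar>c n * iterated_deriv bs (f j n) x\<bar> \<le> B n)" by blast
  qed
qed

subsection \<open>Smooth functions on manifolds\<close>

lemma closed_smooth_manifold_chart:
  assumes "closed_smooth_manifold M A" "(U, \<phi>) \<in> A"
  shows "openin M U" "U \<subseteq> topspace M" "open (\<phi> ` U)" "inj_on \<phi> U"
    "homeomorphic_map (subtopology M U) (top_of_set (\<phi> ` U)) \<phi>"
proof -
  have c: "is_chart M (U, \<phi>)"
    using assms unfolding closed_smooth_manifold_def smooth_atlas_def by blast
  show "openin M U" "open (\<phi> ` U)" using c by (auto simp: is_chart_def)
  then show U: "U \<subseteq> topspace M" using openin_subset by blast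
  show h: "homeomorphic_map (subtopology M U) (top_of_set (\<phi> ` U)) \<phi>"
    using c by (auto simp: is_chart_def)
  show "inj_on \<phi> U"
    using homeomorphic_imp_injective_map[OF h] U by (simp add: inf.absorb2)
qed

lemma closed_smooth_manifold_transition:
  assumes mfd: "closed_smooth_manifold M A" and c: "(U, \<phi>) \<in> A" "(V, \<psi>) \<in> A"
  shows "smooth_on (\<phi> ` (U \<inter> V)) (\<lambda>x. \<psi> (inv_into U \<phi> x))"
proof -
  have "\<forall>(U, \<phi>)\<in>A. \<forall>(V, \<psi>)\<in>A. smooth_on (\<phi> ` (U \<inter> V)) (\<psi> \<circ> inv_into U \<phi>)"
    using mfd by (simp add: closed_smooth_manifold_def smooth_atlas_def)
  from bspec[OF this c(1)] have "\<forall>(V, \<psi>)\<in>A. smooth_on (\<phi> ` (U \<inter> V)) (\<psi> \<circ> inv_into U \<phi>)" by simp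
  from bspec[OF this c(2)] show ?thesis by (simp add: comp_def)
qed

lemma closed_smooth_manifold_open_image:
  assumes mfd: "closed_smooth_manifold M A" and c: "(U, \<phi>) \<in> A" and V: "openin M V"
  shows "open (\<phi> ` (U \<inter> V))"
proof -
  note chart = closed_smooth_manifold_chart[OF mfd c]
  have "openin (subtopology M U) (U \<inter> V)"
    using V by (simp add: openin_subtopology_Int2)
  then have "openin (top_of_set (\<phi> ` U)) (\<phi> ` (U \<inter> V))"
    using homeomorphic_map_openness[OF chart(5), of "U \<inter> V"] chart(2) by auto
  then show ?thesis using chart(3) openin_open_trans by blast
qed

lemma smooth_triangulationE:
  assumes "smooth_triangulation M A K h" "S \<in> K" "x \<in> S"
  obtains U \<phi> W g where "(U, \<phi>) \<in> A" "open W" "x \<in> W" "h ` (S \<inter> W) \<subseteq> U" "smooth_on W g"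
    "\<forall>y\<in>S \<inter> W. g y = \<phi> (h y)" "inj_on (frechet_derivative g (at x)) (span ((\<lambda>y. y - x) ` S))"
proof -
  have "\<forall>S\<in>K. \<forall>x\<in>S. \<exists>(U, \<phi>)\<in>A. \<exists>W g. open W \<and> x \<in> W \<and> h ` (S \<inter> W) \<subseteq> U \<and>
      smooth_on W g \<and> (\<forall>y \<in> S \<inter> W. g y = \<phi> (h y)) \<and>
      inj_on (frechet_derivative g (at x)) (span ((\<lambda>y. y - x) ` S))"
    using assms(1) by (simp add: smooth_triangulation_def)
  from bspec[OF bspec[OF this assms(2)] assms(3)] show ?thesis using that by blast
qed

lemma smooth_function_imp_Ck_function: "smooth_function A f \<Longrightarrow> \<exists>k\<ge>2. Ck_function k A f"
  unfolding smooth_function_def Ck_function_def smooth_on_def by (intro exI[of _ 2]) auto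

definition transplant :: "'a set \<Rightarrow> ('a \<Rightarrow> 'e) \<Rightarrow> ('e \<Rightarrow> real) \<Rightarrow> 'a \<Rightarrow> real" where
  "transplant U \<phi> G q = (if q \<in> U then G (\<phi> q) else 0)"

text \<open>The model space is Euclidean here because mollification integrates over boxes and
  derivatives are expanded in \<open>Basis\<close>; an arbitrary finite-dimensional model is reduced
  to this case at the end.\<close>

locale euclidean_manifold =
  fixes M :: "'a topology" and A :: "('a, 'e::euclidean_space) chart set"
  assumes mfd: "closed_smooth_manifold M A"
begin

lemmas chart = closed_smooth_manifold_chart[OF mfd]

lemma chart_inv [simp]: "(U, \<phi>) \<in> A \<Longrightarrow> q \<in> U \<Longrightarrow> inv_into U \<phi> (\<phi> q) = q"
  using chart(4) by (simp add: inv_into_f_f)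

lemma chart_around:
  assumes "p \<in> topspace M" obtains U \<phi> where "(U, \<phi>) \<in> A" "p \<in> U"
  using mfd assms unfolding closed_smooth_manifold_def smooth_atlas_def by blast

lemmas transition_smooth = closed_smooth_manifold_transition[OF mfd]
lemmas open_chart_image = closed_smooth_manifold_open_image[OF mfd]

lemma openin_chart_preimage:
  assumes c: "(U, \<phi>) \<in> A" and S: "open S"
  shows "openin M {q \<in> U. \<phi> q \<in> S}"
proof -
  have "continuous_map (subtopology M U) euclidean \<phi>"
    using homeomorphic_imp_continuous_map[OF chart(5)[OF c]] continuous_map_in_subtopology by blast
  then have "openin (subtopology M U) {q \<in> topspace (subtopology M U). \<phi> q \<in> S}"
    using S by (simp add: continuous_map_def)
  then show ?thesis
    using chart(1,2)[OF c] openin_trans_full by (fastforce simp: inf.absorb2)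
qed

lemma continuous_map_inv_chart:
  assumes c: "(U, \<phi>) \<in> A"
  shows "continuous_map (top_of_set (\<phi> ` U)) M (inv_into U \<phi>)"
proof -
  obtain g where g: "homeomorphic_maps (subtopology M U) (top_of_set (\<phi> ` U)) \<phi> g"
    using chart(5)[OF c] homeomorphic_map_maps by blast
  then have "continuous_map (top_of_set (\<phi> ` U)) M g"
    unfolding homeomorphic_maps_def using continuous_map_into_fulltopology by blast
  moreover have "g y = inv_into U \<phi> y" if "y \<in> \<phi> ` U" for y
  proof -
    from that obtain q where q: "q \<in> U" "y = \<phi> q" by blast
    then have "g y = q" using g chart(2)[OF c] by (auto simp: homeomorphic_maps_def)
    then show ?thesis using q c by simp
  qed
  ultimately show ?thesis by (auto intro: continuous_map_eq)
qed

lemma continuous_on_chart: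
  assumes "continuous_map M euclidean f" "(U, \<phi>) \<in> A"
  shows "continuous_on (\<phi> ` U) (\<lambda>x. f (inv_into U \<phi> x))"
  using continuous_map_compose[OF continuous_map_inv_chart[OF assms(2)] assms(1)] by (simp add: comp_def)

lemma closedin_inv_chart_compact:
  assumes c: "(U, \<phi>) \<in> A" and C: "compact C" "C \<subseteq> \<phi> ` U"
  shows "closedin M (inv_into U \<phi> ` C)"
proof -
  have "compactin (top_of_set (\<phi> ` U)) C" using C by (simp add: compactin_subtopology)
  then have "compactin M (inv_into U \<phi> ` C)"
    using continuous_map_inv_chart[OF c] image_compactin by blast
  then show ?thesis
    using mfd compactin_imp_closedin unfolding closed_smooth_manifold_def by blast
qed

lemma smooth_function_chart: "smooth_function A f \<Longrightarrow> (U, \<phi>) \<in> A \<Longrightarrow> smooth_on (\<phi> ` U) (\<lambda>x. f (inv_into U \<phi> x))"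
  unfolding smooth_function_def comp_def by blast

lemma smooth_functionI:
  "(\<And>U \<phi>. (U, \<phi>) \<in> A \<Longrightarrow> smooth_on (\<phi> ` U) (\<lambda>x. f (inv_into U \<phi> x))) \<Longrightarrow> smooth_function A f"
  unfolding smooth_function_def comp_def by blast

text \<open>\<open>smooth_function\<close> speaks about all charts of the atlas, but the transition
  maps are smooth, so one convenient chart around each point decides.\<close>

lemma smooth_function_local:
  assumes "\<And>p. p \<in> topspace M \<Longrightarrow> \<exists>(U, \<phi>)\<in>A. \<exists>S. p \<in> U \<and> open S \<and> \<phi> p \<in> S \<and> smooth_on S (\<lambda>x. f (inv_into U \<phi> x))"
  shows "smooth_function A f"
proof (rule smooth_functionI)
  fix V \<psi> assume V: "(V, \<psi>) \<in> A"
  show "smooth_on (\<psi> ` V) (\<lambda>x. f (inv_into V \<psi> x))"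
  proof (rule smooth_on_local)
    fix x assume "x \<in> \<psi> ` V"
    then obtain p where p: "p \<in> V" "x = \<psi> p" by blast
    then obtain U \<phi> S where U: "(U, \<phi>) \<in> A" "p \<in> U" "open S" "\<phi> p \<in> S" "smooth_on S (\<lambda>x. f (inv_into U \<phi> x))"
      using assms[of p] chart(2)[OF V] by blast
    define T where "T = \<psi> ` (V \<inter> {q \<in> U. \<phi> q \<in> S})"
    have oT: "open T" unfolding T_def by (rule open_chart_image[OF V openin_chart_preimage[OF U(1,3)]])
    have "smooth_on T (\<lambda>x. \<phi> (inv_into V \<psi> x))"
      by (rule smooth_on_subset[OF transition_smooth[OF V U(1)]]) (auto simp: T_def)
    then have "smooth_on T (\<lambda>x. f (inv_into U \<phi> (\<phi> (inv_into V \<psi> x))))"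
      by (rule smooth_on_compose[OF oT U(3,5)]) (use V in \<open>auto simp: T_def\<close>)
    then have "smooth_on T (\<lambda>x. f (inv_into V \<psi> x))"
      by (rule iffD1[OF smooth_on_cong[OF oT], rotated]) (use U V in \<open>auto simp: T_def\<close>)
    then show "\<exists>T. open T \<and> x \<in> T \<and> smooth_on T (\<lambda>x. f (inv_into V \<psi> x))"
      using oT p U by (intro exI[of _ T]) (auto simp: T_def)
  qed
qed

lemma smooth_function_sum:
  assumes "\<And>i. i \<in> I \<Longrightarrow> smooth_function A (f i)"
  shows "smooth_function A (\<lambda>q. \<Sum>i\<in>I. f i q)"
proof (rule smooth_functionI)
  fix U \<phi> assume U: "(U, \<phi>) \<in> A"
  show "smooth_on (\<phi> ` U) (\<lambda>x. \<Sum>i\<in>I. f i (inv_into U \<phi> x))"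
    by (rule smooth_on_sum[OF chart(3)[OF U]]) (use smooth_function_chart[OF assms U] in auto)
qed

lemma smooth_function_divide:
  assumes "smooth_function A f" "smooth_function A g" "\<And>q. q \<in> topspace M \<Longrightarrow> g q \<noteq> 0"
  shows "smooth_function A (\<lambda>q. f q / g q)"
proof (rule smooth_functionI)
  fix U \<phi> assume U: "(U, \<phi>) \<in> A"
  have "g (inv_into U \<phi> x) \<noteq> 0" if "x \<in> \<phi> ` U" for x
    using assms(3) chart(2)[OF U] inv_into_into[OF that] by blast
  then show "smooth_on (\<phi> ` U) (\<lambda>x. f (inv_into U \<phi> x) / g (inv_into U \<phi> x))"
    using U assms(1,2) by (intro smooth_on_divide chart(3) smooth_function_chart)
qed

lemma smooth_function_compose:
  assumes "smooth_on UNIV h" "smooth_function A f"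
  shows "smooth_function A (\<lambda>q. h (f q))"
  using smooth_on_compose[OF chart(3) open_UNIV assms(1) smooth_function_chart[OF assms(2)]]
  by (intro smooth_functionI) auto

text \<open>The only question is smoothness at points outside \<open>U\<close>, including boundary
  points of \<open>U\<close>. The compact set \<open>C\<close> corresponds to a set closed in the
  Hausdorff space \<open>M\<close>, so such a point has a neighbourhood on which the function is
  0.\<close>

lemma smooth_function_transplant:
  assumes c: "(U, \<phi>) \<in> A" and C: "compact C" "C \<subseteq> \<phi> ` U"
    and G: "smooth_on UNIV G" "\<And>x. x \<notin> C \<Longrightarrow> G x = 0"
  shows "smooth_function A (transplant U \<phi> G)"
  unfolding transplant_def[abs_def]
proof (rule smooth_function_local)
  let ?f = "\<lambda>q. if q \<in> U then G (\<phi> q) else 0"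
  fix p assume p: "p \<in> topspace M"
  show "\<exists>(U, \<phi>)\<in>A. \<exists>S. p \<in> U \<and> open S \<and> \<phi> p \<in> S \<and> smooth_on S (\<lambda>x. ?f (inv_into U \<phi> x))"
  proof (cases "p \<in> U")
    case True
    have "smooth_on (\<phi> ` U) (\<lambda>x. ?f (inv_into U \<phi> x))"
      using smooth_on_cong[OF chart(3)[OF c], of "\<lambda>x. ?f (inv_into U \<phi> x)" G] smooth_on_subset[OF G(1)] c
      by (auto simp: f_inv_into_f inv_into_into)
    then show ?thesis using c True chart(3)[OF c] by blast
  next
    case False
    obtain V \<psi> where V: "(V, \<psi>) \<in> A" "p \<in> V" using chart_around[OF p] .
    define S where "S = \<psi> ` (V \<inter> (topspace M - inv_into U \<phi> ` C))"
    have oS: "open S" unfolding S_def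
      by (intro open_chart_image V) (use closedin_inv_chart_compact[OF c C] in auto)
    have "?f (inv_into V \<psi> x) = 0" if "x \<in> S" for x
    proof -
      from that obtain q where q: "q \<in> V" "q \<notin> inv_into U \<phi> ` C" "x = \<psi> q" by (auto simp: S_def)
      then have "q \<in> U \<Longrightarrow> \<phi> q \<notin> C" using c by (metis chart_inv imageI)
      then show ?thesis using q V G(2) by simp
    qed
    then have "smooth_on S (\<lambda>x. ?f (inv_into V \<psi> x))"
      using smooth_on_cong[OF oS, of "\<lambda>x. ?f (inv_into V \<psi> x)" "\<lambda>x. 0"] smooth_on_const by auto
    moreover have "p \<notin> inv_into U \<phi> ` C"
      using False C(2) inv_into_into by (metis (no_types, lifting) imageE subsetD)
    ultimately show ?thesis using V oS p by (intro bexI[of _ "(V, \<psi>)"]) (auto simp: S_def)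
  qed
qed

text \<open>Balls of radius r already cover \<open>M\<close> and will carry the bumps. The margin up
  to radius \<open>2 * r\<close> ensures that \<open>chart_extension\<close> agrees with the
  original function in a neighbourhood of the closed ball of radius r.\<close>

lemma finite_chart_cover:
  obtains J :: "'a set" and U \<phi> a r where "finite J"
    "\<And>j. j \<in> J \<Longrightarrow> (U j, \<phi> j) \<in> A" "\<And>j. j \<in> J \<Longrightarrow> r j > 0"
    "\<And>j. j \<in> J \<Longrightarrow> cball (a j) (2 * r j) \<subseteq> \<phi> j ` U j"
    "\<And>q. q \<in> topspace M \<Longrightarrow> \<exists>j\<in>J. q \<in> U j \<and> \<phi> j q \<in> ball (a j) (r j)"
proof -
  have "\<forall>p\<in>topspace M. \<exists>t. (fst t, fst (snd t)) \<in> A \<and> p \<in> fst t \<and> snd (snd t) > (0::real) \<and>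
      cball (fst (snd t) p) (2 * snd (snd t)) \<subseteq> fst (snd t) ` fst t"
  proof
    fix p assume p: "p \<in> topspace M"
    obtain U \<phi> where U: "(U, \<phi>) \<in> A" "p \<in> U" using chart_around[OF p] .
    then obtain e where "e > 0" "cball (\<phi> p) e \<subseteq> \<phi> ` U"
      using chart(3)[OF U(1)] open_contains_cball by blast
    then show "\<exists>t. (fst t, fst (snd t)) \<in> A \<and> p \<in> fst t \<and> snd (snd t) > (0::real) \<and>
      cball (fst (snd t) p) (2 * snd (snd t)) \<subseteq> fst (snd t) ` fst t"
      using U by (intro exI[of _ "(U, \<phi>, e / 2)"]) auto
  qed
  from bchoice[OF this] obtain t where t: "\<forall>p\<in>topspace M. (fst (t p), fst (snd (t p))) \<in> A \<and> p \<in> fst (t p) \<and>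
      snd (snd (t p)) > (0::real) \<and> cball (fst (snd (t p)) p) (2 * snd (snd (t p))) \<subseteq> fst (snd (t p)) ` fst (t p)" ..
  define U \<phi> a r where "U p = fst (t p)" and "\<phi> p = fst (snd (t p))" and "a p = \<phi> p p" and "r p = snd (snd (t p))" for p
  have j: "(U p, \<phi> p) \<in> A \<and> p \<in> U p \<and> r p > 0 \<and> a p = \<phi> p p \<and> cball (a p) (2 * r p) \<subseteq> \<phi> p ` U p"
    if "p \<in> topspace M" for p
    using bspec[OF t that] unfolding U_def \<phi>_def a_def r_def by blast
  define N where "N p = {q \<in> U p. \<phi> p q \<in> ball (a p) (r p)}" for p
  have "openin M (N p)" if "p \<in> topspace M" for p
    using j[OF that] unfolding N_def by (intro openin_chart_preimage) auto
  moreover have "topspace M \<subseteq> \<Union>(N ` topspace M)" using j by (auto simp: N_def)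
  moreover have "compact_space M" using mfd closed_smooth_manifold_def by blast
  ultimately obtain F where F: "finite F" "F \<subseteq> N ` topspace M" "topspace M \<subseteq> \<Union>F"
    unfolding compact_space_alt by (metis (no_types, lifting) imageE)
  then obtain J where J: "J \<subseteq> topspace M" "finite J" "F = N ` J"
    using finite_subset_image by metis
  show ?thesis
  proof (rule that[of J U \<phi> r a])
    show "\<exists>j\<in>J. q \<in> U j \<and> \<phi> j q \<in> ball (a j) (r j)" if "q \<in> topspace M" for q
      using F(3) J(3) that by (auto simp: N_def)
  qed (use J j in auto)
qed

end


subsection \<open>Smoothing\<close>

text \<open>The retraction onto the ball makes the function continuous on the whole space.\<close>

definition chart_extension :: "'a set \<Rightarrow> ('a \<Rightarrow> 'e::euclidean_space) \<Rightarrow> 'e \<Rightarrow> real \<Rightarrow> ('a \<Rightarrow> real) \<Rightarrow> 'e \<Rightarrow> real" where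
  "chart_extension U \<phi> a r u x = u (inv_into U \<phi> (closest_point (cball a (2 * r)) x))"

context euclidean_manifold
begin

lemma continuous_on_chart_extension:
  assumes "(U, \<phi>) \<in> A" "r > 0" "cball a (2 * r) \<subseteq> \<phi> ` U" "continuous_map M euclidean u"
  shows "continuous_on UNIV (chart_extension U \<phi> a r u)"
  unfolding chart_extension_def[abs_def]
proof (rule continuous_on_compose2[OF continuous_on_chart[OF assms(4,1)]])
  show "continuous_on UNIV (closest_point (cball a (2 * r)))"
    using assms(2) by (intro continuous_on_closest_point) auto
  show "closest_point (cball a (2 * r)) ` UNIV \<subseteq> \<phi> ` U"
    using closest_point_in_set[of "cball a (2 * r)"] assms(2,3) by force
qed

lemma chart_extension_eq: "x \<in> cball a (2 * r) \<Longrightarrow> chart_extension U \<phi> a r u x = u (inv_into U \<phi> x)"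
  by (simp add: chart_extension_def closest_point_self)

lemma smooth_function_bump_piece:
  assumes "(U, \<phi>) \<in> A" "r > 0" "cball a (2 * r) \<subseteq> \<phi> ` U" "smooth_on UNIV G"
  shows "smooth_function A (transplant U \<phi> (\<lambda>x. bump a r x * G x))"
proof (rule smooth_function_transplant[OF assms(1) compact_cball[of a r]])
  show "cball a r \<subseteq> \<phi> ` U" using assms(2,3) by (auto simp: subset_iff)
  show "smooth_on UNIV (\<lambda>x. bump a r x * G x)" by (intro smooth_on_mult smooth_on_bump assms(4)) simp
  show "bump a r x * G x = 0" if "x \<notin> cball a r" for x
    using bump_outside[OF assms(2), of a x] that by simp
qed

text \<open>By the product rule the derivative of \<open>P e\<close> is \<open>\<beta>\<close> times
  a derivative of the mollification, which is at least c, plus the derivative of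
  \<open>\<beta>\<close> times the mollification, which is u up to \<open>\<eta>\<close>. The term
  with u has no sign; it is kept because it cancels, up to a small error, against the derivative of
  the total weight. \<open>N\<close> and \<open>K\<close> are fixed before \<open>\<eta>\<close>, so
  that \<open>\<eta>\<close> can later be chosen in terms of \<open>K\<close>.\<close>

lemma mollified_piece_derivative:
  assumes c: "(U, \<phi>) \<in> A" and r: "r > 0" and sub: "cball a (2 * r) \<subseteq> \<phi> ` U"
    and u: "continuous_map M euclidean u"
    and V: "(V, \<psi>) \<in> A" "q0 \<in> V" and inc: "increasing_along (\<lambda>x. u (inv_into V \<psi> x)) c v (\<psi> q0)"
  defines "\<beta> \<equiv> \<lambda>x. transplant U \<phi> (bump a r) (inv_into V \<psi> x)"
    and "P \<equiv> \<lambda>e x. transplant U \<phi> (\<lambda>x. bump a r x * mollify e (chart_extension U \<phi> a r u) x) (inv_into V \<psi> x)"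
  obtains N K where "open N" "\<psi> q0 \<in> N" "N \<subseteq> \<psi> ` V" "K \<ge> 0"
    "\<And>x. x \<in> N \<Longrightarrow> \<bar>frechet_derivative \<beta> (at x) v\<bar> \<le> K"
    "\<And>\<eta>. \<eta> > 0 \<Longrightarrow> \<exists>d>0. \<forall>e x. 0 < e \<and> e < d \<and> x \<in> N \<longrightarrow>
       c * \<beta> x + frechet_derivative \<beta> (at x) v * u (inv_into V \<psi> x) - K * \<eta> \<le> frechet_derivative (P e) (at x) v"
proof (cases "q0 \<in> inv_into U \<phi> ` cball a r")
  case False
  define N where "N = \<psi> ` (V \<inter> (topspace M - inv_into U \<phi> ` cball a r))"
  have subr: "cball a r \<subseteq> \<phi> ` U" using r sub by (auto simp: subset_iff)
  have oN: "open N" unfolding N_def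
    by (intro open_chart_image V) (use closedin_inv_chart_compact[OF c compact_cball subr] in auto)
  have zero: "transplant U \<phi> (\<lambda>x. bump a r x * G x) (inv_into V \<psi> x) = 0" if "x \<in> N" for x G
  proof -
    from that obtain q where q: "q \<in> V" "q \<notin> inv_into U \<phi> ` cball a r" "x = \<psi> q" by (auto simp: N_def)
    then have "q \<in> U \<Longrightarrow> \<phi> q \<notin> cball a r" using c by (metis chart_inv imageI)
    then show ?thesis using q V bump_outside[OF r, of a "\<phi> q"] by (auto simp: transplant_def)
  qed
  have der0: "frechet_derivative F (at x) v = 0" if "x \<in> N" "\<And>x. x \<in> N \<Longrightarrow> F x = 0" for F :: "'e \<Rightarrow> real" and x
  proof -
    have "((\<lambda>x. 0) has_derivative (\<lambda>v. 0)) (at x)" by simp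
    then have "(F has_derivative (\<lambda>v. 0)) (at x)"
      by (rule has_derivative_transform_within_open[OF _ oN that(1)]) (simp add: that(2))
    from fun_cong[OF frechet_derivative_at[OF this], of v] show ?thesis by (rule sym)
  qed
  have \<beta>0: "\<beta> x = 0" if "x \<in> N" for x
    using zero[OF that, of "\<lambda>x. 1"] by (simp add: \<beta>_def)
  have P0: "P e x = 0" if "x \<in> N" for e x
    using zero[OF that] by (simp add: P_def)
  show ?thesis
  proof (rule that[of N 0])
    show "\<psi> q0 \<in> N" using False V chart(2)[OF V(1)] unfolding N_def by blast
    show "N \<subseteq> \<psi> ` V" by (auto simp: N_def)
    show "\<exists>d>0. \<forall>e x. 0 < e \<and> e < d \<and> x \<in> N \<longrightarrow>
       c * \<beta> x + frechet_derivative \<beta> (at x) v * u (inv_into V \<psi> x) - 0 * \<eta> \<le> frechet_derivative (P e) (at x) v" for \<eta> :: real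
      using der0[OF _ \<beta>0] der0[OF _ P0] \<beta>0 by (intro exI[of _ 1]) auto
  qed (use oN der0[OF _ \<beta>0] in auto)
next
  case True
  define W where "W = chart_extension U \<phi> a r u"
  have W: "continuous_on UNIV W"
    unfolding W_def by (rule continuous_on_chart_extension[OF c r sub u])
  obtain y0 where y0: "y0 \<in> cball a r" "q0 = inv_into U \<phi> y0" using True by blast
  then have y0': "y0 \<in> ball a (2 * r)" "y0 \<in> \<phi> ` U" using r sub by auto
  have qU: "q0 \<in> U" "\<phi> q0 = y0" using y0' y0(2) by (auto simp: inv_into_into f_inv_into_f)
  define \<tau> where "\<tau> x = \<phi> (inv_into V \<psi> x)" for x
  define \<sigma> where "\<sigma> y = \<psi> (inv_into U \<phi> y)" for y
  define x0 where "x0 = \<psi> q0"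
  define R where "R = \<psi> ` (V \<inter> U)"
  have oR: "open R" unfolding R_def by (rule open_chart_image[OF V(1) chart(1)[OF c]])
  have oR': "open (\<phi> ` (U \<inter> V))" by (rule open_chart_image[OF c chart(1)[OF V(1)]])
  have x0: "x0 \<in> R" "\<tau> x0 = y0" "\<sigma> y0 = x0" using V qU y0 by (auto simp: R_def x0_def \<tau>_def \<sigma>_def)
  have sm\<tau>: "smooth_on R \<tau>" unfolding R_def \<tau>_def[abs_def] by (rule transition_smooth[OF V(1) c])
  have sm\<sigma>: "smooth_on (\<phi> ` (U \<inter> V)) \<sigma>" unfolding \<sigma>_def[abs_def] by (rule transition_smooth[OF c V(1)])
  have \<sigma>\<tau>: "\<sigma> (\<tau> x) = x" if "x \<in> R" for x
    using that c V by (auto simp: R_def \<sigma>_def \<tau>_def)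
  define T where "T x = frechet_derivative \<tau> (at x)" for x
  define T' where "T' = frechet_derivative \<sigma> (at y0)"
  have T: "(\<tau> has_derivative T x) (at x)" if "x \<in> R" for x
    unfolding T_def by (rule smooth_onD[OF sm\<tau> that])
  have y0R: "y0 \<in> \<phi> ` (U \<inter> V)" using qU V by auto
  have strict\<sigma>: "strict_derivative \<sigma> T' y0"
    unfolding T'_def by (rule smooth_on_strict_derivative[OF sm\<sigma> oR' y0R])
  \<comment> \<open>The two transition maps are inverse to each other near \<open>x0\<close>, hence
    so are their differentials on v.\<close>
  have T'T: "T' (T x0 v) = v"
  proof -
    have "((\<lambda>x. \<sigma> (\<tau> x)) has_derivative (\<lambda>v. T' (T x0 v))) (at x0)"
      using has_derivative_compose[OF T[OF x0(1)], of \<sigma> T'] strict_derivative_imp_has_derivative[OF strict\<sigma>]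
      by (simp add: x0)
    moreover have "((\<lambda>x. \<sigma> (\<tau> x)) has_derivative (\<lambda>v. v)) (at x0)"
      by (rule has_derivative_transform_within_open[OF has_derivative_ident oR x0(1)]) (simp add: \<sigma>\<tau>)
    ultimately show ?thesis by (metis has_derivative_unique)
  qed
  \<comment> \<open>Growth is known in the chart V, while the mollification takes place in the chart
    U. Going back along \<open>\<sigma>\<close> requires the direction at \<open>y0\<close> that
    \<open>T'\<close> sends to v, namely \<open>T x0 v\<close>.\<close>
  have inc\<sigma>: "increasing_along (\<lambda>y. u (inv_into V \<psi> (\<sigma> y))) c (T x0 v) y0"
    by (rule increasing_along_compose[OF strict\<sigma>]) (use inc T'T x0 in \<open>simp add: x0_def\<close>)
  obtain \<epsilon> where \<epsilon>: "\<epsilon> > 0" "ball y0 \<epsilon> \<subseteq> \<phi> ` (U \<inter> V) \<inter> ball a (2 * r)"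
    using open_Int[OF oR' open_ball] y0R y0' by (meson IntI openE)
  have W\<sigma>: "W y = u (inv_into V \<psi> (\<sigma> y))" if "y \<in> ball y0 \<epsilon>" for y
  proof -
    have y: "y \<in> \<phi> ` (U \<inter> V)" "y \<in> cball a (2 * r)" using that \<epsilon> by (auto simp: subset_iff less_imp_le)
    then obtain q where q: "q \<in> U" "q \<in> V" "y = \<phi> q" by blast
    then show ?thesis unfolding W_def \<sigma>_def chart_extension_eq[OF y(2)] using c V(1) by simp
  qed
  have incW: "increasing_along W c (T x0 v) y0"
    by (rule increasing_along_cong[OF inc\<sigma> \<epsilon>(1) W\<sigma>])
  obtain d1 where d1: "d1 > 0" "\<And>e x w. 0 < e \<Longrightarrow> e < d1 \<Longrightarrow> x \<in> ball y0 d1 \<Longrightarrow> w \<in> ball (T x0 v) d1 \<Longrightarrow>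
       c \<le> frechet_derivative (mollify e W) (at x) w"
    using mollify_increasing_along[OF W incW] by blast
  define b where "b x = bump a r (\<tau> x)" for x
  have smb: "smooth_on R b"
    unfolding b_def[abs_def] by (rule smooth_on_compose[OF oR open_UNIV smooth_on_bump sm\<tau>]) simp
  define Db where "Db x = frechet_derivative b (at x) v" for x
  have contDb: "continuous_on R Db" unfolding Db_def[abs_def]
    by (rule smooth_on_continuous_on[OF smooth_on_deriv[OF smb]])
  have contT: "continuous_on R (\<lambda>x. T x v)" unfolding T_def[abs_def]
    by (rule smooth_on_continuous_on[OF smooth_on_deriv[OF sm\<tau>]])
  have cont\<tau>: "continuous_on R \<tau>" by (rule smooth_on_continuous_on[OF sm\<tau>])
  have pre: "open (R \<inter> f -` B)" if "continuous_on R f" "open B" for f :: "'e \<Rightarrow> 'x::topological_space" and B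
    using continuous_open_preimage[OF that(1) oR that(2)] .
  define \<rho> where "\<rho> = min d1 \<epsilon>"
  define K where "K = \<bar>Db x0\<bar> + 1"
  \<comment> \<open>Three open conditions: \<open>\<tau> x\<close> stays where the mollification is
    known to grow, the transported direction \<open>T x v\<close> stays in the cone of growth, and
    the derivative of the bump stays within 1 of its value at \<open>x0\<close>, hence below
    \<open>K\<close>.\<close>
  define N where "N = (R \<inter> \<tau> -` ball y0 \<rho>) \<inter> (R \<inter> (\<lambda>x. T x v) -` ball (T x0 v) d1) \<inter> (R \<inter> Db -` ball (Db x0) 1)"
  have oN: "open N" unfolding N_def by (intro open_Int pre cont\<tau> contT contDb open_ball)
  have NR: "N \<subseteq> R" by (auto simp: N_def)
  have \<beta>b: "\<beta> x = b x" if "x \<in> R" for x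
    using that V by (auto simp: R_def \<beta>_def b_def \<tau>_def transplant_def)
  have D\<beta>: "frechet_derivative \<beta> (at x) v = Db x" if x: "x \<in> R" for x
  proof -
    have "(\<beta> has_derivative frechet_derivative b (at x)) (at x)"
      by (rule has_derivative_transform_within_open[OF smooth_onD[OF smb x] oR x]) (simp add: \<beta>b)
    from frechet_derivative_at[OF this] show ?thesis by (simp add: Db_def)
  qed
  show ?thesis
  proof (rule that[of N K])
    show "open N" by (rule oN)
    show "\<psi> q0 \<in> N" using x0 d1 \<epsilon> by (auto simp: N_def x0_def \<rho>_def)
    show "N \<subseteq> \<psi> ` V" using NR by (auto simp: R_def)
    show "K \<ge> 0" by (simp add: K_def)
    have DbK: "\<bar>Db x\<bar> \<le> K" if "x \<in> N" for x
      using that by (auto simp: N_def K_def dist_real_def)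
    then show "\<bar>frechet_derivative \<beta> (at x) v\<bar> \<le> K" if "x \<in> N" for x
      using D\<beta> that NR by auto
    fix \<eta> :: real assume "\<eta> > 0"
    then obtain d2 where d2: "d2 > 0" "\<And>e x. 0 < e \<Longrightarrow> e < d2 \<Longrightarrow> x \<in> cball a (2 * r) \<Longrightarrow> \<bar>mollify e W x - W x\<bar> \<le> \<eta>"
      using mollify_uniform_limit[OF W] by metis
    show "\<exists>d>0. \<forall>e x. 0 < e \<and> e < d \<and> x \<in> N \<longrightarrow>
       c * \<beta> x + frechet_derivative \<beta> (at x) v * u (inv_into V \<psi> x) - K * \<eta> \<le> frechet_derivative (P e) (at x) v"
    proof (intro exI[of _ "min d1 d2"] conjI allI impI)
      show "min d1 d2 > 0" using d1 d2 by simp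
      fix e x assume "0 < e \<and> e < min d1 d2 \<and> x \<in> N"
      then have e: "0 < e" "e < d1" "e < d2" and x: "x \<in> N" by auto
      have xR: "x \<in> R" using x NR by blast
      let ?m = "mollify e W"
      have Pe: "P e z = b z * ?m (\<tau> z)" if "z \<in> R" for z
        using that V by (auto simp: R_def P_def b_def \<tau>_def transplant_def W_def)
      have Dm: "(?m has_derivative frechet_derivative ?m (at (\<tau> x))) (at (\<tau> x))"
        using smooth_onD[OF smooth_on_mollify[OF W e(1)]] by simp
      have "((\<lambda>z. b z * ?m (\<tau> z)) has_derivative
          (\<lambda>v. b x * frechet_derivative ?m (at (\<tau> x)) (T x v) + frechet_derivative b (at x) v * ?m (\<tau> x))) (at x)"
        by (rule has_derivative_mult[OF smooth_onD[OF smb xR] has_derivative_compose[OF T[OF xR] Dm]])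
      then have "(P e has_derivative
          (\<lambda>v. b x * frechet_derivative ?m (at (\<tau> x)) (T x v) + frechet_derivative b (at x) v * ?m (\<tau> x))) (at x)"
        by (rule has_derivative_transform_within_open[OF _ oR xR]) (simp add: Pe)
      from fun_cong[OF frechet_derivative_at[OF this], of v]
      have DP: "frechet_derivative (P e) (at x) v = b x * frechet_derivative ?m (at (\<tau> x)) (T x v) + Db x * ?m (\<tau> x)"
        unfolding Db_def by (rule sym)
      have "c \<le> frechet_derivative ?m (at (\<tau> x)) (T x v)"
        by (rule d1(2)) (use e x in \<open>auto simp: N_def \<rho>_def\<close>)
      then have 1: "c * b x \<le> b x * frechet_derivative ?m (at (\<tau> x)) (T x v)"
        unfolding b_def mult.commute[of c] by (rule mult_left_mono[OF _ bump_nonneg])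
      have \<tau>x: "\<tau> x \<in> cball a (2 * r)"
        using x \<epsilon> by (auto simp: N_def \<rho>_def subset_iff less_imp_le)
      have Wx: "W (\<tau> x) = u (inv_into V \<psi> x)"
        using xR V c unfolding W_def chart_extension_eq[OF \<tau>x] by (auto simp: \<tau>_def R_def)
      have "\<bar>?m (\<tau> x) - W (\<tau> x)\<bar> \<le> \<eta>" by (rule d2(2)[OF e(1,3) \<tau>x])
      then have "\<bar>Db x * (?m (\<tau> x) - W (\<tau> x))\<bar> \<le> K * \<eta>"
        unfolding abs_mult using DbK[OF x] by (intro mult_mono) (auto simp: K_def)
      then have 2: "Db x * W (\<tau> x) - K * \<eta> \<le> Db x * ?m (\<tau> x)"
        by (simp add: algebra_simps abs_le_iff)
      show "c * \<beta> x + frechet_derivative \<beta> (at x) v * u (inv_into V \<psi> x) - K * \<eta> \<le> frechet_derivative (P e) (at x) v"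
        unfolding DP using 1 2 D\<beta>[OF xR] \<beta>b[OF xR] Wx by simp
    qed
  qed
qed


text \<open>
  The weighted average of the mollifications in finitely many charts. The derivative of the weights
  contributes only the differences between the mollifications, which are small.
\<close>

lemma smoothing:
  assumes u: "continuous_map M euclidean u"
  obtains F :: "real \<Rightarrow> 'a \<Rightarrow> real" where
    "\<And>e. e > 0 \<Longrightarrow> smooth_function A (F e)"
    "\<And>\<eta>. \<eta> > 0 \<Longrightarrow> \<exists>d>0. \<forall>e q. 0 < e \<and> e < d \<and> q \<in> topspace M \<longrightarrow> \<bar>F e q - u q\<bar> \<le> \<eta>"
    "\<And>V \<psi> q0 c v. (V, \<psi>) \<in> A \<Longrightarrow> q0 \<in> V \<Longrightarrow> c > 0 \<Longrightarrow>
       increasing_along (\<lambda>x. u (inv_into V \<psi> x)) c v (\<psi> q0) \<Longrightarrow>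
       \<exists>N d. open N \<and> \<psi> q0 \<in> N \<and> N \<subseteq> \<psi> ` V \<and> d > 0 \<and>
         (\<forall>e x. 0 < e \<and> e < d \<and> x \<in> N \<longrightarrow> 0 < frechet_derivative (\<lambda>x. F e (inv_into V \<psi> x)) (at x) v)"
proof -
  obtain J :: "'a set" and U \<phi> a r where J: "finite J"
    and ch: "\<And>j. j \<in> J \<Longrightarrow> (U j, \<phi> j) \<in> A" and r: "\<And>j. j \<in> J \<Longrightarrow> r j > 0"
    and sub: "\<And>j. j \<in> J \<Longrightarrow> cball (a j) (2 * r j) \<subseteq> \<phi> j ` U j"
    and cover: "\<And>q. q \<in> topspace M \<Longrightarrow> \<exists>j\<in>J. q \<in> U j \<and> \<phi> j q \<in> ball (a j) (r j)"
    using finite_chart_cover by metis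
  define W where "W j = chart_extension (U j) (\<phi> j) (a j) (r j) u" for j
  have W: "continuous_on UNIV (W j)" if "j \<in> J" for j
    unfolding W_def by (rule continuous_on_chart_extension[OF ch[OF that] r[OF that] sub[OF that] u])
  define \<beta> where "\<beta> j = transplant (U j) (\<phi> j) (bump (a j) (r j))" for j
  define P where "P j e = transplant (U j) (\<phi> j) (\<lambda>x. bump (a j) (r j) x * mollify e (W j) x)" for j e
  define B where "B q = (\<Sum>j\<in>J. \<beta> j q)" for q
  define F where "F e q = (\<Sum>j\<in>J. P j e q) / B q" for e q
  have sm\<beta>: "smooth_function A (\<beta> j)" if "j \<in> J" for j
    unfolding \<beta>_def using smooth_function_bump_piece[OF ch[OF that] r[OF that] sub[OF that] smooth_on_const[of _ 1]] by simp
  have smP: "smooth_function A (P j e)" if "j \<in> J" "e > 0" for j e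
    unfolding P_def
    by (rule smooth_function_bump_piece[OF ch[OF that(1)] r[OF that(1)] sub[OF that(1)] smooth_on_mollify[OF W[OF that(1)] that(2)]])
  have \<beta>0: "\<beta> j q \<ge> 0" for j q by (simp add: \<beta>_def transplant_def bump_nonneg)
  have Bpos: "B q > 0" if q: "q \<in> topspace M" for q
  proof -
    obtain j where j: "j \<in> J" "q \<in> U j" "\<phi> j q \<in> ball (a j) (r j)" using cover[OF q] by blast
    have "0 < \<beta> j q" using j by (simp add: \<beta>_def transplant_def bump_pos_iff[OF r[OF j(1)]])
    also have "\<beta> j q \<le> B q" unfolding B_def using J j(1) \<beta>0 by (intro member_le_sum) auto
    finally show ?thesis .
  qed
  have smF: "smooth_function A (F e)" if "e > 0" for e
    unfolding F_def[abs_def]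
  proof (rule smooth_function_divide)
    show "smooth_function A (\<lambda>q. \<Sum>j\<in>J. P j e q)" using smP that by (intro smooth_function_sum) auto
    show "smooth_function A B" unfolding B_def[abs_def] using sm\<beta> by (intro smooth_function_sum) auto
    show "B q \<noteq> 0" if "q \<in> topspace M" for q using Bpos[OF that] by simp
  qed
  have close: "\<exists>d>0. \<forall>e q. 0 < e \<and> e < d \<and> q \<in> topspace M \<longrightarrow> \<bar>F e q - u q\<bar> \<le> \<eta>" if \<eta>: "\<eta> > 0" for \<eta>
  proof -
    have "\<forall>j\<in>J. \<exists>d. d > 0 \<and> (\<forall>e x. 0 < e \<and> e < d \<and> x \<in> cball (a j) (r j) \<longrightarrow> \<bar>mollify e (W j) x - W j x\<bar> \<le> \<eta>)"
      using mollify_uniform_limit[OF W \<eta>] by metis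
    then obtain d where d: "\<And>j. j \<in> J \<Longrightarrow> d j > 0"
      "\<And>j e x. j \<in> J \<Longrightarrow> 0 < e \<Longrightarrow> e < d j \<Longrightarrow> x \<in> cball (a j) (r j) \<Longrightarrow> \<bar>mollify e (W j) x - W j x\<bar> \<le> \<eta>"
      by metis
    define \<delta> where "\<delta> = Min (insert 1 (d ` J))"
    have \<delta>: "\<delta> > 0" "\<And>j. j \<in> J \<Longrightarrow> \<delta> \<le> d j" using d(1) J by (auto simp: \<delta>_def intro: min.coboundedI2)
    have "\<bar>F e q - u q\<bar> \<le> \<eta>" if e: "0 < e" "e < \<delta>" and q: "q \<in> topspace M" for e q
    proof -
      have "\<bar>P j e q - \<beta> j q * u q\<bar> \<le> \<beta> j q * \<eta>" if j: "j \<in> J" for j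
      proof (cases "q \<in> U j \<and> \<phi> j q \<in> ball (a j) (r j)")
        case True
        have in1: "\<phi> j q \<in> cball (a j) (r j)" "\<phi> j q \<in> cball (a j) (2 * r j)" using True r[OF j] by auto
        have "W j (\<phi> j q) = u q"
          unfolding W_def chart_extension_eq[OF in1(2)] using ch[OF j] True by simp
        then have "\<bar>mollify e (W j) (\<phi> j q) - u q\<bar> \<le> \<eta>"
          using d(2)[OF j e(1) _ in1(1)] \<delta>(2)[OF j] e by simp
        moreover have "P j e q - \<beta> j q * u q = \<beta> j q * (mollify e (W j) (\<phi> j q) - u q)"
          using True by (simp add: P_def \<beta>_def transplant_def algebra_simps)
        ultimately show ?thesis using \<beta>0[of j q] by (simp add: abs_mult mult_left_mono)
      next
        case False
        then have "\<beta> j q = 0" "P j e q = 0" using bump_outside[OF r[OF j], of "a j" "\<phi> j q"]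
          by (auto simp: P_def \<beta>_def transplant_def)
        then show ?thesis by simp
      qed
      then have "\<bar>\<Sum>j\<in>J. P j e q - \<beta> j q * u q\<bar> \<le> (\<Sum>j\<in>J. \<beta> j q * \<eta>)"
        by (intro order_trans[OF sum_abs] sum_mono)
      then have "\<bar>F e q * B q - B q * u q\<bar> \<le> B q * \<eta>"
        using Bpos[OF q] by (simp add: F_def sum_subtractf B_def sum_distrib_right[symmetric])
      moreover have "F e q * B q - B q * u q = B q * (F e q - u q)" by (simp add: algebra_simps)
      ultimately show ?thesis using Bpos[OF q] by (simp add: abs_mult)
    qed
    then show ?thesis using \<delta>(1) by blast
  qed
  have dir: "\<exists>N d. open N \<and> \<psi> q0 \<in> N \<and> N \<subseteq> \<psi> ` V \<and> d > 0 \<and>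
         (\<forall>e x. 0 < e \<and> e < d \<and> x \<in> N \<longrightarrow> 0 < frechet_derivative (\<lambda>x. F e (inv_into V \<psi> x)) (at x) v)"
    if V: "(V, \<psi>) \<in> A" "q0 \<in> V" and c: "c > 0" and inc: "increasing_along (\<lambda>x. u (inv_into V \<psi> x)) c v (\<psi> q0)"
    for V \<psi> q0 c v
  proof -
    let ?i = "inv_into V \<psi>"
    let ?\<beta>' = "\<lambda>j x. frechet_derivative (\<lambda>x. \<beta> j (?i x)) (at x) v"
    let ?P' = "\<lambda>j e x. frechet_derivative (\<lambda>x. P j e (?i x)) (at x) v"
    let ?piece = "\<lambda>j NK. open (fst NK) \<and> \<psi> q0 \<in> fst NK \<and> fst NK \<subseteq> \<psi> ` V \<and> snd NK \<ge> 0 \<and>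
       (\<forall>x\<in>fst NK. \<bar>?\<beta>' j x\<bar> \<le> snd NK) \<and>
       (\<forall>\<eta>>0. \<exists>d>0. \<forall>e x. 0 < e \<and> e < d \<and> x \<in> fst NK \<longrightarrow>
          c * \<beta> j (?i x) + ?\<beta>' j x * u (?i x) - snd NK * \<eta> \<le> ?P' j e x)"
    have "\<forall>j\<in>J. \<exists>NK. ?piece j NK"
    proof
      fix j assume j: "j \<in> J"
      show "\<exists>NK. ?piece j NK"
      proof (rule mollified_piece_derivative[OF ch[OF j] r[OF j] sub[OF j] u V inc])
        fix N K
        assume "open N" "\<psi> q0 \<in> N" "N \<subseteq> \<psi> ` V" "K \<ge> 0"
          "\<And>x. x \<in> N \<Longrightarrow> \<bar>frechet_derivative (\<lambda>x. transplant (U j) (\<phi> j) (bump (a j) (r j)) (?i x)) (at x) v\<bar> \<le> K"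
          "\<And>\<eta>. \<eta> > 0 \<Longrightarrow> \<exists>d>0. \<forall>e x. 0 < e \<and> e < d \<and> x \<in> N \<longrightarrow>
             c * transplant (U j) (\<phi> j) (bump (a j) (r j)) (?i x) +
             frechet_derivative (\<lambda>x. transplant (U j) (\<phi> j) (bump (a j) (r j)) (?i x)) (at x) v * u (?i x) - K * \<eta>
             \<le> frechet_derivative (\<lambda>x. transplant (U j) (\<phi> j)
                 (\<lambda>x. bump (a j) (r j) x * mollify e (chart_extension (U j) (\<phi> j) (a j) (r j) u) x) (?i x)) (at x) v"
        then show ?thesis unfolding \<beta>_def P_def W_def by (intro exI[of _ "(N, K)"]) simp
      qed
    qed
    from bchoice[OF this] obtain NK where NK: "\<forall>j\<in>J. ?piece j (NK j)" ..
    define N0 where "N0 j = fst (NK j)" for j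
    define K where "K j = snd (NK j)" for j
    have N0: "\<And>j. j \<in> J \<Longrightarrow> open (N0 j)" "\<And>j. j \<in> J \<Longrightarrow> \<psi> q0 \<in> N0 j" "\<And>j. j \<in> J \<Longrightarrow> N0 j \<subseteq> \<psi> ` V"
      and K: "\<And>j. j \<in> J \<Longrightarrow> K j \<ge> 0" "\<And>j x. j \<in> J \<Longrightarrow> x \<in> N0 j \<Longrightarrow> \<bar>?\<beta>' j x\<bar> \<le> K j"
      and DP: "\<And>j \<eta>. j \<in> J \<Longrightarrow> \<eta> > 0 \<Longrightarrow> \<exists>d>0. \<forall>e x. 0 < e \<and> e < d \<and> x \<in> N0 j \<longrightarrow>
          c * \<beta> j (?i x) + ?\<beta>' j x * u (?i x) - K j * \<eta> \<le> ?P' j e x"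
      using NK unfolding N0_def K_def by blast+
    let ?V = "\<psi> ` V"
    have oV: "open ?V" by (rule chart(3)[OF V(1)])
    have top: "?i x \<in> topspace M" if "x \<in> ?V" for x
      using chart(2)[OF V(1)] inv_into_into[OF that] by blast
    have smB: "smooth_on ?V (\<lambda>x. B (?i x))" unfolding B_def
      by (rule smooth_on_sum[OF oV smooth_function_chart[OF sm\<beta> V(1)]])
    define m where "m = B q0 / 2"
    have m: "m > 0" using Bpos[of q0] V chart(2)[OF V(1)] by (auto simp: m_def)
    define N where "N = (?V \<inter> (\<lambda>x. B (?i x)) -` {m<..}) \<inter> (\<Inter>j\<in>J. N0 j)"
    have oN: "open N" unfolding N_def
      by (intro open_Int open_INT continuous_open_preimage[OF smooth_on_continuous_on[OF smB] oV] J ballI N0(1)) auto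
    have inN: "\<psi> q0 \<in> N" using m V N0(2) by (auto simp: N_def m_def)
    define SK where "SK = (\<Sum>j\<in>J. K j)"
    have SK: "SK \<ge> 0" unfolding SK_def by (rule sum_nonneg) (rule K(1))
    \<comment> \<open>Two errors of size \<open>SK * \<eta>\<close> occur, one from the pieces and
      one from replacing \<open>F e\<close> by u against the derivative of the weights; together
      they must stay below the gain \<open>c * m\<close>.\<close>
    define \<eta> where "\<eta> = c * m / (2 * SK + 1)"
    have \<eta>: "\<eta> > 0" "2 * SK * \<eta> < c * m" using c m SK by (auto simp: \<eta>_def field_simps)
    have "\<forall>j\<in>J. \<exists>d. d > 0 \<and> (\<forall>e x. 0 < e \<and> e < d \<and> x \<in> N0 j \<longrightarrow>
          c * \<beta> j (?i x) + ?\<beta>' j x * u (?i x) - K j * \<eta> \<le> ?P' j e x)"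
      using DP \<eta>(1) by blast
    from bchoice[OF this] obtain d where d: "\<forall>j\<in>J. d j > 0 \<and> (\<forall>e x. 0 < e \<and> e < d j \<and> x \<in> N0 j \<longrightarrow>
          c * \<beta> j (?i x) + ?\<beta>' j x * u (?i x) - K j * \<eta> \<le> ?P' j e x)" ..
    obtain d' where d': "d' > 0" "\<And>e q. 0 < e \<Longrightarrow> e < d' \<Longrightarrow> q \<in> topspace M \<Longrightarrow> \<bar>F e q - u q\<bar> \<le> \<eta>"
      using close[OF \<eta>(1)] by blast
    define \<delta> where "\<delta> = Min (insert d' (d ` J))"
    have \<delta>: "\<delta> > 0" "\<delta> \<le> d'" "\<And>j. j \<in> J \<Longrightarrow> \<delta> \<le> d j" using d J d'(1) by (auto simp: \<delta>_def intro: min.coboundedI2)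
    have "0 < frechet_derivative (\<lambda>x. F e (?i x)) (at x) v" if e: "0 < e" "e < \<delta>" and x: "x \<in> N" for e x
    proof -
      have xV: "x \<in> ?V" and xN0: "\<And>j. j \<in> J \<Longrightarrow> x \<in> N0 j" and Bx: "B (?i x) > m" using x by (auto simp: N_def)
      have hP: "((\<lambda>x. P j e (?i x)) has_derivative frechet_derivative (\<lambda>x. P j e (?i x)) (at x)) (at x)" if "j \<in> J" for j
        by (rule smooth_onD[OF smooth_function_chart[OF smP[OF that e(1)] V(1)] xV])
      have h\<beta>: "((\<lambda>x. \<beta> j (?i x)) has_derivative frechet_derivative (\<lambda>x. \<beta> j (?i x)) (at x)) (at x)" if "j \<in> J" for j
        by (rule smooth_onD[OF smooth_function_chart[OF sm\<beta>[OF that] V(1)] xV])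
      have hF: "((\<lambda>x. F e (?i x)) has_derivative frechet_derivative (\<lambda>x. F e (?i x)) (at x)) (at x)"
        by (rule smooth_onD[OF smooth_function_chart[OF smF[OF e(1)] V(1)] xV])
      have hB: "((\<lambda>x. B (?i x)) has_derivative (\<lambda>w. \<Sum>j\<in>J. frechet_derivative (\<lambda>x. \<beta> j (?i x)) (at x) w)) (at x)"
        unfolding B_def by (rule has_derivative_sum[OF h\<beta>])
      \<comment> \<open>Differentiating the identity between \<open>F e * B\<close> and the sum of
        the pieces in two ways replaces the quotient rule.\<close>
      have "((\<lambda>x. F e (?i x) * B (?i x)) has_derivative (\<lambda>w. F e (?i x) * (\<Sum>j\<in>J. frechet_derivative (\<lambda>x. \<beta> j (?i x)) (at x) w) +
          frechet_derivative (\<lambda>x. F e (?i x)) (at x) w * B (?i x))) (at x)"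
        by (rule has_derivative_mult[OF hF hB])
      moreover have "((\<lambda>x. F e (?i x) * B (?i x)) has_derivative (\<lambda>w. \<Sum>j\<in>J. frechet_derivative (\<lambda>x. P j e (?i x)) (at x) w)) (at x)"
      proof (rule has_derivative_transform_within_open[OF _ oV xV])
        show "((\<lambda>x. \<Sum>j\<in>J. P j e (?i x)) has_derivative (\<lambda>w. \<Sum>j\<in>J. frechet_derivative (\<lambda>x. P j e (?i x)) (at x) w)) (at x)"
          by (rule has_derivative_sum[OF hP])
        show "(\<Sum>j\<in>J. P j e (?i y)) = F e (?i y) * B (?i y)" if "y \<in> ?V" for y
          using Bpos[OF top[OF that]] by (simp add: F_def)
      qed
      ultimately have "(\<lambda>w. F e (?i x) * (\<Sum>j\<in>J. frechet_derivative (\<lambda>x. \<beta> j (?i x)) (at x) w) +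
          frechet_derivative (\<lambda>x. F e (?i x)) (at x) w * B (?i x)) = (\<lambda>w. \<Sum>j\<in>J. frechet_derivative (\<lambda>x. P j e (?i x)) (at x) w)"
        by (rule has_derivative_unique)
      from fun_cong[OF this, of v] have eq: "frechet_derivative (\<lambda>x. F e (?i x)) (at x) v * B (?i x) =
          (\<Sum>j\<in>J. ?P' j e x) - F e (?i x) * (\<Sum>j\<in>J. ?\<beta>' j x)" by linarith
      have "(\<Sum>j\<in>J. c * \<beta> j (?i x) + ?\<beta>' j x * u (?i x) - K j * \<eta>) \<le> (\<Sum>j\<in>J. ?P' j e x)"
        by (rule sum_mono) (use d \<delta>(3) e xN0 in force)
      then have 1: "c * B (?i x) + (\<Sum>j\<in>J. ?\<beta>' j x) * u (?i x) - SK * \<eta> \<le> (\<Sum>j\<in>J. ?P' j e x)"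
        by (simp add: sum.distrib sum_subtractf B_def SK_def sum_distrib_left sum_distrib_right)
      have "\<bar>\<Sum>j\<in>J. ?\<beta>' j x\<bar> \<le> SK" unfolding SK_def
        by (rule order_trans[OF sum_abs]) (intro sum_mono K(2) xN0)
      moreover have "\<bar>F e (?i x) - u (?i x)\<bar> \<le> \<eta>" using d'(2)[OF e(1) _ top[OF xV]] e \<delta>(2) by simp
      ultimately have "\<bar>(\<Sum>j\<in>J. ?\<beta>' j x) * (F e (?i x) - u (?i x))\<bar> \<le> SK * \<eta>"
        unfolding abs_mult using SK by (intro mult_mono) auto
      then have 2: "(\<Sum>j\<in>J. ?\<beta>' j x) * F e (?i x) \<le> (\<Sum>j\<in>J. ?\<beta>' j x) * u (?i x) + SK * \<eta>"
        by (simp add: algebra_simps abs_le_iff)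
      have "c * m < c * B (?i x)" using Bx c by simp
      then have "0 < frechet_derivative (\<lambda>x. F e (?i x)) (at x) v * B (?i x)"
        unfolding eq using 1 2 \<eta>(2) by (simp add: algebra_simps)
      then show ?thesis using Bx m by (simp add: zero_less_mult_iff)
    qed
    moreover have "N \<subseteq> ?V" by (auto simp: N_def)
    ultimately show ?thesis using oN inN \<delta>(1) by blast
  qed
  show ?thesis using that[OF smF close dir] .
qed

end

subsection \<open>Construction of the Reeb function\<close>

context euclidean_manifold
begin

text \<open>One \<open>T\<close> serves all functions at once, so it can be applied to every term of
  a series and to its sum.\<close>

lemma has_derivative_change_chart:
  assumes U: "(U, \<phi>) \<in> A" and V: "(V, \<psi>) \<in> A" and p: "p \<in> U" "p \<in> V"
  obtains T where "linear T"
    "\<And>f D. ((\<lambda>x. f (inv_into U \<phi> x)) has_derivative D) (at (\<phi> p)) \<Longrightarrow>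
       ((\<lambda>x. f (inv_into V \<psi> x) :: real) has_derivative (\<lambda>v. D (T v))) (at (\<psi> p))"
proof
  let ?\<tau> = "\<lambda>x. \<phi> (inv_into V \<psi> x)"
  let ?R = "\<psi> ` (V \<inter> U)"
  have pR: "\<psi> p \<in> ?R" using p by blast
  have oR: "open ?R" by (rule open_chart_image[OF V chart(1)[OF U]])
  have T: "(?\<tau> has_derivative frechet_derivative ?\<tau> (at (\<psi> p))) (at (\<psi> p))"
    by (rule smooth_onD[OF transition_smooth[OF V U] pR])
  show "linear (frechet_derivative ?\<tau> (at (\<psi> p)))" using has_derivative_linear[OF T] .
  fix f :: "'a \<Rightarrow> real" and D assume D: "((\<lambda>x. f (inv_into U \<phi> x)) has_derivative D) (at (\<phi> p))"
  have "((\<lambda>x. f (inv_into U \<phi> (?\<tau> x))) has_derivative (\<lambda>v. D (frechet_derivative ?\<tau> (at (\<psi> p)) v))) (at (\<psi> p))"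
    by (rule has_derivative_compose[OF T]) (use D V p in simp)
  then show "((\<lambda>x. f (inv_into V \<psi> x)) has_derivative (\<lambda>v. D (frechet_derivative ?\<tau> (at (\<psi> p)) v))) (at (\<psi> p))"
    by (rule has_derivative_transform_within_open[OF _ oR pR]) (use U V in auto)
qed

text \<open>Bounds are arranged on finitely many coordinate balls only. This suffices: smoothness is
  local, and the derivative formula in an arbitrary chart follows by one linear change of direction
  that acts on all terms alike.\<close>

lemma smooth_series:
  assumes f: "\<And>n. smooth_function A (f n)"
  obtains c :: "nat \<Rightarrow> real" where "\<And>n. c n > 0" "c sums 1"
    "smooth_function A (\<lambda>q. \<Sum>n. c n * f n q)"
    "\<And>V \<psi> q v. (V, \<psi>) \<in> A \<Longrightarrow> q \<in> V \<Longrightarrow>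
       ((\<lambda>x. \<Sum>n. c n * f n (inv_into V \<psi> x)) has_derivative
         (\<lambda>v. \<Sum>n. c n * frechet_derivative (\<lambda>x. f n (inv_into V \<psi> x)) (at (\<psi> q)) v)) (at (\<psi> q))"
    "\<And>V \<psi> q v. (V, \<psi>) \<in> A \<Longrightarrow> q \<in> V \<Longrightarrow>
       summable (\<lambda>n. c n * frechet_derivative (\<lambda>x. f n (inv_into V \<psi> x)) (at (\<psi> q)) v)"
proof -
  obtain J :: "'a set" and U \<phi> a r where J: "finite J"
    and ch: "\<And>j. j \<in> J \<Longrightarrow> (U j, \<phi> j) \<in> A" and r: "\<And>j. j \<in> J \<Longrightarrow> r j > 0"
    and sub: "\<And>j. j \<in> J \<Longrightarrow> cball (a j) (2 * r j) \<subseteq> \<phi> j ` U j"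
    and cover: "\<And>q. q \<in> topspace M \<Longrightarrow> \<exists>j\<in>J. q \<in> U j \<and> \<phi> j q \<in> ball (a j) (r j)"
    using finite_chart_cover by metis
  define g where "g j n x = f n (inv_into (U j) (\<phi> j) x)" for j n x
  define S where "S j = ball (a j) (r j)" for j
  have smg: "smooth_on (\<phi> j ` U j) (g j n)" if "j \<in> J" for j n
    unfolding g_def[abs_def] by (rule smooth_function_chart[OF f ch[OF that]])
  have subc: "cball (a j) (r j) \<subseteq> \<phi> j ` U j" if "j \<in> J" for j
    using sub[OF that] r[OF that] by (auto simp: subset_iff)
  have subS: "S j \<subseteq> \<phi> j ` U j" if "j \<in> J" for j
    using subc[OF that] by (auto simp: S_def subset_iff)
  obtain c :: "nat \<Rightarrow> real" where c: "\<And>n. c n > 0" "c sums 1"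
    and bd: "\<And>j bs. j \<in> J \<Longrightarrow> set bs \<subseteq> Basis \<Longrightarrow>
       \<exists>B. summable B \<and> (\<forall>n. \<forall>x\<in>cball (a j) (r j). \<bar>c n * iterated_deriv bs (g j n) x\<bar> \<le> B n)"
    by (rule summable_weights[OF J, of "\<lambda>j. \<phi> j ` U j" g "\<lambda>j. cball (a j) (r j)"])
       (use smg subc in auto)
  have bdS: "\<exists>B. summable B \<and> (\<forall>n. \<forall>x\<in>S j. \<bar>c n * iterated_deriv bs (g j n) x\<bar> \<le> B n)"
    if "j \<in> J" "set bs \<subseteq> Basis" for j bs
    using bd[OF that] unfolding S_def by (meson ball_subset_cball subsetD)
  have S: "open (S j)" "convex (S j)" for j by (auto simp: S_def)
  have smS: "smooth_on (S j) (g j n)" if "j \<in> J" for j n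
    by (rule smooth_on_subset[OF smg[OF that] subS[OF that]])
  let ?F = "\<lambda>q. \<Sum>n. c n * f n q"
  have smooth: "smooth_function A ?F"
  proof (rule smooth_function_local)
    fix p assume "p \<in> topspace M"
    then obtain j where j: "j \<in> J" "p \<in> U j" "\<phi> j p \<in> S j" using cover unfolding S_def by blast
    have "smooth_on (S j) (\<lambda>x. \<Sum>n. c n * g j n x)"
      unfolding smooth_on_def using Ck_on_series[OF S smS[OF j(1)] bdS[OF j(1)]] by blast
    then show "\<exists>(U, \<phi>)\<in>A. \<exists>S. p \<in> U \<and> open S \<and> \<phi> p \<in> S \<and> smooth_on S (\<lambda>x. ?F (inv_into U \<phi> x))"
      using ch[OF j(1)] j(2,3) S(1)[of j] unfolding g_def by blast
  qed
  have der: "((\<lambda>x. ?F (inv_into V \<psi> x)) has_derivative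
         (\<lambda>v. \<Sum>n. c n * frechet_derivative (\<lambda>x. f n (inv_into V \<psi> x)) (at (\<psi> q)) v)) (at (\<psi> q)) \<and>
       (\<forall>v. summable (\<lambda>n. c n * frechet_derivative (\<lambda>x. f n (inv_into V \<psi> x)) (at (\<psi> q)) v))"
    if V: "(V, \<psi>) \<in> A" "q \<in> V" for V \<psi> q
  proof -
    have "q \<in> topspace M" using V chart(2) by blast
    then obtain j where j: "j \<in> J" "q \<in> U j" "\<phi> j q \<in> S j" using cover unfolding S_def by blast
    let ?y = "\<phi> j q"
    obtain B0 B where B0: "summable B0" "\<And>n x. x \<in> S j \<Longrightarrow> \<bar>c n * g j n x\<bar> \<le> B0 n"
      and B: "\<And>b. b \<in> Basis \<Longrightarrow> summable (B b)"
        "\<And>b n x. b \<in> Basis \<Longrightarrow> x \<in> S j \<Longrightarrow> \<bar>c n * frechet_derivative (g j n) (at x) b\<bar> \<le> B b n"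
      by (rule first_order_bounds[OF bdS[OF j(1)]]) (assumption, rule that)
    have 1: "((\<lambda>x. \<Sum>n. c n * g j n x) has_derivative (\<lambda>v. \<Sum>n. c n * frechet_derivative (g j n) (at ?y) v)) (at ?y)"
      by (rule series_has_derivative(1)[where ?B0.0 = B0 and B = B])
         (use S smS[OF j(1)] B0 B j(3) in auto)
    have 2: "summable (\<lambda>n. c n * frechet_derivative (g j n) (at ?y) v)" for v
      by (rule series_has_derivative(2)[where ?B0.0 = B0 and B = B])
         (use S smS[OF j(1)] B0 B j(3) in auto)
    obtain T where T: "\<And>f D. ((\<lambda>x. f (inv_into (U j) (\<phi> j) x)) has_derivative D) (at ?y) \<Longrightarrow>
       ((\<lambda>x. f (inv_into V \<psi> x) :: real) has_derivative (\<lambda>v. D (T v))) (at (\<psi> q))"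
      using has_derivative_change_chart[OF ch[OF j(1)] V(1) j(2) V(2)] by metis
    have "((\<lambda>x. f n (inv_into V \<psi> x)) has_derivative (\<lambda>v. frechet_derivative (g j n) (at ?y) (T v))) (at (\<psi> q))" for n
      using T[of "f n"] smooth_onD[OF smS[OF j(1)] j(3)] unfolding g_def by blast
    from frechet_derivative_at[OF this]
    have fd: "frechet_derivative (\<lambda>x. f n (inv_into V \<psi> x)) (at (\<psi> q)) v = frechet_derivative (g j n) (at ?y) (T v)" for n v
      by metis
    show ?thesis unfolding fd using T[of ?F, OF 1[unfolded g_def]] 2 unfolding g_def by blast
  qed
  show ?thesis using that[OF c smooth] der by blast
qed

lemma band_cover:
  fixes u :: "'a \<Rightarrow> real"
  assumes u: "continuous_map M euclidean u" and C: "\<And>q. q \<in> C \<longleftrightarrow> q \<in> topspace M \<and> s \<le> u q \<and> u q \<le> t"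
    and N: "\<And>q. q \<in> C \<Longrightarrow> openin M (N q) \<and> q \<in> N q"
  obtains Q where "finite Q" "Q \<subseteq> C" "C \<subseteq> (\<Union>q\<in>Q. N q)"
proof -
  have "C = {q \<in> topspace M. u q \<in> {s..t}}" using C by auto
  then have "closedin M C" using closedin_continuous_map_preimage[OF u, of "{s..t}"] by simp
  moreover have "compact_space M" using mfd closed_smooth_manifold_def by blast
  ultimately have "compactin M C" by (rule closedin_compact_space[rotated])
  moreover have "\<forall>G\<in>N ` C. openin M G" "C \<subseteq> \<Union>(N ` C)" using N by auto
  ultimately obtain F where F: "finite F" "F \<subseteq> N ` C" "C \<subseteq> \<Union>F"
    unfolding compactin_def by meson
  then obtain Q where "Q \<subseteq> C" "finite Q" "F = N ` Q" using finite_subset_image by metis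
  then show ?thesis using that F by auto
qed

section \<open>Critical points, extrema and regular points\<close>

lemma critical_point_of_extremum:
  assumes f: "smooth_function A f" and p: "p \<in> topspace M"
    and ext: "(\<forall>q\<in>topspace M. f p \<le> f q) \<or> (\<forall>q\<in>topspace M. f q \<le> f p)"
  shows "critical_point A f p"
proof -
  obtain U \<phi> where U: "(U, \<phi>) \<in> A" "p \<in> U" using chart_around[OF p] .
  let ?g = "\<lambda>x. f (inv_into U \<phi> x)"
  have x: "\<phi> p \<in> \<phi> ` U" using U by blast
  have D: "(?g has_derivative frechet_derivative ?g (at (\<phi> p))) (at (\<phi> p))"
    by (rule smooth_onD[OF smooth_function_chart[OF f U(1)] x])
  have ev: "eventually (\<lambda>y. inv_into U \<phi> y \<in> topspace M) (at (\<phi> p))"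
  proof (rule eventually_at_topological[THEN iffD2], intro exI[of _ "\<phi> ` U"] conjI ballI impI)
    show "inv_into U \<phi> y \<in> topspace M" if "y \<in> \<phi> ` U" for y
      using chart(2)[OF U(1)] inv_into_into[OF that] by blast
  qed (use chart(3)[OF U(1)] x in auto)
  have "frechet_derivative ?g (at (\<phi> p)) = (\<lambda>h. 0)"
    using ext
  proof
    assume "\<forall>q\<in>topspace M. f p \<le> f q"
    then have "eventually (\<lambda>y. ?g (\<phi> p) \<le> ?g y) (at (\<phi> p))"
      by (intro eventually_mono[OF ev]) (use U in simp)
    then show ?thesis by (rule has_derivative_local_min[OF D])
  next
    assume "\<forall>q\<in>topspace M. f q \<le> f p"
    then have "eventually (\<lambda>y. ?g y \<le> ?g (\<phi> p)) (at (\<phi> p))"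
      by (intro eventually_mono[OF ev]) (use U in simp)
    then show ?thesis by (rule has_derivative_local_max[OF D])
  qed
  then show ?thesis using D U unfolding critical_point_def comp_def by auto
qed

text \<open>\<open>critical_point\<close> is existential over charts, so the vanishing derivative in
  an unknown chart is carried to \<open>V\<close>, where it contradicts \<open>D\<close>.\<close>

lemma not_critical_point:
  assumes f: "smooth_function A f" and V: "(V, \<psi>) \<in> A" "q \<in> V"
    and D: "((\<lambda>x. f (inv_into V \<psi> x)) has_derivative D) (at (\<psi> q))" "D v \<noteq> 0"
  shows "\<not> critical_point A f q"
proof
  assume "critical_point A f q"
  then obtain U \<phi> where U: "(U, \<phi>) \<in> A" "q \<in> U" "((\<lambda>x. f (inv_into U \<phi> x)) has_derivative (\<lambda>_. 0)) (at (\<phi> q))"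
    unfolding critical_point_def comp_def by blast
  obtain T where T: "\<And>f D. ((\<lambda>x. f (inv_into U \<phi> x)) has_derivative D) (at (\<phi> q)) \<Longrightarrow>
       ((\<lambda>x. f (inv_into V \<psi> x) :: real) has_derivative (\<lambda>v. D (T v))) (at (\<psi> q))"
    by (rule has_derivative_change_chart[OF U(1) V(1) U(2) V(2)]) (rule that)
  have "((\<lambda>x. f (inv_into V \<psi> x)) has_derivative (\<lambda>_. 0)) (at (\<psi> q))"
    by (rule T[OF U(3)])
  from fun_cong[OF has_derivative_unique[OF this D(1)], of v] show False using D(2) by simp
qed

text \<open>Used at a maximum of u: it must lie outside the region where growth is known, which is
  how the value 1 is seen to be attained.\<close>

lemma increasing_along_not_maximal:
  assumes V: "(V, \<psi>) \<in> A" "q \<in> V" and c: "c > 0"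
    and inc: "increasing_along (\<lambda>x. u (inv_into V \<psi> x)) c v (\<psi> q)"
  obtains p where "p \<in> topspace M" "u q < u p"
proof -
  obtain r where r: "r > 0"
    "\<And>x w s. x \<in> ball (\<psi> q) r \<Longrightarrow> w \<in> ball v r \<Longrightarrow> 0 \<le> s \<Longrightarrow> s \<le> r \<Longrightarrow>
       u (inv_into V \<psi> x) + c * s \<le> u (inv_into V \<psi> (x + s *\<^sub>R w))"
    using increasing_alongE[OF inc] by metis
  obtain e where e: "e > 0" "ball (\<psi> q) e \<subseteq> \<psi> ` V" using chart(3)[OF V(1)] V(2) openE by blast
  obtain r' where r': "r' > 0"
    "\<And>x w s. x \<in> ball (\<psi> q) r' \<Longrightarrow> w \<in> ball v r' \<Longrightarrow> 0 \<le> s \<Longrightarrow> s \<le> r' \<Longrightarrow> x + s *\<^sub>R w \<in> ball (\<psi> q) e"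
    using short_step_in_ball[OF e(1)] by metis
  define s where "s = min r r'"
  have s: "s > 0" "s \<le> r" "s \<le> r'" using r(1) r'(1) by (auto simp: s_def)
  show ?thesis
  proof
    have "\<psi> q + s *\<^sub>R v \<in> \<psi> ` V" using r'(2)[of "\<psi> q" v s] r'(1) s e(2) by auto
    from inv_into_into[OF this] chart(2)[OF V(1)]
    show "inv_into V \<psi> (\<psi> q + s *\<^sub>R v) \<in> topspace M" by (rule rev_subsetD)
    have "u q + c * s \<le> u (inv_into V \<psi> (\<psi> q + s *\<^sub>R v))" using r(2)[of "\<psi> q" v s] r(1) s V by simp
    then show "u q < u (inv_into V \<psi> (\<psi> q + s *\<^sub>R v))" using mult_pos_pos[OF c s(1)] by linarith
  qed
qed


text \<open>Nothing is known about u at levels from b upwards, so all steps make their transition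
  strictly below b and the resulting function is constantly 1 above them. No uniform rate c and no
  uniform direction is assumed.\<close>

proposition Reeb_function_of_increasing:
  fixes u :: "'a \<Rightarrow> real"
  assumes u: "continuous_map M euclidean u" and u0: "\<And>q. q \<in> topspace M \<Longrightarrow> 0 \<le> u q"
    and X: "X = {q \<in> topspace M. u q = 0}" "X \<noteq> {}" "X \<noteq> topspace M" and b: "b > 0"
    and inc: "\<And>q. q \<in> topspace M \<Longrightarrow> 0 < u q \<Longrightarrow> u q < b \<Longrightarrow>
      \<exists>(V, \<psi>)\<in>A. \<exists>c v. q \<in> V \<and> c > 0 \<and> increasing_along (\<lambda>x. u (inv_into V \<psi> x)) c v (\<psi> q)"
  shows "\<exists>f. smooth_function A f \<and> Reeb_function M A 0 1 f \<and> {p \<in> topspace M. f p = 0} = X"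
proof -
  obtain F :: "real \<Rightarrow> 'a \<Rightarrow> real" where
    smF: "\<And>e. e > 0 \<Longrightarrow> smooth_function A (F e)"
    and close: "\<And>\<eta>. \<eta> > 0 \<Longrightarrow> \<exists>d>0. \<forall>e q. 0 < e \<and> e < d \<and> q \<in> topspace M \<longrightarrow> \<bar>F e q - u q\<bar> \<le> \<eta>"
    and dir: "\<And>V \<psi> q0 c v. (V, \<psi>) \<in> A \<Longrightarrow> q0 \<in> V \<Longrightarrow> c > 0 \<Longrightarrow>
       increasing_along (\<lambda>x. u (inv_into V \<psi> x)) c v (\<psi> q0) \<Longrightarrow>
       \<exists>N d. open N \<and> \<psi> q0 \<in> N \<and> N \<subseteq> \<psi> ` V \<and> d > 0 \<and>
         (\<forall>e x. 0 < e \<and> e < d \<and> x \<in> N \<longrightarrow> 0 < frechet_derivative (\<lambda>x. F e (inv_into V \<psi> x)) (at x) v)"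
    by (rule smoothing[OF u]) (rule that)
  \<comment> \<open>On \<open>N\<close> one direction v in one chart serves every smoothing
    parameter below d; this is what allows derivatives of different smoothings at the same point to
    be added without cancellation.\<close>
  let ?dirs = "\<lambda>N d. d > 0 \<and> (\<exists>(V, \<psi>)\<in>A. \<exists>v. N \<subseteq> V \<and>
    (\<forall>e. \<forall>q\<in>N. 0 < e \<and> e < d \<longrightarrow> 0 < frechet_derivative (\<lambda>x. F e (inv_into V \<psi> x)) (at (\<psi> q)) v))"
  have "\<forall>q\<in>{q \<in> topspace M. 0 < u q \<and> u q < b}. \<exists>Nd. openin M (fst Nd) \<and> q \<in> fst Nd \<and> ?dirs (fst Nd) (snd Nd)"
  proof
    fix q assume "q \<in> {q \<in> topspace M. 0 < u q \<and> u q < b}"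
    then obtain V \<psi> c v where V: "(V, \<psi>) \<in> A" "q \<in> V" "c > 0" "increasing_along (\<lambda>x. u (inv_into V \<psi> x)) c v (\<psi> q)"
      using inc[of q] by blast
    obtain N d where N: "open N" "\<psi> q \<in> N" "N \<subseteq> \<psi> ` V" "d > 0"
      "\<And>e x. 0 < e \<Longrightarrow> e < d \<Longrightarrow> x \<in> N \<Longrightarrow> 0 < frechet_derivative (\<lambda>x. F e (inv_into V \<psi> x)) (at x) v"
      using dir[OF V] by blast
    define N' where "N' = {q \<in> V. \<psi> q \<in> N}"
    have "?dirs N' d"
      using N(4,5) V(1) by (intro conjI bexI[of _ "(V, \<psi>)"]) (auto simp: N'_def intro!: exI[of _ v])
    moreover have "openin M N'" unfolding N'_def by (rule openin_chart_preimage[OF V(1) N(1)])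
    moreover have "q \<in> N'" using V N by (simp add: N'_def)
    ultimately show "\<exists>Nd. openin M (fst Nd) \<and> q \<in> fst Nd \<and> ?dirs (fst Nd) (snd Nd)"
      by (intro exI[of _ "(N', d)"]) auto
  qed
  from bchoice[OF this] obtain Nd where Nd: "\<forall>q\<in>{q \<in> topspace M. 0 < u q \<and> u q < b}.
     openin M (fst (Nd q)) \<and> q \<in> fst (Nd q) \<and> ?dirs (fst (Nd q)) (snd (Nd q))" ..
  define a where "a n = b * (1 / 4) ^ Suc n" for n
  have a_pos: "a n > 0" for n using b by (simp add: a_def)
  have a_Suc: "a (Suc n) = a n / 4" for n by (simp add: a_def)
  have a_mono: "m \<le> n \<Longrightarrow> a n \<le> a m" for m n
    unfolding a_def using b by (intro mult_left_mono power_decreasing) auto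
  have a_lt_b: "a n < b" for n
  proof -
    have "a n \<le> a 0" by (rule a_mono) simp
    also have "a 0 < b" using b by (simp add: a_def)
    finally show ?thesis .
  qed
  have a_lim: "a \<longlonglongrightarrow> 0"
  proof -
    have "(\<lambda>n. (1 / 4 :: real) ^ n) \<longlonglongrightarrow> 0" by (rule LIMSEQ_realpow_zero) auto
    from tendsto_mult_right_zero[OF LIMSEQ_Suc[OF this], of b] show ?thesis by (simp add: a_def[abs_def])
  qed
  define C where "C m = {q \<in> topspace M. a (Suc m) \<le> u q \<and> u q \<le> a m}" for m
  have C_sub: "q \<in> topspace M \<and> 0 < u q \<and> u q < b" if "q \<in> C m" for q m
    using that a_pos[of "Suc m"] a_lt_b[of m] by (auto simp: C_def)
  have "\<forall>m. \<exists>Q. finite Q \<and> Q \<subseteq> C m \<and> C m \<subseteq> (\<Union>q\<in>Q. fst (Nd q))"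
  proof
    fix m
    show "\<exists>Q. finite Q \<and> Q \<subseteq> C m \<and> C m \<subseteq> (\<Union>q\<in>Q. fst (Nd q))"
    proof (rule band_cover[OF u, of "C m" "a (Suc m)" "a m" "\<lambda>q. fst (Nd q)"])
      show "q \<in> C m \<longleftrightarrow> q \<in> topspace M \<and> a (Suc m) \<le> u q \<and> u q \<le> a m" for q by (simp add: C_def)
      show "openin M (fst (Nd q)) \<and> q \<in> fst (Nd q)" if "q \<in> C m" for q
        using Nd C_sub[OF that] by blast
    qed blast
  qed
  then obtain Q where Q: "\<And>m. finite (Q m)" "\<And>m. Q m \<subseteq> C m" "\<And>m. C m \<subseteq> (\<Union>q\<in>Q m. fst (Nd q))"
    by metis
  \<comment> \<open>With an error of at most \<open>\<eta> n\<close>, the n-th step is in transition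
    wherever \<open>a (n + 2) \<le> u q \<le> a (n + 1)\<close>, and only where
    \<open>a (n + 3) < u q < a n\<close>. The former leaves no gap between successive transitions,
    the latter confines each of them.\<close>
  define \<alpha> where "\<alpha> n = a (n + 2) / 2" for n
  define \<beta> where "\<beta> n = 2 * a (Suc n)" for n
  define \<eta> where "\<eta> n = a (n + 2) / 4" for n
  have levels: "\<alpha> n < \<beta> n" "\<eta> n > 0" "\<beta> n = a n / 2" "a (n + 2) = a n / 16" "a (Suc n) = a n / 4" for n
    using a_pos[of n] by (simp_all add: \<alpha>_def \<beta>_def \<eta>_def a_Suc)
  obtain d' where d': "\<And>n. d' n > 0"
    "\<And>n e q. 0 < e \<Longrightarrow> e < d' n \<Longrightarrow> q \<in> topspace M \<Longrightarrow> \<bar>F e q - u q\<bar> \<le> \<eta> n"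
    using close[OF levels(2)] by metis
  \<comment> \<open>A point where the n-th step is in transition lies in a band \<open>C m\<close>
    with m at most n + 2, because u exceeds \<open>a (n + 3)\<close> there; only these finitely many
    bands constrain \<open>e n\<close>. Halving the minimum makes the inequalities strict.\<close>
  define e where "e n = Min (insert (d' n) (snd ` Nd ` (\<Union>m\<le>n + 2. Q m))) / 2" for n
  have fin: "finite (snd ` Nd ` (\<Union>m\<le>n + 2. Q m))" for n using Q(1) by blast
  have d_pos: "snd (Nd q) > 0" if "q \<in> Q m" for q m
    using Nd C_sub Q(2) that by blast
  have min_pos: "Min (insert (d' n) (snd ` Nd ` (\<Union>m\<le>n + 2. Q m))) > 0" for n
    using fin[of n] d'(1) d_pos by (subst Min_gr_iff) auto
  then have e_pos: "e n > 0" for n by (simp add: e_def)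
  have e_less: "e n < x" if "x \<in> insert (d' n) (snd ` Nd ` (\<Union>m\<le>n + 2. Q m))" for n x
  proof -
    have "Min (insert (d' n) (snd ` Nd ` (\<Union>m\<le>n + 2. Q m))) \<le> x" using fin[of n] that by (intro Min_le) auto
    then show ?thesis using min_pos[of n] unfolding e_def by linarith
  qed
  define G where "G n = F (e n)" for n
  have smG: "smooth_function A (G n)" for n unfolding G_def by (rule smF[OF e_pos])
  have G_close: "\<bar>G n q - u q\<bar> \<le> \<eta> n" if "q \<in> topspace M" for n q
    unfolding G_def using d'(2)[OF e_pos _ that] e_less[of "d' n" n] by simp
  define f where "f n q = step (\<alpha> n) (\<beta> n) (G n q)" for n q
  have smf: "smooth_function A (f n)" for n
    unfolding f_def[abs_def] by (rule smooth_function_compose[OF smooth_on_step[OF levels(1)] smG])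
  have f01: "0 \<le> f n q" "f n q \<le> 1" for n q
    unfolding f_def using step_range[OF levels(1)] by auto
  obtain c :: "nat \<Rightarrow> real" where c: "\<And>n. c n > 0" "c sums 1"
    and sm: "smooth_function A (\<lambda>q. \<Sum>n. c n * f n q)"
    and der: "\<And>V \<psi> q v. (V, \<psi>) \<in> A \<Longrightarrow> q \<in> V \<Longrightarrow>
       ((\<lambda>x. \<Sum>n. c n * f n (inv_into V \<psi> x)) has_derivative
         (\<lambda>v. \<Sum>n. c n * frechet_derivative (\<lambda>x. f n (inv_into V \<psi> x)) (at (\<psi> q)) v)) (at (\<psi> q))"
    and summ': "\<And>V \<psi> q v. (V, \<psi>) \<in> A \<Longrightarrow> q \<in> V \<Longrightarrow>
       summable (\<lambda>n. c n * frechet_derivative (\<lambda>x. f n (inv_into V \<psi> x)) (at (\<psi> q)) v)"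
    by (rule smooth_series[of f, OF smf]) (rule that)
  define g where "g q = (\<Sum>n. c n * f n q)" for q
  have smg: "smooth_function A g" using sm unfolding g_def .
  have summ: "summable (\<lambda>n. c n * f n q)" for q
  proof (rule summable_comparison_test'[of c 0])
    show "summable c" using c(2) sums_summable by blast
    show "norm (c n * f n q) \<le> c n" for n using c(1)[of n] f01[of n q] by (simp add: mult_left_le)
  qed
  have g01: "0 \<le> g q" "g q \<le> 1" for q
  proof -
    show "0 \<le> g q" unfolding g_def using c(1) f01 by (intro suminf_nonneg[OF summ]) (simp add: less_imp_le)
    have "g q \<le> suminf c" unfolding g_def
      using c(1) f01 c(2) by (intro suminf_le[OF _ summ sums_summable]) (simp_all add: mult_left_le less_imp_le)
    then show "g q \<le> 1" using c(2) by (simp add: sums_iff)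
  qed
  have g_zero: "g q = 0" if q: "q \<in> topspace M" "u q = 0" for q
  proof -
    have "f n q = 0" for n
      using G_close[OF q(1), of n] q(2) a_pos[of "n + 2"] unfolding f_def
      by (intro step_eq_0) (simp add: \<alpha>_def \<eta>_def)
    then show ?thesis by (simp add: g_def)
  qed
  have g_pos: "g q > 0" if q: "q \<in> topspace M" "u q > 0" for q
  proof -
    have "eventually (\<lambda>n. a n < u q) sequentially" using order_tendstoD(2)[OF a_lim q(2)] .
    then obtain n where "a (n + 2) < u q"
      unfolding eventually_sequentially by (meson le_add1)
    then have "\<alpha> n < G n q"
      using G_close[OF q(1), of n] a_pos[of "n + 2"] unfolding \<alpha>_def \<eta>_def by linarith
    then have "f n q > 0" unfolding f_def by (rule step_pos[OF levels(1)])
    then show ?thesis unfolding g_def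
      using c(1) f01 by (intro suminf_pos2[OF summ, of _ n]) (auto simp: less_imp_le)
  qed
  \<comment> \<open>If no step is in transition, the bands covered by the transitions are excluded
    one after the other, so u q is at least \<open>a 1\<close>. Then every \<open>G n\<close>
    exceeds its lower level, and a step past its lower level and not in transition is
    complete.\<close>
  have dichotomy: "(\<forall>n. \<beta> n \<le> G n q) \<or> (\<exists>n. \<alpha> n < G n q \<and> G n q < \<beta> n)" if q: "q \<in> topspace M" "u q > 0" for q
  proof (rule disjCI)
    assume non: "\<not> (\<exists>n. \<alpha> n < G n q \<and> G n q < \<beta> n)"
    have above: "u q > a n" if "u q \<ge> a (Suc n)" "n \<ge> 1" for n
    proof (rule ccontr)
      assume "\<not> u q > a n"
      obtain k where k: "n = Suc k" using \<open>n \<ge> 1\<close> by (cases n) auto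
      have "u q \<le> a (Suc k)" "u q \<ge> a (k + 2)" using that \<open>\<not> u q > a n\<close> k by auto
      moreover have "G k q \<le> u q + \<eta> k" "u q - \<eta> k \<le> G k q" using G_close[OF q(1), of k] by linarith+
      ultimately have "\<alpha> k < G k q \<and> G k q < \<beta> k"
        using a_pos[of k] levels(4,5)[of k] unfolding \<alpha>_def \<beta>_def \<eta>_def by (intro conjI; linarith)
      then show False using non by blast
    qed
    have "eventually (\<lambda>n. a n < u q) sequentially" using order_tendstoD(2)[OF a_lim q(2)] .
    then obtain n where n: "a (Suc n) < u q"
      unfolding eventually_sequentially by (meson le_SucI le_refl)
    have "a (Suc k) \<le> u q \<Longrightarrow> a 1 \<le> u q" for k
    proof (induction k)
      case (Suc k)
      then show ?case using above[of "Suc k"] by simp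
    qed simp
    then have u1: "a 1 \<le> u q" using less_imp_le[OF n] .
    show "\<forall>n. \<beta> n \<le> G n q"
    proof
      fix n
      have "a (n + 2) \<le> u q" using a_mono[of 1 "n + 2"] u1 by simp
      then have "\<alpha> n < G n q"
        using G_close[OF q(1), of n] a_pos[of "n + 2"] unfolding \<alpha>_def \<eta>_def by linarith
      then show "\<beta> n \<le> G n q" using non by (meson not_less)
    qed
  qed
  have g_one: "g q = 1" if "\<forall>n. \<beta> n \<le> G n q" for q
  proof -
    have "f n q = 1" for n unfolding f_def using that by (intro step_eq_1[OF levels(1)]) auto
    then show ?thesis using c(2) by (simp add: g_def sums_iff)
  qed
  have band: "a (n + 3) < u q" "u q < a n" if q: "q \<in> topspace M" and "\<alpha> n < G n q" "G n q < \<beta> n" for n q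
  proof -
    have "G n q \<le> u q + \<eta> n" "u q - \<eta> n \<le> G n q" using G_close[OF q, of n] by linarith+
    moreover have "a (n + 3) = a (n + 2) / 4" using a_Suc[of "n + 2"] by (simp add: numeral_3_eq_3)
    ultimately show "a (n + 3) < u q" "u q < a n"
      using that a_pos[of n] levels(3,4)[of n] unfolding \<alpha>_def \<eta>_def by linarith+
  qed
  \<comment> \<open>All steps in transition at q use smoothings finer than the threshold of one
    neighbourhood \<open>fst (Nd q')\<close>, so their derivatives along its v are positive; the
    other steps have derivative 0. The series of derivatives has nonnegative terms and a positive
    n-th one.\<close>
  have noncrit: "\<not> critical_point A g q" if q: "q \<in> topspace M" and n: "\<alpha> n < G n q" "G n q < \<beta> n" for q n
  proof -
    have "u q < a 0" using band(2)[OF q n] a_mono[of 0 n] by linarith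
    moreover have "u q > 0" using band(1)[OF q n] a_pos[of "n + 3"] by linarith
    moreover have "\<exists>m. a (Suc m) \<le> u q \<and> u q \<le> a m" if "a k < u q" for k
      using that
    proof (induction k)
      case (Suc k)
      then show ?case by (cases "a k < u q") (auto intro!: exI[of _ k])
    qed (use \<open>u q < a 0\<close> in simp)
    ultimately obtain m where m: "a (Suc m) \<le> u q" "u q \<le> a m" using band(1)[OF q n] by blast
    have "q \<in> C m" using m q by (simp add: C_def)
    then obtain q' where q': "q' \<in> Q m" "q \<in> fst (Nd q')" using Q(3) by blast
    then have "?dirs (fst (Nd q')) (snd (Nd q'))" using Nd C_sub Q(2) by blast
    then obtain V \<psi> v where V: "(V, \<psi>) \<in> A" "fst (Nd q') \<subseteq> V"
      and pos: "\<And>e q. q \<in> fst (Nd q') \<Longrightarrow> 0 < e \<Longrightarrow> e < snd (Nd q') \<Longrightarrow>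
         0 < frechet_derivative (\<lambda>x. F e (inv_into V \<psi> x)) (at (\<psi> q)) v"
      by blast
    have qV: "q \<in> V" using V(2) q'(2) by blast
    have DG: "0 < frechet_derivative (\<lambda>x. G n (inv_into V \<psi> x)) (at (\<psi> q)) v"
      if "\<alpha> n < G n q" "G n q < \<beta> n" for n
    proof -
      have "a (n + 3) < a m" using band(1)[OF q that] m(2) by linarith
      then have "\<not> n + 3 \<le> m" using a_mono[of "n + 3" m] by (meson not_less)
      then have "m \<le> n + 2" by simp
      then have "e n < snd (Nd q')" using q'(1) by (intro e_less) blast
      then show ?thesis unfolding G_def by (intro pos[OF q'(2) e_pos])
    qed
    have Df: "\<exists>s\<ge>0. (\<alpha> n < G n q \<and> G n q < \<beta> n \<longrightarrow> s > 0) \<and> (\<not> (\<alpha> n < G n q \<and> G n q < \<beta> n) \<longrightarrow> s = 0) \<and>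
        frechet_derivative (\<lambda>x. f n (inv_into V \<psi> x)) (at (\<psi> q)) v =
        s * frechet_derivative (\<lambda>x. G n (inv_into V \<psi> x)) (at (\<psi> q)) v" for n
    proof -
      obtain s where s: "(step (\<alpha> n) (\<beta> n) has_real_derivative s) (at (G n q))" "s \<ge> 0"
        "\<alpha> n < G n q \<Longrightarrow> G n q < \<beta> n \<Longrightarrow> s > 0" "\<not> (\<alpha> n < G n q \<and> G n q < \<beta> n) \<Longrightarrow> s = 0"
        using step_deriv[OF levels(1)] by metis
      have hG: "((\<lambda>x. G n (inv_into V \<psi> x)) has_derivative frechet_derivative (\<lambda>x. G n (inv_into V \<psi> x)) (at (\<psi> q))) (at (\<psi> q))"
        by (rule smooth_onD[OF smooth_function_chart[OF smG V(1)]]) (use qV in blast)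
      have "((\<lambda>x. f n (inv_into V \<psi> x)) has_derivative
          (\<lambda>w. s * frechet_derivative (\<lambda>x. G n (inv_into V \<psi> x)) (at (\<psi> q)) w)) (at (\<psi> q))"
        unfolding f_def
        by (rule has_derivative_compose[OF hG]) (use s(1) qV V(1) in \<open>simp add: has_field_derivative_def\<close>)
      from fun_cong[OF frechet_derivative_at[OF this], of v] s show ?thesis by auto
    qed
    have nonneg: "0 \<le> c k * frechet_derivative (\<lambda>x. f k (inv_into V \<psi> x)) (at (\<psi> q)) v" for k
    proof (cases "\<alpha> k < G k q \<and> G k q < \<beta> k")
      case True
      obtain s where "s \<ge> 0" "frechet_derivative (\<lambda>x. f k (inv_into V \<psi> x)) (at (\<psi> q)) v =
        s * frechet_derivative (\<lambda>x. G k (inv_into V \<psi> x)) (at (\<psi> q)) v" using Df[of k] by blast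
      then show ?thesis using c(1)[of k] DG[of k] True by simp
    next
      case False
      then have "frechet_derivative (\<lambda>x. f k (inv_into V \<psi> x)) (at (\<psi> q)) v = 0" using Df[of k] by auto
      then show ?thesis by simp
    qed
    obtain s where "s > 0" "frechet_derivative (\<lambda>x. f n (inv_into V \<psi> x)) (at (\<psi> q)) v =
        s * frechet_derivative (\<lambda>x. G n (inv_into V \<psi> x)) (at (\<psi> q)) v" using Df[of n] n by blast
    then have "0 < c n * frechet_derivative (\<lambda>x. f n (inv_into V \<psi> x)) (at (\<psi> q)) v"
      using c(1)[of n] DG[OF n] by simp
    then have pos: "0 < (\<Sum>k. c k * frechet_derivative (\<lambda>x. f k (inv_into V \<psi> x)) (at (\<psi> q)) v)"
      by (rule suminf_pos2[OF summ'[OF V(1) qV] nonneg])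
    have "((\<lambda>x. g (inv_into V \<psi> x)) has_derivative
        (\<lambda>v. \<Sum>k. c k * frechet_derivative (\<lambda>x. f k (inv_into V \<psi> x)) (at (\<psi> q)) v)) (at (\<psi> q))"
      unfolding g_def by (rule der[OF V(1) qV])
    then show ?thesis
      by (rule not_critical_point[OF smg V(1) qV, where v = v]) (rule less_imp_neq[OF pos, symmetric])
  qed
  have zero_set: "{p \<in> topspace M. g p = 0} = X"
    using g_zero g_pos u0 unfolding X(1) by (force simp: less_eq_real_def)
  have crit: "g q = 0 \<or> g q = 1" if q: "q \<in> topspace M" "critical_point A g q" for q
  proof (cases "u q = 0")
    case False
    then have "u q > 0" using u0[OF q(1)] by simp
    then show ?thesis using dichotomy[OF q(1)] noncrit[OF q(1)] g_one q(2) by blast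
  qed (use g_zero[OF q(1)] in simp)
  have attain0: "\<exists>q\<in>topspace M. critical_point A g q \<and> g q = 0"
  proof -
    obtain q where "q \<in> topspace M" "g q = 0" using X(2) zero_set by blast
    then show ?thesis using critical_point_of_extremum[OF smg, of q] g01(1) by auto
  qed
  have attain1: "\<exists>q\<in>topspace M. critical_point A g q \<and> g q = 1"
  proof -
    have "compactin M (topspace M)" using mfd by (simp add: closed_smooth_manifold_def compact_space_def)
    from image_compactin[OF this u] have cpt: "compact (u ` topspace M)" by simp
    have ne: "u ` topspace M \<noteq> {}" using X(1,2) by blast
    from compact_attains_sup[OF cpt ne]
    obtain q where q: "q \<in> topspace M" "\<And>p. p \<in> topspace M \<Longrightarrow> u p \<le> u q" by blast
    obtain p where p: "p \<in> topspace M" "p \<notin> X" using X(1,3) by blast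
    then have "u p > 0" using u0[OF p(1)] X(1) by (simp add: less_eq_real_def)
    then have uq: "u q > 0" using q(2)[OF p(1)] by linarith
    \<comment> \<open>A maximum of u below b could still be increased. At level b or above no step
      is in transition, so the value there is 1.\<close>
    have "\<not> u q < b"
    proof
      assume "u q < b"
      then obtain V \<psi> c v where V: "(V, \<psi>) \<in> A" "q \<in> V" "c > 0" "increasing_along (\<lambda>x. u (inv_into V \<psi> x)) c v (\<psi> q)"
        using inc[OF q(1) uq] by blast
      obtain p where "p \<in> topspace M" "u q < u p" using increasing_along_not_maximal[OF V] .
      then show False using q(2)[of p] by simp
    qed
    then have "\<not> (\<alpha> n < G n q \<and> G n q < \<beta> n)" for n
      using band(2)[OF q(1), of n] a_lt_b[of n] by auto
    then have "g q = 1" using dichotomy[OF q(1) uq] g_one by blast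
    then show ?thesis using critical_point_of_extremum[OF smg q(1)] g01(2) q(1) by auto
  qed
  have "Reeb_function M A 0 1 g"
    unfolding Reeb_function_def critical_values_def
  proof (intro conjI)
    show "\<exists>k\<ge>2. Ck_function k A g" by (rule smooth_function_imp_Ck_function[OF smg])
    show "g ` {p \<in> topspace M. critical_point A g p} = {0, 1}"
      using crit attain0 attain1 by force
  qed (use g01 in auto)
  then show ?thesis using smg zero_set by blast
qed

end

subsection \<open>Barycentric coordinates in a simplicial complex\<close>

definition verts :: "'b::euclidean_space set \<Rightarrow> 'b set" where
  "verts S = {x. x extreme_point_of S}"

lemma verts_convex_hull: "\<not> affine_dependent C \<Longrightarrow> verts (convex hull C) = C"
  by (auto simp: verts_def extreme_point_of_convex_hull_affine_independent)

lemma simplicial_complex_simplex: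
  assumes "simplicial_complex K" "S \<in> K"
  shows "\<not> affine_dependent (verts S)" "finite (verts S)" "S = convex hull (verts S)"
proof -
  obtain n where "n simplex S" using assms unfolding simplicial_complex_def by blast
  then obtain C where C: "\<not> affine_dependent C" "S = convex hull C" unfolding simplex_def by blast
  then have "verts S = C" using verts_convex_hull by blast
  then show "\<not> affine_dependent (verts S)" "finite (verts S)" "S = convex hull (verts S)"
    using C aff_independent_finite by auto
qed

lemma simplicial_complex_face:
  assumes "simplicial_complex K" "S \<in> K" "C \<subseteq> verts S"
  shows "convex hull C \<in> K" "verts (convex hull C) = C"
proof -
  note S = simplicial_complex_simplex[OF assms(1,2)]
  have "convex hull C face_of S"
    using face_of_convex_hull_affine_independent[OF S(1)] assms(3) S(3) by auto
  then show "convex hull C \<in> K" using assms unfolding simplicial_complex_def by blast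
  show "verts (convex hull C) = C"
    by (rule verts_convex_hull) (use affine_independent_subset[OF S(1) assms(3)] in simp)
qed

lemma affine_coords_unique:
  assumes "\<not> affine_dependent C" "finite C" "sum s C = 1" "sum t C = 1"
    "(\<Sum>v\<in>C. s v *\<^sub>R v) = (\<Sum>v\<in>C. t v *\<^sub>R v)" "v \<in> C"
  shows "s v = t v"
proof (rule ccontr)
  assume "s v \<noteq> t v"
  then have "affine_dependent C"
    unfolding affine_dependent_explicit_finite[OF assms(2)]
    using assms by (intro exI[of _ "\<lambda>v. s v - t v"]) (auto simp: sum_subtractf algebra_simps)
  then show False using assms(1) by blast
qed

text \<open>Coordinates are extended by 0 to all vectors, so that those of a point taken in
  different simplices of a complex are equal as functions. Without this, \<open>bary\<close> would
  depend on the simplex chosen.\<close>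

definition coords_in :: "'b::euclidean_space set \<Rightarrow> 'b \<Rightarrow> ('b \<Rightarrow> real) \<Rightarrow> bool" where
  "coords_in S x t \<longleftrightarrow> (\<forall>v. 0 \<le> t v) \<and> (\<forall>v. v \<notin> verts S \<longrightarrow> t v = 0) \<and>
     sum t (verts S) = 1 \<and> (\<Sum>v\<in>verts S. t v *\<^sub>R v) = x"

definition bary :: "'b::euclidean_space set set \<Rightarrow> 'b \<Rightarrow> 'b \<Rightarrow> real" where
  "bary K x = (SOME t. \<exists>S\<in>K. coords_in S x t)"

lemma coords_in_exists:
  assumes "simplicial_complex K" "S \<in> K" "x \<in> S" obtains t where "coords_in S x t"
proof -
  note S = simplicial_complex_simplex[OF assms(1,2)]
  have "x \<in> convex hull (verts S)" using assms(3) S(3) by simp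
  then obtain t where t: "\<forall>v\<in>verts S. 0 \<le> t v" "sum t (verts S) = 1" "(\<Sum>v\<in>verts S. t v *\<^sub>R v) = x"
    unfolding convex_hull_finite[OF S(2)] by blast
  have "coords_in S x (\<lambda>v. if v \<in> verts S then t v else 0)"
    using t unfolding coords_in_def by (auto cong: sum.cong if_cong)
  then show ?thesis using that by blast
qed

lemma coords_in_imp_mem:
  assumes "simplicial_complex K" "S \<in> K" "coords_in S x t" shows "x \<in> S"
proof -
  note S = simplicial_complex_simplex[OF assms(1,2)]
  have "x \<in> convex hull (verts S)"
    unfolding convex_hull_finite[OF S(2)] using assms(3) by (auto simp: coords_in_def)
  then show ?thesis using S(3) by simp
qed

lemma coords_in_face:
  assumes K: "simplicial_complex K" and S: "S \<in> K" and C: "C \<subseteq> verts S" and s: "coords_in (convex hull C) x s"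
  shows "coords_in S x s"
proof -
  have v: "verts (convex hull C) = C" by (rule simplicial_complex_face[OF K S C])
  have fin: "finite (verts S)" by (rule simplicial_complex_simplex[OF K S])
  have "sum s (verts S) = sum s C" "(\<Sum>v\<in>verts S. s v *\<^sub>R v) = (\<Sum>v\<in>C. s v *\<^sub>R v)"
    using s v by (simp_all add: coords_in_def sum.mono_neutral_right[OF fin C])
  then show ?thesis using s C v by (auto simp: coords_in_def)
qed

lemma coords_in_unique_simplex:
  assumes K: "simplicial_complex K" "S \<in> K" and "coords_in S x s" "coords_in S x t"
  shows "s = t"
proof
  fix v
  note S = simplicial_complex_simplex[OF K]
  show "s v = t v"
    using affine_coords_unique[OF S(1,2), of s t v] assms(3,4)
    by (cases "v \<in> verts S") (auto simp: coords_in_def)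
qed

text \<open>The point lies in the common face of the two simplices, and its coordinates in that
  face, extended by 0, are coordinates in both.\<close>

lemma coords_in_unique:
  assumes K: "simplicial_complex K" and S: "S \<in> K" "coords_in S x s" and T: "T \<in> K" "coords_in T x t"
  shows "s = t"
proof -
  have x: "x \<in> S \<inter> T" using coords_in_imp_mem[OF K S] coords_in_imp_mem[OF K T] by blast
  have f: "(S \<inter> T) face_of S" "(S \<inter> T) face_of T"
    using K S(1) T(1) unfolding simplicial_complex_def by (blast, metis inf_commute)
  have F: "S \<inter> T \<in> K" using K S(1) f(1) unfolding simplicial_complex_def by blast
  obtain r where r: "coords_in (S \<inter> T) x r" using coords_in_exists[OF K F x] .
  have sub: "verts (S \<inter> T) \<subseteq> verts S" "verts (S \<inter> T) \<subseteq> verts T"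
    using extreme_point_of_face[OF f(1)] extreme_point_of_face[OF f(2)] unfolding verts_def by blast+
  have "S \<inter> T = convex hull verts (S \<inter> T)" by (rule simplicial_complex_simplex[OF K F])
  then have "coords_in S x r" "coords_in T x r"
    using coords_in_face[OF K S(1) sub(1)] coords_in_face[OF K T(1) sub(2)] r by auto
  then show ?thesis using coords_in_unique_simplex[OF K S(1) S(2)] coords_in_unique_simplex[OF K T(1) T(2)] by metis
qed

lemma bary_eqI:
  assumes "simplicial_complex K" "S \<in> K" "coords_in S x t"
  shows "bary K x = t"
proof -
  have "\<exists>S\<in>K. coords_in S x (bary K x)"
    unfolding bary_def using assms by (intro someI_ex[of "\<lambda>t. \<exists>S\<in>K. coords_in S x t"]) blast
  then show ?thesis using coords_in_unique[OF assms(1)] assms(2,3) by blast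
qed

lemma coords_in_bary:
  assumes "simplicial_complex K" "S \<in> K" "x \<in> S" shows "coords_in S x (bary K x)"
  using coords_in_exists[OF assms] bary_eqI[OF assms(1,2)] by metis

text \<open>Placing the points at height 1 in a space with one more dimension turns affine into
  linear independence; the dual functionals exist there, and restricting them to height 1 gives
  affine functions.\<close>

lemma affine_coordinate_functions:
  fixes C :: "'b::euclidean_space set"
  assumes C: "\<not> affine_dependent C" and fin: "finite C"
  obtains l k where "\<And>v. bounded_linear (l v)"
    "\<And>t v. v \<in> C \<Longrightarrow> sum t C = 1 \<Longrightarrow> l v (\<Sum>c\<in>C. t c *\<^sub>R c) + k v = (t v :: real)"
proof -
  let ?i = "\<lambda>c::'b. (c, 1::real)"
  have inj: "inj_on ?i C" by (auto simp: inj_on_def)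
  have ind: "independent (?i ` C)"
  proof
    assume "dependent (?i ` C)"
    then obtain w where w: "\<exists>c\<in>?i ` C. w c \<noteq> 0" "(\<Sum>c\<in>?i ` C. w c *\<^sub>R c) = 0"
      using fin by (auto simp: dependent_finite)
    have "(\<Sum>c\<in>C. w (?i c) *\<^sub>R ?i c) = 0" using w(2) by (simp add: sum.reindex[OF inj])
    then have "fst (\<Sum>c\<in>C. w (?i c) *\<^sub>R ?i c) = 0" "snd (\<Sum>c\<in>C. w (?i c) *\<^sub>R ?i c) = 0" by auto
    then have "(\<Sum>c\<in>C. w (?i c) *\<^sub>R c) = 0" "(\<Sum>c\<in>C. w (?i c)) = 0"
      by (simp_all add: fst_sum snd_sum)
    then have "affine_dependent C" unfolding affine_dependent_explicit_finite[OF fin]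
      using w(1) by (intro exI[of _ "\<lambda>c. w (?i c)"]) auto
    then show False using C by blast
  qed
  have "\<exists>g. linear g \<and> (\<forall>c\<in>?i ` C. g c = (if fst c = v then 1 else 0::real))" for v
    using linear_independent_extend[OF ind, of "\<lambda>c. if fst c = v then 1 else 0::real"] by simp
  then obtain g where g: "\<And>v. linear (g v)" "\<And>v c. c \<in> C \<Longrightarrow> g v (?i c) = (if c = v then 1 else 0::real)"
    by (metis (no_types, lifting) fst_conv imageI)
  show ?thesis
  proof
    fix v
    have "linear (\<lambda>x::'b. (x, 0::real))" by (intro linearI) auto
    from linear_compose[OF this g(1)[of v]]
    show "bounded_linear (\<lambda>x. g v (x, 0))" by (simp add: linear_linear comp_def)
    fix t :: "'b \<Rightarrow> real" assume v: "v \<in> C" and t: "sum t C = 1"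
    have "g v (\<Sum>c\<in>C. t c *\<^sub>R c, 0) + g v (0, 1) = g v ((\<Sum>c\<in>C. t c *\<^sub>R c, 0) + (0, 1))"
      using linear_add[OF g(1)] by metis
    also have "(\<Sum>c\<in>C. t c *\<^sub>R c, 0) + (0, 1) = (\<Sum>c\<in>C. t c *\<^sub>R ?i c)"
      using t by (intro prod_eqI) (simp_all add: fst_sum snd_sum)
    also have "g v \<dots> = (\<Sum>c\<in>C. t c * g v (?i c))"
      by (simp only: linear_sum[OF g(1)] linear_scale[OF g(1)] real_scaleR_def)
    also have "\<dots> = (\<Sum>c\<in>C. if c = v then t v else 0)" by (intro sum.cong) (auto simp: g(2))
    also have "\<dots> = t v" using v fin by simp
    finally show "g v (\<Sum>c\<in>C. t c *\<^sub>R c, 0) + g v (0, 1) = t v" .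
  qed
qed

text \<open>
  The sum of the monomials of the simplices outside \<open>L\<close> vanishes exactly on the polyhedron of
  \<open>L\<close>, even if \<open>L\<close> is not a full subcomplex; no subdivision is needed.
\<close>

definition monomial_sum :: "'b::euclidean_space set set \<Rightarrow> 'b set set \<Rightarrow> 'b \<Rightarrow> real" where
  "monomial_sum K L x = (\<Sum>S\<in>K - L. \<Prod>v\<in>verts S. bary K x v)"

section \<open>Regularity and zero set of the monomial sum\<close>

lemma smooth_on_prod:
  fixes f :: "'i \<Rightarrow> 'c::real_normed_vector \<Rightarrow> real"
  assumes "open S" "\<And>i. i \<in> I \<Longrightarrow> smooth_on S (f i)"
  shows "smooth_on S (\<lambda>x. \<Prod>i\<in>I. f i x)"
  using assms(2)
  by (induction I rule: infinite_finite_induct) (auto intro: smooth_on_const smooth_on_mult[OF assms(1)])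

text \<open>On \<open>T\<close> the coordinates of its vertices are affine functions and all others
  vanish, so the sum is the restriction of a polynomial on the ambient space. The extension beyond
  \<open>T\<close> is what gives meaning to derivatives at boundary points; it depends on
  \<open>T\<close>.\<close>

lemma monomial_sum_smooth_on_simplex:
  assumes K: "simplicial_complex K" and T: "T \<in> K"
  obtains p where "smooth_on UNIV p" "\<And>y. y \<in> T \<Longrightarrow> p y = monomial_sum K L y"
proof -
  note S = simplicial_complex_simplex[OF K T]
  obtain l k where l: "\<And>v. bounded_linear (l v)"
    "\<And>t v. v \<in> verts T \<Longrightarrow> sum t (verts T) = 1 \<Longrightarrow> l v (\<Sum>c\<in>verts T. t c *\<^sub>R c) + k v = (t v :: real)"
    by (rule affine_coordinate_functions[OF S(1,2)]) (rule that)
  define a where "a v y = (if v \<in> verts T then l v y + k v else 0)" for v y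
  have sma: "smooth_on UNIV (a v)" for v
  proof (cases "v \<in> verts T")
    case True
    then have "a v = (\<lambda>y. l v y + k v)" by (auto simp: a_def)
    then show ?thesis
      using smooth_on_add[OF open_UNIV smooth_on_bounded_linear[OF l(1) open_UNIV] smooth_on_const] by simp
  next
    case False
    then have "a v = (\<lambda>y. 0)" by (auto simp: a_def)
    then show ?thesis using smooth_on_const[of UNIV 0] by simp
  qed
  have a: "a v y = bary K y v" if "y \<in> T" for v y
    using coords_in_bary[OF K T that] l(2)[of v "bary K y"] by (auto simp: a_def coords_in_def)
  show ?thesis
  proof
    show "smooth_on UNIV (\<lambda>y. \<Sum>S\<in>K - L. \<Prod>v\<in>verts S. a v y)"
      by (intro smooth_on_sum smooth_on_prod sma open_UNIV)
    show "(\<Sum>S\<in>K - L. \<Prod>v\<in>verts S. a v y) = monomial_sum K L y" if "y \<in> T" for y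
      using a[OF that] by (simp add: monomial_sum_def)
  qed
qed

lemma simplicial_complex_closed: "simplicial_complex K \<Longrightarrow> S \<in> K \<Longrightarrow> closed S"
  using simplicial_complex_simplex[of K S] finite_imp_compact_convex_hull compact_imp_closed by metis

lemma continuous_on_monomial_sum:
  assumes K: "simplicial_complex K" shows "continuous_on (\<Union>K) (monomial_sum K L)"
proof -
  have "continuous_on T (monomial_sum K L)" if T: "T \<in> K" for T
  proof -
    obtain p where p: "smooth_on UNIV p" "\<And>y. y \<in> T \<Longrightarrow> p y = monomial_sum K L y"
      using monomial_sum_smooth_on_simplex[OF K T] by metis
    have "continuous_on T p" using smooth_on_continuous_on[OF smooth_on_subset[OF p(1)]] by simp
    then show ?thesis using p(2) by (simp cong: continuous_on_cong)
  qed
  then have "continuous_on (\<Union>T\<in>K. T) (monomial_sum K L)"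
    using K by (intro continuous_on_closed_Union) (auto simp: simplicial_complex_def intro: simplicial_complex_closed[OF K])
  then show ?thesis by simp
qed

lemma bary_nonneg:
  assumes "simplicial_complex K" "x \<in> \<Union>K" shows "0 \<le> bary K x v"
  using assms coords_in_bary[OF assms(1)] by (auto simp: coords_in_def)

lemma monomial_sum_nonneg:
  assumes "simplicial_complex K" "x \<in> \<Union>K" shows "0 \<le> monomial_sum K L x"
  unfolding monomial_sum_def by (intro sum_nonneg prod_nonneg bary_nonneg[OF assms])

text \<open>The vertices with nonzero coordinate span the smallest face containing x, and the
  monomial of that face is positive at x; so the sum vanishes only if the face belongs to
  \<open>L\<close>. Conversely, a simplex whose monomial is nonzero at a point of a simplex of
  \<open>L\<close> is a face of the latter, hence in \<open>L\<close>.\<close>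

lemma monomial_sum_eq_0_iff:
  assumes K: "simplicial_complex K" and L: "simplicial_complex L" "L \<subseteq> K" and x: "x \<in> \<Union>K"
  shows "monomial_sum K L x = 0 \<longleftrightarrow> x \<in> \<Union>L"
proof -
  obtain T where T: "T \<in> K" "x \<in> T" using x by blast
  note c = coords_in_bary[OF K T]
  have finK: "finite (K - L)" using K by (simp add: simplicial_complex_def)
  have "monomial_sum K L x = 0 \<longleftrightarrow> (\<forall>S\<in>K - L. (\<Prod>v\<in>verts S. bary K x v) = 0)"
    unfolding monomial_sum_def
    by (rule sum_nonneg_eq_0_iff[OF finK]) (intro prod_nonneg bary_nonneg[OF K x])
  also have "\<dots> \<longleftrightarrow> (\<forall>S\<in>K - L. \<exists>v\<in>verts S. bary K x v = 0)"
    using simplicial_complex_simplex(2)[OF K] by (auto simp: prod_zero_iff)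
  also have "\<dots> \<longleftrightarrow> x \<in> \<Union>L"
  proof
    assume all: "\<forall>S\<in>K - L. \<exists>v\<in>verts S. bary K x v = 0"
    define C where "C = {v \<in> verts T. bary K x v \<noteq> 0}"
    have C: "C \<subseteq> verts T" by (auto simp: C_def)
    note f = simplicial_complex_face[OF K T(1) C]
    have "finite (verts T)" by (rule simplicial_complex_simplex[OF K T(1)])
    then have "sum (bary K x) (verts T) = sum (bary K x) C" "(\<Sum>v\<in>verts T. bary K x v *\<^sub>R v) = (\<Sum>v\<in>C. bary K x v *\<^sub>R v)"
      by (auto simp: C_def intro!: sum.mono_neutral_right)
    then have "coords_in (convex hull C) x (bary K x)"
      using c f(2) unfolding coords_in_def C_def by auto
    then have "x \<in> convex hull C" by (rule coords_in_imp_mem[OF K f(1)])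
    moreover have "convex hull C \<in> L" using all f by (auto simp: C_def)
    ultimately show "x \<in> \<Union>L" by blast
  next
    assume "x \<in> \<Union>L"
    then obtain S where S: "S \<in> L" "x \<in> S" by blast
    have SK: "S \<in> K" using S L by blast
    show "\<forall>R\<in>K - L. \<exists>v\<in>verts R. bary K x v = 0"
    proof (rule ccontr)
      assume "\<not> ?thesis"
      then obtain R where R: "R \<in> K" "R \<notin> L" "\<And>v. v \<in> verts R \<Longrightarrow> bary K x v \<noteq> 0" by blast
      then have "verts R \<subseteq> verts S" using coords_in_bary[OF K SK S(2)] by (auto simp: coords_in_def)
      then have "convex hull verts R \<in> L" using simplicial_complex_face[OF L(1) S(1)] by blast
      then show False using R simplicial_complex_simplex(3)[OF K R(1)] by simp
    qed
  qed
  finally show ?thesis .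
qed


subsection \<open>Leaving a subcomplex\<close>

text \<open>
  With \<open>I\<close> the vertices carrying a large coordinate of \<open>x\<close>, the direction enlarges all other
  coordinates of \<open>x\<close> by a common factor. If \<open>x\<close> is close to \<open>L\<close> then \<open>I\<close> spans a simplex of \<open>L\<close>,
  so every monomial involves a coordinate that is enlarged, while those on \<open>I\<close> hardly shrink.
\<close>

lemma monomial_sum_direction:
  fixes K L :: "'b::euclidean_space set set"
  assumes K: "simplicial_complex K" and L: "simplicial_complex L" "L \<subseteq> K"
  obtains b where "b > 0" "\<And>x. x \<in> \<Union>K \<Longrightarrow> monomial_sum K L x < b \<Longrightarrow>
     \<exists>w. \<forall>s. 0 \<le> s \<and> s \<le> 1 / 2 \<longrightarrow> (\<forall>T\<in>K. x \<in> T \<longrightarrow> x + s *\<^sub>R w \<in> T) \<and>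
       monomial_sum K L x + monomial_sum K L x / 4 * s \<le> monomial_sum K L (x + s *\<^sub>R w)"
proof -
  define Vs where "Vs = (\<Union>S\<in>K. verts S)"
  have finK: "finite K" using K by (simp add: simplicial_complex_def)
  have finVs: "finite Vs" unfolding Vs_def using finK simplicial_complex_simplex(2)[OF K] by auto
  define N where "N = Suc (card Vs)"
  \<comment> \<open>Coordinates below \<open>m\<close> add up to at most \<open>1 / (4 * N)\<close>,
    so the compensating loss \<open>\<kappa>\<close> on the large coordinates satisfies
    \<open>N * \<kappa> \<le> 1 / 3\<close>, as the product estimate requires.\<close>
  define m where "m = 1 / (4 * real N ^ 2)"
  have N1: "real N \<ge> 1" by (simp add: N_def)
  then have "4 * real N ^ 2 \<ge> 1" using one_le_power[OF N1, of 2] by linarith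
  then have m: "m > 0" "m \<le> 1" using N1 by (auto simp: m_def)
  have card_le: "card C \<le> N" if "C \<subseteq> Vs" for C
    using card_mono[OF finVs that] by (simp add: N_def)
  show ?thesis
  proof (rule that[of "m ^ N"])
    show "m ^ N > 0" using m by simp
    fix x assume x: "x \<in> \<Union>K" and small: "monomial_sum K L x < m ^ N"
    define t where "t = bary K x"
    have t0: "0 \<le> t v" for v unfolding t_def by (rule bary_nonneg[OF K x])
    have tc: "coords_in T x t" if "T \<in> K" "x \<in> T" for T
      unfolding t_def by (rule coords_in_bary[OF K that])
    have sub: "verts T \<subseteq> Vs" if "T \<in> K" for T using that by (auto simp: Vs_def)
    have tsum: "sum (\<lambda>v. f v * t v) Vs = sum (\<lambda>v. f v * t v) (verts T)"
      "(\<Sum>v\<in>Vs. (f v * t v) *\<^sub>R v) = (\<Sum>v\<in>verts T. (f v * t v) *\<^sub>R v)" if T: "T \<in> K" "x \<in> T" for f T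
      using tc[OF T] by (auto intro!: sum.mono_neutral_right[OF finVs sub[OF T(1)]] simp: coords_in_def)
    obtain T0 where T0: "T0 \<in> K" "x \<in> T0" using x by blast
    have sum1: "sum t Vs = 1" using tsum(1)[OF T0, of "\<lambda>_. 1"] tc[OF T0] by (simp add: coords_in_def)
    define I where "I = {v \<in> Vs. t v \<ge> m}"
    have IT: "I \<subseteq> verts T" if "T \<in> K" "x \<in> T" for T
      using tc[OF that] m by (force simp: I_def coords_in_def)
    note fI = simplicial_complex_face[OF K T0(1) IT[OF T0]]
    have IVs: "I \<subseteq> Vs" by (auto simp: I_def)
    have finI: "finite I" using finVs IVs finite_subset by blast
    \<comment> \<open>Otherwise the monomial of the simplex spanned by \<open>I\<close>, a product
      of at most \<open>N\<close> coordinates that are at least \<open>m\<close>, would alone reach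
      the bound \<open>m ^ N\<close>.\<close>
    have IL: "convex hull I \<in> L"
    proof (rule ccontr)
      assume "convex hull I \<notin> L"
      then have "(\<Prod>v\<in>verts (convex hull I). t v) \<le> monomial_sum K L x"
        unfolding monomial_sum_def t_def[symmetric] using fI finK t0
        by (intro member_le_sum[of "convex hull I" "K - L" "\<lambda>S. \<Prod>v\<in>verts S. t v"]) (auto intro: prod_nonneg)
      moreover have "m ^ card I \<le> (\<Prod>v\<in>I. t v)"
        using prod_mono[of I "\<lambda>_. m" t] m by (simp add: I_def)
      moreover have "m ^ N \<le> m ^ card I" using m card_le[OF IVs] by (intro power_decreasing) auto
      ultimately show False using small fI(2) by simp
    qed
    define \<delta> where "\<delta> = sum t (Vs - I)"
    \<comment> \<open>Enlarging the small coordinates, of total \<open>\<delta>\<close>, at rate 1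
      has to be paid for by the large ones, of total \<open>1 - \<delta>\<close>; this rate keeps
      the sum of all coordinates equal to 1.\<close>
    define \<kappa> where "\<kappa> = \<delta> / (1 - \<delta>)"
    have \<delta>0: "\<delta> \<ge> 0" unfolding \<delta>_def using t0 by (intro sum_nonneg) auto
    have "\<delta> \<le> of_nat (card (Vs - I)) * m"
      unfolding \<delta>_def by (rule sum_bounded_above) (auto simp: I_def)
    also have "\<dots> \<le> real N * m" using card_le[of "Vs - I"] m by (intro mult_right_mono) auto
    also have "\<dots> = 1 / (4 * real N)" using N1 by (simp add: m_def power2_eq_square)
    finally have \<delta>N: "\<delta> \<le> 1 / (4 * real N)" .
    then have N\<delta>: "real N * \<delta> \<le> 1 / 4" using N1 by (simp add: field_simps)
    moreover have "\<delta> \<le> real N * \<delta>" using N1 \<delta>0 by (simp add: mult_le_cancel_right1)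
    ultimately have \<delta>4: "\<delta> \<le> 1 / 4" by linarith
    have \<kappa>0: "\<kappa> \<ge> 0" using \<delta>0 \<delta>4 by (simp add: \<kappa>_def)
    have N\<kappa>: "real N * \<kappa> \<le> 1 / 3"
      using N\<delta> \<delta>4 by (simp add: \<kappa>_def field_simps)
    moreover have "\<kappa> \<le> real N * \<kappa>" using N1 \<kappa>0 by (simp add: mult_le_cancel_right1)
    ultimately have \<kappa>1: "\<kappa> \<le> 1" by linarith
    have "sum t Vs = sum t (Vs - I) + sum t I" by (rule sum.subset_diff[OF IVs finVs])
    then have sumI: "sum t I = 1 - \<delta>" using sum1 by (simp add: \<delta>_def)
    define \<nu> where "\<nu> v = (if v \<in> I then - \<kappa> else 1)" for v
    define w where "w = (\<Sum>v\<in>Vs. (\<nu> v * t v) *\<^sub>R v)"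
    have sum\<nu>: "(\<Sum>v\<in>Vs. \<nu> v * t v) = 0"
    proof -
      have "(\<Sum>v\<in>Vs. \<nu> v * t v) = (\<Sum>v\<in>Vs - I. \<nu> v * t v) + (\<Sum>v\<in>I. \<nu> v * t v)"
        by (rule sum.subset_diff[OF IVs finVs])
      also have "(\<Sum>v\<in>Vs - I. \<nu> v * t v) = \<delta>" unfolding \<delta>_def by (intro sum.cong) (auto simp: \<nu>_def)
      also have "(\<Sum>v\<in>I. \<nu> v * t v) = - \<kappa> * sum t I" unfolding sum_distrib_left by (intro sum.cong) (auto simp: \<nu>_def)
      also have "\<delta> + - \<kappa> * sum t I = 0" using \<delta>4 by (simp add: sumI \<kappa>_def)
      finally show ?thesis .
    qed
    have main: "(\<forall>T\<in>K. x \<in> T \<longrightarrow> x + s *\<^sub>R w \<in> T) \<and>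
       monomial_sum K L x + monomial_sum K L x / 4 * s \<le> monomial_sum K L (x + s *\<^sub>R w)"
      if s: "0 \<le> s" "s \<le> 1 / 2" for s
    proof -
      define fac where "fac v = 1 + s * \<nu> v" for v
      have \<kappa>s: "0 \<le> \<kappa> * s" "\<kappa> * s \<le> 1"
        using \<kappa>0 \<kappa>1 s mult_mono[of \<kappa> 1 s 1] by auto
      have fac_ge: "1 - \<kappa> * s \<le> fac v" for v using s \<kappa>s by (auto simp: fac_def \<nu>_def mult.commute)
      have fac0: "0 \<le> fac v" for v using fac_ge[of v] \<kappa>s by linarith
      define t' where "t' v = fac v * t v" for v
      \<comment> \<open>Coordinates vanishing at x remain 0 and the total remains 1, so the moved
        point stays in every simplex that contains x. The bounds on s and \<open>\<kappa>\<close>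
        keep the factors nonnegative.\<close>
      have t'c: "coords_in T (x + s *\<^sub>R w) t'" if T: "T \<in> K" "x \<in> T" for T
      proof -
        have "sum t' (verts T) = sum t' Vs" using tsum(1)[OF T, of fac] by (simp add: t'_def)
        also have "\<dots> = sum t Vs + s * (\<Sum>v\<in>Vs. \<nu> v * t v)"
          by (simp add: t'_def fac_def algebra_simps sum.distrib sum_distrib_left)
        finally have 1: "sum t' (verts T) = 1" by (simp add: sum1 sum\<nu>)
        have "(\<Sum>v\<in>verts T. t' v *\<^sub>R v) = (\<Sum>v\<in>Vs. t' v *\<^sub>R v)" using tsum(2)[OF T, of fac] by (simp add: t'_def)
        also have "\<dots> = (\<Sum>v\<in>Vs. t v *\<^sub>R v) + s *\<^sub>R w"
          by (simp add: t'_def fac_def w_def algebra_simps sum.distrib scaleR_sum_right)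
        also have "(\<Sum>v\<in>Vs. t v *\<^sub>R v) = x" using tsum(2)[OF T, of "\<lambda>_. 1"] tc[OF T] by (simp add: coords_in_def)
        finally have 2: "(\<Sum>v\<in>verts T. t' v *\<^sub>R v) = x + s *\<^sub>R w" .
        show ?thesis using 1 2 tc[OF T] fac0 by (simp add: coords_in_def t'_def)
      qed
      have stay: "\<forall>T\<in>K. x \<in> T \<longrightarrow> x + s *\<^sub>R w \<in> T"
        using coords_in_imp_mem[OF K] t'c by blast
      have bary': "bary K (x + s *\<^sub>R w) = t'" by (rule bary_eqI[OF K T0(1) t'c[OF T0]])
      have le: "(\<Prod>v\<in>verts S. t v) * (1 + s / 4) \<le> (\<Prod>v\<in>verts S. t' v)" if S: "S \<in> K - L" for S
      proof (cases "(\<Prod>v\<in>verts S. t v) = 0")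
        case True
        then show ?thesis using t0 fac0 by (auto simp: t'_def intro!: prod_nonneg)
      next
        case False
        have SK: "S \<in> K" using S by blast
        have fS: "finite (verts S)" by (rule simplicial_complex_simplex[OF K SK])
        have "\<not> verts S \<subseteq> I"
        proof
          assume "verts S \<subseteq> I"
          then have "convex hull verts S \<in> L" using simplicial_complex_face(1)[OF L(1) IL] fI(2) by simp
          then show False using S simplicial_complex_simplex(3)[OF K SK] by simp
        qed
        then obtain v where v: "v \<in> verts S" "v \<notin> I" by blast
        \<comment> \<open>At most \<open>N\<close> factors remain, each at least
          \<open>1 - \<kappa> * s\<close>; by Bernoulli their product is at least
          \<open>1 - s / 3\<close>. Against the gain \<open>1 + s\<close> this leaves more than
          \<open>1 + s / 4\<close> as long as s is positive and at most
          \<open>1 / 2\<close>.\<close>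
        have "1 + real N * (- (\<kappa> * s)) \<le> (1 + - (\<kappa> * s)) ^ N"
          by (rule Bernoulli_inequality) (use \<kappa>s in simp)
        moreover have "real N * \<kappa> * s \<le> 1 / 3 * s" using N\<kappa> s by (intro mult_right_mono)
        ultimately have "1 - s / 3 \<le> (1 - \<kappa> * s) ^ N" by simp
        also have "\<dots> \<le> (1 - \<kappa> * s) ^ card (verts S - {v})"
          using card_le[of "verts S - {v}"] sub[OF SK] \<kappa>s by (intro power_decreasing) auto
        also have "\<dots> \<le> (\<Prod>v\<in>verts S - {v}. fac v)"
          using prod_mono[of "verts S - {v}" "\<lambda>_. 1 - \<kappa> * s" fac] fac_ge \<kappa>s by simp
        finally have "(1 + s) * (1 - s / 3) \<le> fac v * (\<Prod>v\<in>verts S - {v}. fac v)"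
          using v(2) s by (simp add: fac_def \<nu>_def mult_left_mono)
        also have "\<dots> = (\<Prod>v\<in>verts S. fac v)" using v(1) fS by (simp add: prod.remove)
        finally have "(1 + s) * (1 - s / 3) \<le> (\<Prod>v\<in>verts S. fac v)" .
        moreover have "(1 + s) * (1 - s / 3) = 1 + 2 * s / 3 - s * s / 3" by (simp add: field_simps)
        moreover have "s * s \<le> s / 2" using mult_left_mono[OF s(2,1)] by simp
        ultimately have "1 + s / 4 \<le> (\<Prod>v\<in>verts S. fac v)" using s by linarith
        then have "(\<Prod>v\<in>verts S. t v) * (1 + s / 4) \<le> (\<Prod>v\<in>verts S. t v) * (\<Prod>v\<in>verts S. fac v)"
          using t0 by (intro mult_left_mono prod_nonneg) auto
        then show ?thesis by (simp add: t'_def prod.distrib mult.commute)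
      qed
      have "monomial_sum K L x + monomial_sum K L x / 4 * s = monomial_sum K L x * (1 + s / 4)"
        by (simp add: algebra_simps)
      also have "\<dots> = (\<Sum>S\<in>K - L. (\<Prod>v\<in>verts S. t v) * (1 + s / 4))"
        by (simp add: monomial_sum_def t_def sum_distrib_right)
      also have "\<dots> \<le> (\<Sum>S\<in>K - L. (\<Prod>v\<in>verts S. t' v))" by (rule sum_mono) (rule le)
      also have "\<dots> = monomial_sum K L (x + s *\<^sub>R w)" by (simp add: monomial_sum_def bary')
      finally show ?thesis using stay by blast
    qed
    then show "\<exists>w. \<forall>s. 0 \<le> s \<and> s \<le> 1 / 2 \<longrightarrow> (\<forall>T\<in>K. x \<in> T \<longrightarrow> x + s *\<^sub>R w \<in> T) \<and>
       monomial_sum K L x + monomial_sum K L x / 4 * s \<le> monomial_sum K L (x + s *\<^sub>R w)" by blast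
  qed
qed

section \<open>Growth across the simplices around a point\<close>

text \<open>A path may enter and leave a simplex infinitely often, so no subdivision into finitely
  many pieces is available. Instead, jump from a to the last parameter in a set containing a; the
  remaining half-open interval avoids that set, and its closure is covered by the other sets since
  they are closed. Comparison within one set is assumed for any two of its parameters, even if the
  path leaves it in between.\<close>

lemma mono_on_closed_cover:
  fixes \<kappa> :: "real \<Rightarrow> real"
  assumes "finite I" "\<And>i. i \<in> I \<Longrightarrow> closed (C i)"
    "\<And>i \<sigma> \<sigma>'. i \<in> I \<Longrightarrow> \<sigma> \<in> C i \<inter> {a..s} \<Longrightarrow> \<sigma>' \<in> C i \<inter> {a..s} \<Longrightarrow> \<sigma> \<le> \<sigma>' \<Longrightarrow> \<kappa> \<sigma> \<le> \<kappa> \<sigma>'"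
    "a \<le> s" "{a..s} \<subseteq> (\<Union>i\<in>I. C i)"
  shows "\<kappa> a \<le> \<kappa> s"
  using assms
proof (induction "card I" arbitrary: I a rule: less_induct)
  case less
  obtain i where i: "i \<in> I" "a \<in> C i" using less.prems(4,5) by auto
  have "compact (C i \<inter> {a..s})" using less.prems(2)[OF i(1)] by (simp add: closed_Int_compact)
  moreover have "C i \<inter> {a..s} \<noteq> {}" using i less.prems(4) by auto
  ultimately obtain m where m: "m \<in> C i \<inter> {a..s}" "\<And>\<sigma>. \<sigma> \<in> C i \<inter> {a..s} \<Longrightarrow> \<sigma> \<le> m"
    using compact_attains_sup by metis
  have am: "\<kappa> a \<le> \<kappa> m" using less.prems(3)[OF i(1), of a m] i m less.prems(4) by auto
  show ?case
  proof (cases "m = s")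
    case False
    then have ms: "m < s" using m by auto
    have sub: "{m<..s} \<subseteq> (\<Union>j\<in>I - {i}. C j)"
    proof
      fix \<sigma> assume \<sigma>: "\<sigma> \<in> {m<..s}"
      then have "\<sigma> \<in> {a..s}" "\<sigma> \<notin> C i" using m by auto force
      then show "\<sigma> \<in> (\<Union>j\<in>I - {i}. C j)" using less.prems(5) by blast
    qed
    have "closed (\<Union>j\<in>I - {i}. C j)" using less.prems(1,2) by (intro closed_UN) auto
    then have "closure {m<..s} \<subseteq> (\<Union>j\<in>I - {i}. C j)" using sub closure_minimal by blast
    then have sub': "{m..s} \<subseteq> (\<Union>j\<in>I - {i}. C j)" using ms by simp
    have "\<kappa> m \<le> \<kappa> s"
    proof (rule less.hyps[of "I - {i}" m])
      show "card (I - {i}) < card I" using less.prems(1) i(1) by (rule card_Diff1_less)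
      show "\<kappa> \<sigma> \<le> \<kappa> \<sigma>'" if "j \<in> I - {i}" "\<sigma> \<in> C j \<inter> {m..s}" "\<sigma>' \<in> C j \<inter> {m..s}" "\<sigma> \<le> \<sigma>'" for j \<sigma> \<sigma>'
        using less.prems(3)[of j \<sigma> \<sigma>'] that m by auto
    qed (use less.prems ms sub' in auto)
    then show ?thesis using am by simp
  qed (use am in simp)
qed


lemma strict_derivative_bounded_linear: "strict_derivative f D x \<Longrightarrow> bounded_linear D"
  by (simp add: strict_derivative_def)

text \<open>\<open>G\<close> is the triangulation in coordinates, extended beyond a simplex with
  direction space \<open>P\<close>. Injectivity of \<open>E\<close> on \<open>P\<close> inverts the
  image step: if \<open>G\<close> moves by s along a direction near \<open>E w\<close>, then
  \<open>z - y\<close> is close to \<open>s *\<^sub>R w\<close>, and p grows almost as along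
  w.\<close>

lemma simplex_increment:
  fixes G :: "'b::euclidean_space \<Rightarrow> 'e::euclidean_space" and p :: "'b \<Rightarrow> real"
  assumes G: "strict_derivative G E x" and p: "strict_derivative p D x"
    and P: "subspace P" and inj: "inj_on E P" and w: "w \<in> P" and c: "c > 0" "2 * c \<le> D w"
  obtains r where "r > 0"
    "\<And>y z u s. y \<in> ball x r \<Longrightarrow> z \<in> ball x r \<Longrightarrow> z - y \<in> P \<Longrightarrow> u \<in> ball (E w) r \<Longrightarrow> 0 \<le> s \<Longrightarrow>
       G z - G y = s *\<^sub>R u \<Longrightarrow> p y + c * s \<le> p z"
proof -
  note bE = strict_derivative_bounded_linear[OF G] and bD = strict_derivative_bounded_linear[OF p]
  note lE = bounded_linear.linear[OF bE] and lD = bounded_linear.linear[OF bD]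
  have "\<xi> = 0" if "\<xi> \<in> P" "E \<xi> = 0" for \<xi>
    using inj_onD[OF inj, of \<xi> 0] that subspace_0[OF P] linear_0[OF lE] by simp
  then obtain m where m: "m > 0" "\<And>\<xi>. \<xi> \<in> P \<Longrightarrow> norm (E \<xi>) \<ge> m * norm \<xi>"
    using injective_imp_isometric[OF closed_subspace[OF P] P bE] by (metis mult.commute)
  obtain k where k: "k > 0" "\<And>\<xi>. norm (D \<xi>) \<le> norm \<xi> * k" using bounded_linear.pos_bounded[OF bD] by blast
  define B where "B = 2 * (norm (E w) + 1) / m"
  have B: "B > 0" using m(1) norm_ge_zero[of "E w"] by (simp add: B_def add_nonneg_pos)
  \<comment> \<open>\<open>B\<close> bounds \<open>norm (z - y)\<close> by a multiple of s. The
    constants allow three errors of \<open>c / 3\<close> per unit of s: linearising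
    \<open>G\<close>, replacing the direction by \<open>E w\<close>, and linearising p. They use up
    half of the rate \<open>2 * c\<close>.\<close>
  define e where "e = min (m / 2) (min (c * m / (3 * k * B)) (c / (3 * B)))"
  have e: "e > 0" "e \<le> m / 2" "k * (e * B) / m \<le> c / 3" "e * B \<le> c / 3"
  proof -
    show "e > 0" "e \<le> m / 2" using m(1) c(1) k(1) B by (auto simp: e_def)
    have "e \<le> c * m / (3 * k * B)" by (simp add: e_def)
    then have "e * (3 * k * B) \<le> c * m" using k(1) B by (simp only: pos_le_divide_eq mult_pos_pos zero_less_numeral)
    then show "k * (e * B) / m \<le> c / 3" using m(1) by (simp add: field_simps)
    have "e \<le> c / (3 * B)" by (simp add: e_def)
    then have "e * (3 * B) \<le> c" using B by (simp only: pos_le_divide_eq mult_pos_pos zero_less_numeral)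
    then show "e * B \<le> c / 3" by simp
  qed
  define \<rho> where "\<rho> = min 1 (c * m / (3 * k))"
  have \<rho>: "\<rho> > 0" "\<rho> \<le> 1" "k * \<rho> / m \<le> c / 3"
  proof -
    show "\<rho> > 0" "\<rho> \<le> 1" using m(1) c(1) k(1) by (auto simp: \<rho>_def)
    have "\<rho> \<le> c * m / (3 * k)" by (simp add: \<rho>_def)
    then have "\<rho> * (3 * k) \<le> c * m" using k(1) by (simp only: pos_le_divide_eq mult_pos_pos zero_less_numeral)
    then show "k * \<rho> / m \<le> c / 3" using m(1) by (simp add: field_simps)
  qed
  obtain d1 where d1: "d1 > 0" "\<And>y z. y \<in> ball x d1 \<Longrightarrow> z \<in> ball x d1 \<Longrightarrow> norm (G y - G z - E (y - z)) \<le> e * norm (y - z)"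
    using strict_derivativeE[OF G e(1)] by blast
  obtain d2 where d2: "d2 > 0" "\<And>y z. y \<in> ball x d2 \<Longrightarrow> z \<in> ball x d2 \<Longrightarrow> norm (p y - p z - D (y - z)) \<le> e * norm (y - z)"
    using strict_derivativeE[OF p e(1)] by blast
  show ?thesis
  proof (rule that[of "min \<rho> (min d1 d2)"])
    show "min \<rho> (min d1 d2) > 0" using \<rho> d1 d2 by simp
    fix y z u s
    assume yz: "y \<in> ball x (min \<rho> (min d1 d2))" "z \<in> ball x (min \<rho> (min d1 d2))" and P': "z - y \<in> P"
      and u: "u \<in> ball (E w) (min \<rho> (min d1 d2))" and s: "0 \<le> s" and eq: "G z - G y = s *\<^sub>R u"
    define \<xi> where "\<xi> = z - y"
    have u\<rho>: "norm (u - E w) \<le> \<rho>" using u by (simp add: dist_norm norm_minus_commute)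
    have nu: "norm u \<le> norm (E w) + 1" using u\<rho> \<rho>(2) norm_triangle_sub[of u "E w"] by linarith
    have g: "norm (s *\<^sub>R u - E \<xi>) \<le> e * norm \<xi>" using d1(2)[of z y] yz eq by (simp add: \<xi>_def)
    have "m * norm \<xi> \<le> norm (E \<xi>)" using m(2) P' by (simp add: \<xi>_def)
    also have "\<dots> \<le> norm (s *\<^sub>R u) + norm (s *\<^sub>R u - E \<xi>)"
      using norm_triangle_ineq4[of "s *\<^sub>R u" "s *\<^sub>R u - E \<xi>"] by simp
    also have "\<dots> \<le> s * (norm (E w) + 1) + m / 2 * norm \<xi>"
      using g s nu mult_left_mono[OF nu s] mult_right_mono[OF e(2), of "norm \<xi>"] by simp
    finally have "norm \<xi> \<le> s * B" using m(1) by (simp add: B_def field_simps)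
    then have e\<xi>: "e * norm \<xi> \<le> s * (e * B)" using e(1) mult_left_mono[of "norm \<xi>" "s * B" e] by (simp add: mult_ac)
    have "m * norm (\<xi> - s *\<^sub>R w) \<le> norm (E (\<xi> - s *\<^sub>R w))"
      using P' P w by (intro m(2)) (auto simp: \<xi>_def intro: subspace_diff subspace_scale)
    also have "E (\<xi> - s *\<^sub>R w) = (E \<xi> - s *\<^sub>R u) + s *\<^sub>R (u - E w)"
      by (simp add: linear_diff[OF lE] linear_scale[OF lE] algebra_simps)
    also have "norm \<dots> \<le> e * norm \<xi> + s * \<rho>"
      using g s mult_left_mono[OF u\<rho> s] by (intro norm_triangle_mono) (simp_all add: norm_minus_commute)
    also have "\<dots> \<le> s * (e * B) + s * \<rho>" using e\<xi> by simp
    finally have "norm (\<xi> - s *\<^sub>R w) \<le> s * (e * B + \<rho>) / m" using m(1) by (simp add: field_simps)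
    then have "norm (\<xi> - s *\<^sub>R w) * k \<le> s * (e * B + \<rho>) / m * k" using k(1) by (intro mult_right_mono) auto
    also have "\<dots> = s * (k * (e * B) / m + k * \<rho> / m)" by (simp add: field_simps add_divide_distrib)
    also have "\<dots> \<le> s * (c / 3 + c / 3)" by (rule mult_left_mono[OF add_mono[OF e(3) \<rho>(3)] s])
    finally have "norm (D (\<xi> - s *\<^sub>R w)) \<le> s * (c / 3 + c / 3)" using k(2)[of "\<xi> - s *\<^sub>R w"] by linarith
    moreover have "D (\<xi> - s *\<^sub>R w) = D \<xi> - s * D w"
      by (simp add: linear_diff[OF lD] linear_scale[OF lD])
    moreover have "s * (2 * c) \<le> s * D w" by (rule mult_left_mono[OF c(2) s])
    moreover have "norm (p z - p y - D \<xi>) \<le> e * norm \<xi>" using d2(2)[of z y] yz by (simp add: \<xi>_def)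
    moreover have "s * (e * B) \<le> s * (c / 3)" by (rule mult_left_mono[OF e(4) s])
    ultimately have "\<bar>D \<xi> - s * D w\<bar> \<le> s * c * 2 / 3" "s * c * 2 \<le> s * D w" "\<bar>p z - p y - D \<xi>\<bar> \<le> s * c / 3"
      using e\<xi> by (simp_all add: algebra_simps)
    then show "p y + c * s \<le> p z" unfolding mult.commute[of c s] by linarith
  qed
qed

section \<open>Transfer of the growth to charts of the manifold\<close>

context euclidean_manifold
begin

text \<open>A smooth triangulation provides an extension in some chart that may vary with the
  simplex. Composing with the transition map gives one in a prescribed chart, and the differential
  stays injective because that of the transition map is invertible.\<close>

lemma triangulation_chart_extension:
  assumes tri: "smooth_triangulation M A K h" and T: "T \<in> K" "x \<in> T" and V: "(V, \<psi>) \<in> A" "h x \<in> V"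
  obtains G E r where "r > 0" "strict_derivative G E x" "inj_on E (span ((\<lambda>y. y - x) ` T))"
    "\<And>y. y \<in> T \<inter> ball x r \<Longrightarrow> h y \<in> V \<and> G y = \<psi> (h y)"
proof -
  obtain U \<phi> W g where U: "(U, \<phi>) \<in> A" and W: "open W" "x \<in> W" "h ` (T \<inter> W) \<subseteq> U"
    and g: "smooth_on W g" "\<forall>y\<in>T \<inter> W. g y = \<phi> (h y)"
      "inj_on (frechet_derivative g (at x)) (span ((\<lambda>y. y - x) ` T))"
    by (rule smooth_triangulationE[OF tri T])
  have hU: "h x \<in> U" using W T by blast
  have gx: "g x = \<phi> (h x)" using g(2) W T by blast
  let ?\<tau> = "\<lambda>y. \<psi> (inv_into U \<phi> y)" and ?\<sigma> = "\<lambda>y. \<phi> (inv_into V \<psi> y)"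
  let ?R = "\<phi> ` (U \<inter> V)"
  have oR: "open ?R" by (rule open_chart_image[OF U chart(1)[OF V(1)]])
  have oR': "open (\<psi> ` (V \<inter> U))" by (rule open_chart_image[OF V(1) chart(1)[OF U]])
  have gxR: "g x \<in> ?R" using gx hU V by blast
  define T' where "T' = frechet_derivative ?\<tau> (at (g x))"
  have \<tau>: "strict_derivative ?\<tau> T' (g x)"
    unfolding T'_def by (rule smooth_on_strict_derivative[OF transition_smooth[OF U V(1)] oR gxR])
  have hi: "inv_into U \<phi> (g x) = h x" using gx U hU by simp
  have inj\<tau>: "inj T'"
  proof -
    have \<sigma>: "(?\<sigma> has_derivative frechet_derivative ?\<sigma> (at (\<psi> (h x)))) (at (?\<tau> (g x)))"
      unfolding hi by (rule smooth_onD[OF transition_smooth[OF V(1) U]]) (use hU V in blast)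
    have "((\<lambda>y. ?\<sigma> (?\<tau> y)) has_derivative (\<lambda>v. frechet_derivative ?\<sigma> (at (\<psi> (h x))) (T' v))) (at (g x))"
      by (rule has_derivative_compose[OF strict_derivative_imp_has_derivative[OF \<tau>] \<sigma>])
    moreover have "((\<lambda>y. ?\<sigma> (?\<tau> y)) has_derivative (\<lambda>v. v)) (at (g x))"
      by (rule has_derivative_transform_within_open[OF has_derivative_ident oR gxR]) (use U V in auto)
    ultimately have "(\<lambda>v. frechet_derivative ?\<sigma> (at (\<psi> (h x))) (T' v)) = (\<lambda>v. v)"
      by (rule has_derivative_unique)
    then show ?thesis by (metis injI)
  qed
  have sg: "strict_derivative g (frechet_derivative g (at x)) x"
    by (rule smooth_on_strict_derivative[OF g(1) W(1,2)])
  obtain r1 where r1: "r1 > 0" "ball x r1 \<subseteq> W" using W openE by blast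
  obtain e where e: "e > 0" "ball (g x) e \<subseteq> ?R" using oR gxR openE by blast
  obtain r2 where r2: "r2 > 0" "\<And>y. y \<in> ball x r2 \<Longrightarrow> g y \<in> ball (g x) e"
    using strict_derivative_imp_isCont[OF sg] e(1) unfolding continuous_at_eps_delta
    by (metis dist_commute mem_ball)
  show ?thesis
  proof
    show "min r1 r2 > 0" using r1 r2 by simp
    show "strict_derivative (\<lambda>y. ?\<tau> (g y)) (\<lambda>v. T' (frechet_derivative g (at x) v)) x"
      by (rule strict_derivative_compose[OF sg \<tau>])
    show "inj_on (\<lambda>v. T' (frechet_derivative g (at x) v)) (span ((\<lambda>y. y - x) ` T))"
      using comp_inj_on[OF g(3) inj_on_subset[OF inj\<tau> subset_UNIV]] by (simp only: comp_def)
    fix y assume y: "y \<in> T \<inter> ball x (min r1 r2)"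
    then have yW: "y \<in> T \<inter> W" "g y \<in> ?R" using r1 r2 e by auto
    then have hy: "h y \<in> U" "g y = \<phi> (h y)" using W g(2) by auto
    from yW(2) obtain q where q: "q \<in> U" "q \<in> V" "g y = \<phi> q" by blast
    have "\<phi> q = \<phi> (h y)" using q(3) hy(2) by simp
    from inj_onD[OF chart(4)[OF U] this q(1) hy(1)] have "h y \<in> V" using q(2) by simp
    then show "h y \<in> V \<and> ?\<tau> (g y) = \<psi> (h y)" using hy U by simp
  qed
qed


text \<open>The direction v is the image of w under the differential of \<open>h\<close> on any
  simplex through x. A short straight path in the chart in a direction near v is pulled back by
  \<open>H\<close>; it runs through simplices containing x, and on each of them the increment
  estimate compares any two of its points.\<close>

lemma monomial_sum_increasing_along:
  assumes tri: "smooth_triangulation M A K h" and H: "homeomorphic_maps (top_of_set (\<Union>K)) M h H"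
    and x: "x \<in> \<Union>K" and V: "(V, \<psi>) \<in> A" "h x \<in> V" and pos: "0 < monomial_sum K L x"
    and dir: "\<forall>s. 0 \<le> s \<and> s \<le> 1 / 2 \<longrightarrow> (\<forall>T\<in>K. x \<in> T \<longrightarrow> x + s *\<^sub>R w \<in> T) \<and>
       monomial_sum K L x + monomial_sum K L x / 4 * s \<le> monomial_sum K L (x + s *\<^sub>R w)"
  defines "c \<equiv> monomial_sum K L x / 8"
  obtains v where "increasing_along (\<lambda>y. monomial_sum K L (H (inv_into V \<psi> y))) c v (\<psi> (h x))"
proof -
  let ?u = "monomial_sum K L"
  have K: "simplicial_complex K" using tri by (simp add: smooth_triangulation_def)
  have finK: "finite K" using K by (simp add: simplicial_complex_def)
  have c: "c > 0" using pos by (simp add: c_def)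
  have w: "(\<forall>T\<in>K. x \<in> T \<longrightarrow> x + s *\<^sub>R w \<in> T) \<and>
       monomial_sum K L x + monomial_sum K L x / 4 * s \<le> monomial_sum K L (x + s *\<^sub>R w)"
    if "0 \<le> s" "s \<le> 1 / 2" for s using dir that by blast
  define Kx where "Kx = {T \<in> K. x \<in> T}"
  let ?ext = "\<lambda>T GEr. snd (snd GEr) > 0 \<and> strict_derivative (fst GEr) (fst (snd GEr)) x \<and>
      inj_on (fst (snd GEr)) (span ((\<lambda>y. y - x) ` T)) \<and>
      (\<forall>y\<in>T \<inter> ball x (snd (snd GEr)). h y \<in> V \<and> fst GEr y = \<psi> (h y))"
  have "\<forall>T\<in>Kx. \<exists>GEr. ?ext T GEr"
  proof
    fix T assume "T \<in> Kx"
    then have T: "T \<in> K" "x \<in> T" by (auto simp: Kx_def)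
    show "\<exists>GEr. ?ext T GEr"
    proof (rule triangulation_chart_extension[OF tri T V])
      fix G E and r :: real
      assume "r > 0" "strict_derivative G E x" "inj_on E (span ((\<lambda>y. y - x) ` T))"
        "\<And>y. y \<in> T \<inter> ball x r \<Longrightarrow> h y \<in> V \<and> G y = \<psi> (h y)"
      then show ?thesis by (intro exI[of _ "(G, E, r)"]) auto
    qed
  qed
  from bchoice[OF this] obtain GEr where GEr: "\<forall>T\<in>Kx. ?ext T (GEr T)" ..
  define G where "G T = fst (GEr T)" for T
  define E where "E T = fst (snd (GEr T))" for T
  define r where "r T = snd (snd (GEr T))" for T
  have r: "\<And>T. T \<in> Kx \<Longrightarrow> r T > 0" and sG: "\<And>T. T \<in> Kx \<Longrightarrow> strict_derivative (G T) (E T) x"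
    and injE: "\<And>T. T \<in> Kx \<Longrightarrow> inj_on (E T) (span ((\<lambda>y. y - x) ` T))"
    and G: "\<And>T y. T \<in> Kx \<Longrightarrow> y \<in> T \<Longrightarrow> y \<in> ball x (r T) \<Longrightarrow> h y \<in> V \<and> G T y = \<psi> (h y)"
    using GEr unfolding G_def E_def r_def by blast+
  have step_in_ball: "x + s *\<^sub>R w \<in> ball x d" if "0 \<le> s" "s * (norm w + 1) < d" for s d
  proof -
    have "s * norm w \<le> s * (norm w + 1)" using that by (intro mult_left_mono) auto
    then show ?thesis using that by (simp add: dist_norm)
  qed
  \<comment> \<open>The segment from x along w lies in all simplices through x, and on it the
    extensions all agree with the triangulation. Hence their differentials agree on w, although they
    may differ in other directions.\<close>
  have same: "E T w = E T' w" if T: "T \<in> Kx" "T' \<in> Kx" for T T'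
  proof -
    have "norm (E T w - E T' w) \<le> 2 * norm w * e" if e: "e > 0" for e
    proof -
      obtain d where d: "d > 0" "\<And>y z. y \<in> ball x d \<Longrightarrow> z \<in> ball x d \<Longrightarrow> norm (G T y - G T z - E T (y - z)) \<le> e * norm (y - z)"
        using strict_derivativeE[OF sG[OF T(1)] e] by blast
      obtain d' where d': "d' > 0" "\<And>y z. y \<in> ball x d' \<Longrightarrow> z \<in> ball x d' \<Longrightarrow> norm (G T' y - G T' z - E T' (y - z)) \<le> e * norm (y - z)"
        using strict_derivativeE[OF sG[OF T(2)] e] by blast
      define m where "m = Min {d, d', r T, r T'}"
      have m: "m > 0" "m \<le> d" "m \<le> d'" "m \<le> r T" "m \<le> r T'" using d d' r T by (auto simp: m_def)
      define s where "s = min (1 / 2) (m / (2 * (norm w + 1)))"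
      have nw: "norm w + 1 > 0" using norm_ge_zero[of w] by linarith
      have s: "s \<le> 1 / 2" unfolding s_def by (rule min.cobounded1)
      have s: "s > 0" "s \<le> 1 / 2" using s m nw by (simp_all add: s_def)
      have "s * (norm w + 1) \<le> m / (2 * (norm w + 1)) * (norm w + 1)" using nw by (intro mult_right_mono) (auto simp: s_def)
      also have "\<dots> = m / 2"
      proof -
        have "m / (2 * n) * n = m / 2" if "n > 0" for n :: real using that by simp
        from this[OF nw] show ?thesis .
      qed
      finally have sm: "s * (norm w + 1) < m" using m by simp
      let ?y = "x + s *\<^sub>R w"
      have y: "?y \<in> ball x d" "?y \<in> ball x d'" "?y \<in> ball x (r T)" "?y \<in> ball x (r T')"
        using s m sm by (auto intro!: step_in_ball simp del: mem_ball)
      have yT: "?y \<in> T" "?y \<in> T'" "x \<in> T" "x \<in> T'" using w[of s] s T by (auto simp: Kx_def)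
      have eq: "G T ?y = G T' ?y" "G T x = G T' x"
        using G[OF T(1) yT(1) y(3)] G[OF T(2) yT(2) y(4)] G[OF T(1) yT(3)] G[OF T(2) yT(4)] r T by auto
      have 1: "norm (G T ?y - G T x - s *\<^sub>R E T w) \<le> e * (s * norm w)"
        using d(2)[OF y(1), of x] d(1) s linear_scale[OF bounded_linear.linear[OF strict_derivative_bounded_linear[OF sG[OF T(1)]]], of s w] by simp
      have 2: "norm (G T' ?y - G T' x - s *\<^sub>R E T' w) \<le> e * (s * norm w)"
        using d'(2)[OF y(2), of x] d'(1) s linear_scale[OF bounded_linear.linear[OF strict_derivative_bounded_linear[OF sG[OF T(2)]]], of s w] by simp
      have "norm (s *\<^sub>R (E T w - E T' w)) \<le> e * (s * norm w) + e * (s * norm w)"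
        using norm_triangle_mono[OF 2 1[unfolded eq, unfolded norm_minus_commute[of _ "s *\<^sub>R E T w"]]]
        by (simp add: scaleR_diff_right)
      also have "\<dots> = s * (2 * norm w * e)" by simp
      finally have "s * norm (E T w - E T' w) \<le> s * (2 * norm w * e)" using s by simp
      then show ?thesis using s(1) by (simp only: mult_le_cancel_left_pos)
    qed
    note bd = this
    have "norm (E T w - E T' w) \<le> 0"
    proof (rule field_le_epsilon)
      fix e :: real assume e: "e > 0"
      have nw: "2 * norm w + 1 > 0" using norm_ge_zero[of w] by linarith
      have "2 * norm w * (e / (2 * norm w + 1)) \<le> e" using e nw by (simp add: field_simps)
      then show "norm (E T w - E T' w) \<le> 0 + e" using bd[of "e / (2 * norm w + 1)"] e nw by simp
    qed
    then show ?thesis by simp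
  qed
  obtain T0 where T0: "T0 \<in> Kx" using x by (auto simp: Kx_def)
  define v where "v = E T0 w"
  let ?incr = "\<lambda>T \<rho>. \<rho> > 0 \<and> (\<forall>y z u s. y \<in> T \<inter> ball x \<rho> \<longrightarrow> z \<in> T \<inter> ball x \<rho> \<longrightarrow> u \<in> ball v \<rho> \<longrightarrow> 0 \<le> s \<longrightarrow>
      \<psi> (h z) - \<psi> (h y) = s *\<^sub>R u \<longrightarrow> ?u y + c * s \<le> ?u z)"
  have "\<exists>\<rho>. ?incr T \<rho>" if T: "T \<in> Kx" for T
  proof -
    have TK: "T \<in> K" "x \<in> T" using T by (auto simp: Kx_def)
    obtain p where p: "smooth_on UNIV p" "\<And>y. y \<in> T \<Longrightarrow> p y = ?u y"
      using monomial_sum_smooth_on_simplex[OF K TK(1)] by metis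
    define D where "D = frechet_derivative p (at x)"
    have sp: "strict_derivative p D x" unfolding D_def by (rule smooth_on_strict_derivative[OF p(1)]) auto
    let ?P = "span ((\<lambda>y. y - x) ` T)"

    have "x + (1 / 2) *\<^sub>R w \<in> T" using w[of "1 / 2"] TK by auto
    then have "(1 / 2) *\<^sub>R w \<in> (\<lambda>y. y - x) ` T" by (intro image_eqI[of _ _ "x + (1 / 2) *\<^sub>R w"]) auto
    then have "2 *\<^sub>R ((1 / 2) *\<^sub>R w) \<in> ?P" by (intro span_scale span_base)
    then have wP: "w \<in> ?P" by simp
    have "monomial_sum K L x / 4 \<le> D w"
    proof (rule has_derivative_ge_of_increments[OF strict_derivative_imp_has_derivative[OF sp]])
      fix s :: real assume "0 < s" "s < 1 / 2"
      then show "p x + monomial_sum K L x / 4 * s \<le> p (x + s *\<^sub>R w)"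
        using w[of s] p(2) TK by auto
    qed simp
    \<comment> \<open>Half of the rate available along w is reserved for errors, hence the divisor 8
      in c against 4 here.\<close>
    then have cD: "2 * c \<le> D w" by (simp add: c_def)
    obtain \<rho> where \<rho>: "\<rho> > 0"
      "\<And>y z u s. y \<in> ball x \<rho> \<Longrightarrow> z \<in> ball x \<rho> \<Longrightarrow> z - y \<in> ?P \<Longrightarrow> u \<in> ball (E T w) \<rho> \<Longrightarrow> 0 \<le> s \<Longrightarrow>
       G T z - G T y = s *\<^sub>R u \<Longrightarrow> p y + c * s \<le> p z"
      by (rule simplex_increment[OF sG[OF T] sp subspace_span injE[OF T] wP c cD]) (rule that)
    have "?u y + c * s \<le> ?u z"
      if y: "y \<in> T \<inter> ball x (min \<rho> (r T))" and z: "z \<in> T \<inter> ball x (min \<rho> (r T))" and u: "u \<in> ball v (min \<rho> (r T))"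
        and s: "0 \<le> s" and eq: "\<psi> (h z) - \<psi> (h y) = s *\<^sub>R u" for y z u s
    proof -
      have "(z - x) - (y - x) \<in> ?P" using y z by (intro span_diff span_base) auto
      then have "z - y \<in> ?P" by simp
      moreover have "G T z - G T y = s *\<^sub>R u" using G[OF T, of y] G[OF T, of z] y z eq by auto
      moreover have "u \<in> ball (E T w) \<rho>" using u same[OF T T0] by (simp add: v_def)
      ultimately have "p y + c * s \<le> p z" using y z s by (intro \<rho>(2)) auto
      then show ?thesis using p(2) y z by auto
    qed
    then show ?thesis using \<rho>(1) r[OF T] by (intro exI[of _ "min \<rho> (r T)"]) simp
  qed
  then have "\<forall>T\<in>Kx. \<exists>\<rho>. ?incr T \<rho>" by blast
  from bchoice[OF this] obtain \<rho> where \<rho>: "\<forall>T\<in>Kx. ?incr T (\<rho> T)" ..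
  define R where "R = Min (insert 1 (\<rho> ` Kx))"
  have finKx: "finite Kx" using finK by (simp add: Kx_def)
  have R: "R > 0" "\<And>T. T \<in> Kx \<Longrightarrow> R \<le> \<rho> T" using \<rho> finKx by (auto simp: R_def intro: min.coboundedI2)
  \<comment> \<open>A growth estimate exists only on simplices through x. The others form a finite
    union of closed sets that misses x, so a neighbourhood avoids them.\<close>
  have "closed (\<Union>(K - Kx))"
    using finK simplicial_complex_closed[OF K] by (intro closed_Union) auto
  then have "open (ball x R - \<Union>(K - Kx))" by (rule open_Diff[OF open_ball])
  moreover have "x \<in> ball x R - \<Union>(K - Kx)" using R by (auto simp: Kx_def)
  moreover have cHV: "continuous_on (\<psi> ` V) (\<lambda>y. H (inv_into V \<psi> y))"
  proof -
    have "continuous_map M (top_of_set (\<Union>K)) H" using H by (simp add: homeomorphic_maps_def)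
    from continuous_map_compose[OF continuous_map_inv_chart[OF V(1)] this]
    show ?thesis using continuous_map_in_subtopology by (force simp: comp_def)
  qed
  moreover have Hx: "H (inv_into V \<psi> (\<psi> (h x))) = x"
    using H x V by (auto simp: homeomorphic_maps_def)
  ultimately have "open (\<psi> ` V \<inter> (\<lambda>y. H (inv_into V \<psi> y)) -` (ball x R - \<Union>(K - Kx)))"
    "\<psi> (h x) \<in> \<psi> ` V \<inter> (\<lambda>y. H (inv_into V \<psi> y)) -` (ball x R - \<Union>(K - Kx))"
    using continuous_open_preimage[OF cHV chart(3)[OF V(1)]] V(2) by auto
  then obtain e where e: "e > 0" "ball (\<psi> (h x)) e \<subseteq> \<psi> ` V \<inter> (\<lambda>y. H (inv_into V \<psi> y)) -` (ball x R - \<Union>(K - Kx))"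
    using openE by blast
  let ?H = "\<lambda>y. H (inv_into V \<psi> y)"
  have near: "y \<in> \<psi> ` V" "?H y \<in> ball x R" "?H y \<notin> \<Union>(K - Kx)" "?H y \<in> \<Union>K" "h (?H y) = inv_into V \<psi> y" "\<psi> (h (?H y)) = y"
    if "y \<in> ball (\<psi> (h x)) e" for y
  proof -
    show y: "y \<in> \<psi> ` V" and "?H y \<in> ball x R" "?H y \<notin> \<Union>(K - Kx)" using e that by auto
    have i: "inv_into V \<psi> y \<in> topspace M" using chart(2)[OF V(1)] inv_into_into[OF y] by blast
    then have "H (inv_into V \<psi> y) \<in> topspace (top_of_set (\<Union>K))"
      using H continuous_map_image_subset_topspace unfolding homeomorphic_maps_def by fast
    then show "?H y \<in> \<Union>K" by simp
    show "h (?H y) = inv_into V \<psi> y" using H i by (simp add: homeomorphic_maps_def)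
    then show "\<psi> (h (?H y)) = y" using y by (simp add: f_inv_into_f)
  qed
  obtain q where q: "q > 0" "q \<le> min e R"
    "\<And>y u s. y \<in> ball (\<psi> (h x)) q \<Longrightarrow> u \<in> ball v q \<Longrightarrow> 0 \<le> s \<Longrightarrow> s \<le> q \<Longrightarrow> y + s *\<^sub>R u \<in> ball (\<psi> (h x)) e"
    using short_step_in_ball[of "min e R" "\<psi> (h x)" v] e(1) R(1) by (metis (no_types, lifting) min_less_iff_conj mem_ball)
  have "?u (?H y) + c * s \<le> ?u (?H (y + s *\<^sub>R u))"
    if y: "y \<in> ball (\<psi> (h x)) q" and u: "u \<in> ball v q" and s: "0 \<le> s" "s \<le> q" for y u s
  proof -
    define \<gamma> where "\<gamma> \<sigma> = y + \<sigma> *\<^sub>R u" for \<sigma>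
    have \<gamma>: "\<gamma> \<sigma> \<in> ball (\<psi> (h x)) e" if "\<sigma> \<in> {0..s}" for \<sigma>
      unfolding \<gamma>_def using q(3)[OF y u] that s by auto
    have c\<gamma>: "continuous_on {0..s} (\<lambda>\<sigma>. ?H (\<gamma> \<sigma>))"
    proof (rule continuous_on_compose2[OF cHV])
      show "continuous_on {0..s} \<gamma>" unfolding \<gamma>_def by (intro continuous_intros)
      show "\<gamma> ` {0..s} \<subseteq> \<psi> ` V" using near(1) \<gamma> by blast
    qed
    define C where "C T = {0..s} \<inter> (\<lambda>\<sigma>. ?H (\<gamma> \<sigma>)) -` T" for T
    \<comment> \<open>Subtracting the required gain turns growth at rate c into monotonicity, the
      form that is glued over the closed sets of parameters at which the path is in a given
      simplex.\<close>
    let ?\<kappa> = "\<lambda>\<sigma>. ?u (?H (\<gamma> \<sigma>)) - c * \<sigma>"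
    have "?\<kappa> 0 \<le> ?\<kappa> s"
    proof (rule mono_on_closed_cover[of Kx C 0 s ?\<kappa>, OF finKx])
      show "closed (C T)" if "T \<in> Kx" for T
        unfolding C_def using that simplicial_complex_closed[OF K]
        by (intro continuous_closed_preimage[OF c\<gamma>]) (auto simp: Kx_def)
      show "0 \<le> s" by (rule s)
      show "{0..s} \<subseteq> (\<Union>T\<in>Kx. C T)"
      proof
        fix \<sigma> assume \<sigma>: "\<sigma> \<in> {0..s}"
        obtain T where "T \<in> K" "?H (\<gamma> \<sigma>) \<in> T" using near(4)[OF \<gamma>[OF \<sigma>]] by blast
        moreover then have "T \<in> Kx" using near(3)[OF \<gamma>[OF \<sigma>]] by blast
        ultimately show "\<sigma> \<in> (\<Union>T\<in>Kx. C T)" using \<sigma> by (auto simp: C_def)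
      qed
      fix T \<sigma> \<sigma>' assume T: "T \<in> Kx" and \<sigma>: "\<sigma> \<in> C T \<inter> {0..s}" "\<sigma>' \<in> C T \<inter> {0..s}" "\<sigma> \<le> \<sigma>'"
      have s1: "\<sigma> \<in> {0..s}" "\<sigma>' \<in> {0..s}" and T1: "?H (\<gamma> \<sigma>) \<in> T" "?H (\<gamma> \<sigma>') \<in> T" using \<sigma> by (auto simp: C_def)
      have b: "?H (\<gamma> \<sigma>) \<in> ball x (\<rho> T)" "?H (\<gamma> \<sigma>') \<in> ball x (\<rho> T)"
        using near(2)[OF \<gamma>[OF s1(1)]] near(2)[OF \<gamma>[OF s1(2)]] R(2)[OF T] by auto
      have u': "u \<in> ball v (\<rho> T)" using u q(2) R(2)[OF T] by auto
      have eq: "\<psi> (h (?H (\<gamma> \<sigma>'))) - \<psi> (h (?H (\<gamma> \<sigma>))) = (\<sigma>' - \<sigma>) *\<^sub>R u"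
        unfolding near(6)[OF \<gamma>[OF s1(1)]] near(6)[OF \<gamma>[OF s1(2)]] by (simp add: \<gamma>_def algebra_simps)
      have "?u (?H (\<gamma> \<sigma>)) + c * (\<sigma>' - \<sigma>) \<le> ?u (?H (\<gamma> \<sigma>'))"
        using \<rho> T T1 b u' eq \<sigma>(3) by (meson IntI diff_ge_0_iff_ge)
      then show "?\<kappa> \<sigma> \<le> ?\<kappa> \<sigma>'" by (simp add: algebra_simps)
    qed
    then show ?thesis by (simp add: \<gamma>_def)
  qed
  then have "increasing_along (\<lambda>y. ?u (?H y)) c v (\<psi> (h x))"
    unfolding increasing_along_def using q(1) by blast
  then show ?thesis by (rule that)
qed

lemma Reeb_function_of_subcomplex:
  assumes "simplicial_subcomplex_via M A K h L X" "X \<noteq> {}" "X \<subset> topspace M"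
  shows "\<exists>f. smooth_function A f \<and> Reeb_function M A 0 1 f \<and> {p \<in> topspace M. f p = 0} = X"
proof -
  have tri: "smooth_triangulation M A K h" and L: "simplicial_complex L" "L \<subseteq> K" and X: "X = h ` (\<Union>L)"
    using assms(1) by (auto simp: simplicial_subcomplex_via_def)
  have K: "simplicial_complex K" using tri by (simp add: smooth_triangulation_def)
  obtain H where H: "homeomorphic_maps (top_of_set (\<Union>K)) M h H"
    using tri by (auto simp: smooth_triangulation_def homeomorphic_map_maps)
  have cH: "continuous_map M (top_of_set (\<Union>K)) H" and Hh: "\<And>x. x \<in> \<Union>K \<Longrightarrow> H (h x) = x"
    and hH: "\<And>q. q \<in> topspace M \<Longrightarrow> h (H q) = q"
    using H by (auto simp: homeomorphic_maps_def)
  have HK: "H q \<in> \<Union>K" if "q \<in> topspace M" for q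
    using continuous_map_image_subset_topspace[OF cH] that by auto
  obtain b where b: "b > 0" "\<And>x. x \<in> \<Union>K \<Longrightarrow> monomial_sum K L x < b \<Longrightarrow>
     \<exists>w. \<forall>s. 0 \<le> s \<and> s \<le> 1 / 2 \<longrightarrow> (\<forall>T\<in>K. x \<in> T \<longrightarrow> x + s *\<^sub>R w \<in> T) \<and>
       monomial_sum K L x + monomial_sum K L x / 4 * s \<le> monomial_sum K L (x + s *\<^sub>R w)"
    by (rule monomial_sum_direction[OF K L]) (rule that)
  let ?u = "\<lambda>q. monomial_sum K L (H q)"
  show ?thesis
  proof (rule Reeb_function_of_increasing[of ?u X b])
    have "continuous_map (top_of_set (\<Union>K)) euclidean (monomial_sum K L)"
      using continuous_on_monomial_sum[OF K] by simp
    from continuous_map_compose[OF cH this] show "continuous_map M euclidean ?u" by (simp add: comp_def)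
    show "0 \<le> ?u q" if "q \<in> topspace M" for q by (rule monomial_sum_nonneg[OF K HK[OF that]])
    have "q \<in> X \<longleftrightarrow> ?u q = 0" if q: "q \<in> topspace M" for q
    proof -
      have "q \<in> X \<longleftrightarrow> H q \<in> \<Union>L"
      proof
        assume "q \<in> X"
        then obtain y where y: "y \<in> \<Union>L" "q = h y" unfolding X by blast
        moreover have "y \<in> \<Union>K" using y(1) L(2) by blast
        ultimately show "H q \<in> \<Union>L" using Hh by simp
      next
        assume "H q \<in> \<Union>L"
        then have "h (H q) \<in> X" unfolding X by (rule imageI)
        then show "q \<in> X" using hH[OF q] by simp
      qed
      then show ?thesis using monomial_sum_eq_0_iff[OF K L HK[OF q]] by simp
    qed
    then show "X = {q \<in> topspace M. ?u q = 0}" using assms(3) by blast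
    fix q assume q: "q \<in> topspace M" "0 < ?u q" "?u q < b"
    obtain V \<psi> where V: "(V, \<psi>) \<in> A" "q \<in> V" using chart_around[OF q(1)] .
    obtain w where w: "\<forall>s. 0 \<le> s \<and> s \<le> 1 / 2 \<longrightarrow> (\<forall>T\<in>K. H q \<in> T \<longrightarrow> H q + s *\<^sub>R w \<in> T) \<and>
       monomial_sum K L (H q) + monomial_sum K L (H q) / 4 * s \<le> monomial_sum K L (H q + s *\<^sub>R w)"
      using b(2)[OF HK[OF q(1)] q(3)] by blast
    have hV: "h (H q) \<in> V" using hH[OF q(1)] V by simp
    \<comment> \<open>The rate tends to 0 towards X; only its positivity at the single point q is
      asked for.\<close>
    obtain v where "increasing_along (\<lambda>y. monomial_sum K L (H (inv_into V \<psi> y))) (monomial_sum K L (H q) / 8) v (\<psi> (h (H q)))"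
      by (rule monomial_sum_increasing_along[OF tri H HK[OF q(1)] V(1) hV q(2) w]) (rule that)
    then show "\<exists>(V, \<psi>)\<in>A. \<exists>c v. q \<in> V \<and> c > 0 \<and> increasing_along (\<lambda>x. ?u (inv_into V \<psi> x)) c v (\<psi> q)"
      unfolding hH[OF q(1)] using V q(2)
      by (intro bexI[of _ "(V, \<psi>)"]) (auto intro!: exI[of _ "monomial_sum K L (H q) / 8"])
  qed (use assms(2,3) b in auto)
qed

end

subsection \<open>A Euclidean model space\<close>

text \<open>
  The dimension of the model space is not a type, so a finite index type for its coordinates is
  carved out of the model space itself. The value \<open>{0}\<close> is junk.
\<close>

definition coord_index :: "'e::real_normed_vector set" where
  "coord_index = (if \<exists>B::'e set. finite B \<and> independent B \<and> span B = UNIV \<and> B \<noteq> {}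
     then SOME B::'e set. finite B \<and> independent B \<and> span B = UNIV \<and> B \<noteq> {} else {0})"

lemma coord_index_basis:
  assumes "\<exists>B::'e::real_normed_vector set. finite B \<and> span B = UNIV" "\<exists>x::'e. x \<noteq> 0"
  shows "finite (coord_index :: 'e set) \<and> independent (coord_index :: 'e set) \<and>
    span (coord_index :: 'e set) = UNIV \<and> (coord_index :: 'e set) \<noteq> {}"
proof -
  obtain C :: "'e set" where C: "finite C" "span C = UNIV" using assms(1) by blast
  obtain B where B: "B \<subseteq> C" "independent B" "C \<subseteq> span B"
    by (rule maximal_independent_subset[of C])
  have "span B = UNIV" using C(2) span_mono[OF B(3)] by (simp add: span_span top.extremum_uniqueI)
  moreover have "B \<noteq> {}" using \<open>span B = UNIV\<close> assms(2) by (metis UNIV_I singletonD span_empty)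
  ultimately have ex: "\<exists>B::'e set. finite B \<and> independent B \<and> span B = UNIV \<and> B \<noteq> {}"
    using B C(1) finite_subset by blast
  from someI_ex[OF this] show ?thesis unfolding coord_index_def if_P[OF ex] .
qed

lemma coord_index_finite_nonempty:
  "finite (coord_index :: 'e::real_normed_vector set)" "(coord_index :: 'e::real_normed_vector set) \<noteq> {}"
proof -
  have "finite (coord_index :: 'e set) \<and> (coord_index :: 'e set) \<noteq> {}"
  proof (cases "\<exists>B::'e set. finite B \<and> independent B \<and> span B = UNIV \<and> B \<noteq> {}")
    case True
    from someI_ex[OF this] show ?thesis unfolding coord_index_def if_P[OF True] by blast
  next
    case False
    show ?thesis unfolding coord_index_def if_not_P[OF False] by simp
  qed
  then show "finite (coord_index :: 'e set)" "(coord_index :: 'e set) \<noteq> {}" by auto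
qed

typedef (overloaded) 'e coord_ix = "coord_index :: 'e::real_normed_vector set"
  using coord_index_finite_nonempty by auto

instance coord_ix :: (real_normed_vector) finite
proof
  have "(UNIV :: 'a coord_ix set) = Abs_coord_ix ` coord_index"
    by (rule type_definition.univ[OF type_definition_coord_ix])
  then show "finite (UNIV :: 'a coord_ix set)"
    using coord_index_finite_nonempty(1)[where 'e = 'a] by (metis finite_imageI)
qed

lemma linear_iso_euclidean:
  assumes fin: "\<exists>B::'e::real_normed_vector set. finite B \<and> span B = UNIV" and nz: "\<exists>x::'e. x \<noteq> 0"
  obtains R :: "'e::real_normed_vector \<Rightarrow> real ^ 'e::real_normed_vector coord_ix" and L where "bounded_linear R" "bounded_linear L"
    "\<And>x. L (R x) = x" "\<And>y. R (L y) = y"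
proof -
  note B = coord_index_basis[OF fin nz]
  define L :: "real ^ 'e coord_ix \<Rightarrow> 'e" where "L y = (\<Sum>i\<in>UNIV. (y $ i) *\<^sub>R Rep_coord_ix i)" for y
  have bL: "bounded_linear L"
    unfolding L_def by (intro bounded_linear_sum bounded_linear_scaleR_const bounded_linear_vec_nth)
  note lL = bounded_linear.linear[OF bL]
  have injRep: "inj Rep_coord_ix" by (simp add: inj_on_def Rep_coord_ix_inject)
  have rangeRep: "range Rep_coord_ix = (coord_index :: 'e set)"
    by (rule type_definition.Rep_range[OF type_definition_coord_ix])
  have "y = 0" if "L y = 0" for y
  proof -
    have "(\<Sum>v\<in>coord_index. (y $ Abs_coord_ix v) *\<^sub>R v) = 0"
      using that unfolding rangeRep[symmetric] L_def by (simp add: sum.reindex[OF injRep] Rep_coord_ix_inverse)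
    then have "y $ Abs_coord_ix v = 0" if "v \<in> coord_index" for v
      using independentD[of coord_index coord_index "\<lambda>v. y $ Abs_coord_ix v" v] B that by blast
    then have "y $ i = 0" for i using Rep_coord_ix[of i] Rep_coord_ix_inverse[of i] by metis
    then show ?thesis by (simp add: vec_eq_iff)
  qed
  then have injL: "inj L" using linear_injective_0[OF lL] by blast
  have surjL: "surj L"
  proof -
    have "coord_index \<subseteq> range L"
    proof
      fix v :: 'e assume v: "v \<in> coord_index"
      have "L (axis (Abs_coord_ix v) 1) = v"
        using v by (simp add: L_def axis_def if_distrib[of "\<lambda>c. c *\<^sub>R _"] Abs_coord_ix_inverse cong: if_cong)
      then show "v \<in> range L" by (metis rangeI)
    qed
    then have "span coord_index \<subseteq> range L"
      by (intro span_minimal linear_subspace_image[OF lL] subspace_UNIV)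
    then show ?thesis using B by auto
  qed
  define R where "R = inv L"
  have LR: "L (R x) = x" for x unfolding R_def by (rule surj_f_inv_f[OF surjL])
  have RL: "R (L y) = y" for y unfolding R_def by (rule inv_f_f[OF injL])
  have lR: "linear R"
  proof (rule linearI)
    show "R (x + y) = R x + R y" for x y using RL[of "R x + R y"] by (simp add: linear_add[OF lL] LR)
    show "R (c *\<^sub>R x) = c *\<^sub>R R x" for c x using RL[of "c *\<^sub>R R x"] by (simp add: linear_scale[OF lL] LR)
  qed
  \<comment> \<open>The inverse of \<open>L\<close> is bounded because \<open>norm (L y)\<close>
    attains a positive minimum on the compact unit sphere.\<close>
  obtain m where m: "m > 0" "\<And>y. m * norm y \<le> norm (L y)"
  proof -
    let ?S = "sphere (0 :: real ^ 'e coord_ix) 1"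
    have "continuous_on ?S (\<lambda>y. norm (L y))"
      by (intro continuous_on_norm linear_continuous_on bL)
    moreover have "?S \<noteq> {}" by simp
    ultimately obtain y0 where y0: "y0 \<in> ?S" "\<And>y. y \<in> ?S \<Longrightarrow> norm (L y0) \<le> norm (L y)"
      using continuous_attains_inf[OF compact_sphere] by metis
    have "L y0 \<noteq> 0" using y0(1) injL linear_0[OF lL] by (auto dest: injD[of L y0 0])
    moreover have "norm (L y0) * norm y \<le> norm (L y)" for y
    proof (cases "y = 0")
      case False
      have "norm (L y0) \<le> norm (L ((1 / norm y) *\<^sub>R y))" by (rule y0(2)) (use False in simp)
      then show ?thesis using False by (simp add: linear_scale[OF lL] field_simps)
    qed simp
    ultimately show ?thesis using that[of "norm (L y0)"] by simp
  qed
  have "bounded_linear R"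
  proof (rule bounded_linear_intro[where K = "1 / m"])
    show "R (x + y) = R x + R y" for x y using linear_add[OF lR] .
    show "R (c *\<^sub>R x) = c *\<^sub>R R x" for c x using linear_scale[OF lR] .
    show "norm (R x) \<le> norm x * (1 / m)" for x
      using m(2)[of "R x"] m(1) by (simp add: LR field_simps)
  qed
  then show ?thesis using that[OF _ bL LR RL] by blast
qed

subsection \<open>Linear change of the model space\<close>

definition change_model :: "('e \<Rightarrow> 'd) \<Rightarrow> ('a, 'e) chart set \<Rightarrow> ('a, 'd) chart set" where
  "change_model R A = (\<lambda>(U, \<phi>). (U, R \<circ> \<phi>)) ` A"

text \<open>The situation is symmetric in \<open>R\<close> and \<open>L\<close>. Thus every transfer
  from \<open>A\<close> to \<open>change_model R A\<close> also holds backwards, by applying it to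
  \<open>L\<close> and undoing the change with \<open>change_model_back\<close>.\<close>

locale model_iso =
  fixes R :: "'e::real_normed_vector \<Rightarrow> 'd::real_normed_vector" and L :: "'d \<Rightarrow> 'e"
  assumes bR: "bounded_linear R" and bL: "bounded_linear L" and LR [simp]: "\<And>x. L (R x) = x" and RL [simp]: "\<And>y. R (L y) = y"
begin

lemma swap: "model_iso L R"
  by (rule model_iso.intro) (simp_all add: bR bL)

lemma change_model_back: "change_model L (change_model R A) = A"
  by (force simp: change_model_def comp_def)

lemma image_eq: "R ` S = L -` S"
  by (force intro: image_eqI[of _ R "L _"])

lemma open_image: "open S \<Longrightarrow> open (R ` S)"
  unfolding image_eq by (rule open_vimage) (use linear_continuous_on[OF bL] in auto)

lemma inv_chart:
  assumes "inj_on \<phi> U" "x \<in> \<phi> ` U"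
  shows "inv_into U (R \<circ> \<phi>) (R x) = inv_into U \<phi> x"
proof -
  obtain q where q: "q \<in> U" "x = \<phi> q" using assms(2) by blast
  have "inj_on (R \<circ> \<phi>) U" using assms(1) by (intro comp_inj_on) (auto intro: inj_on_inverseI[of _ L])
  from inv_into_f_f[OF this q(1)] inv_into_f_f[OF assms(1) q(1)] q(2) show ?thesis by simp
qed

lemma homeomorphic_map_top_of_set: "homeomorphic_map (top_of_set S) (top_of_set (R ` S)) R"
proof -
  have "homeomorphic_maps (top_of_set S) (top_of_set (R ` S)) R L"
    unfolding homeomorphic_maps_def continuous_map_in_subtopology
    using linear_continuous_on[OF bR] linear_continuous_on[OF bL] by auto
  then show ?thesis using homeomorphic_map_maps by blast
qed

lemma smooth_on_chart_change:
  assumes "open S" "S \<subseteq> \<phi> ` U" "inj_on \<phi> U" "smooth_on S (\<lambda>x. f (inv_into U \<phi> x))"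
  shows "smooth_on (R ` S) (\<lambda>x. f (inv_into U (R \<circ> \<phi>) x))"
proof -
  have "smooth_on (R ` S) (\<lambda>x. f (inv_into U \<phi> (L x)))"
    by (rule smooth_on_precompose_linear[OF bL open_image[OF assms(1)] assms(4)]) auto
  then show ?thesis
    by (rule iffD1[OF smooth_on_cong[OF open_image[OF assms(1)]], rotated])
       (use assms(2,3) in \<open>auto simp: subset_iff inv_chart\<close>)
qed

lemma closed_smooth_manifold_change_model:
  assumes mfd: "closed_smooth_manifold M A" and d: "\<exists>B::'d set. finite B \<and> span B = UNIV"
  shows "closed_smooth_manifold M (change_model R A)"
proof -
  note chart = closed_smooth_manifold_chart[OF mfd]
  have "smooth_atlas M (change_model R A)"
    unfolding smooth_atlas_def
  proof (intro conjI ballI)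
    fix c assume "c \<in> change_model R A"
    then obtain U \<phi> where U: "(U, \<phi>) \<in> A" "c = (U, R \<circ> \<phi>)" by (auto simp: change_model_def)
    have "homeomorphic_map (subtopology M U) (top_of_set (R ` \<phi> ` U)) (R \<circ> \<phi>)"
      by (rule homeomorphic_map_compose[OF chart(5)[OF U(1)] homeomorphic_map_top_of_set])
    then show "is_chart M c"
      using chart(1,3)[OF U(1)] open_image[of "\<phi> ` U"] by (simp add: U(2) is_chart_def image_comp)
  next
    have "(\<Union>(U, \<phi>)\<in>A. U) = topspace M"
      using mfd by (simp add: closed_smooth_manifold_def smooth_atlas_def)
    then show "(\<Union>(U, \<phi>)\<in>change_model R A. U) = topspace M"
      by (auto simp: change_model_def)
  next
    fix c assume "c \<in> change_model R A"
    then obtain U \<phi> where U: "(U, \<phi>) \<in> A" "c = (U, R \<circ> \<phi>)" by (auto simp: change_model_def)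
    have "smooth_on ((R \<circ> \<phi>) ` (U \<inter> V)) ((R \<circ> \<psi>) \<circ> inv_into U (R \<circ> \<phi>))" if V: "(V, \<psi>) \<in> A" for V \<psi>
    proof -
      note sm = closed_smooth_manifold_transition[OF mfd U(1) V]
      note o = closed_smooth_manifold_open_image[OF mfd U(1) chart(1)[OF V]]
      have "smooth_on (R ` \<phi> ` (U \<inter> V)) (\<lambda>x. R (\<psi> (inv_into U (R \<circ> \<phi>) x)))"
        by (intro smooth_on_linear_compose[OF bR open_image[OF o]] smooth_on_chart_change[OF o _ chart(4)[OF U(1)] sm]) auto
      then show ?thesis by (simp add: image_comp comp_def)
    qed
    then show "case c of (U, \<phi>) \<Rightarrow> \<forall>(V, \<psi>)\<in>change_model R A. smooth_on (\<phi> ` (U \<inter> V)) (\<psi> \<circ> inv_into U \<phi>)"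
      by (auto simp: U(2) change_model_def)
  qed
  then show ?thesis using mfd d by (simp add: closed_smooth_manifold_def)
qed

lemma smooth_triangulation_change_model:
  assumes tri: "smooth_triangulation M A K h"
  shows "smooth_triangulation M (change_model R A) K h"
proof -
  have "\<exists>(U, \<phi>)\<in>change_model R A. \<exists>W g. open W \<and> x \<in> W \<and> h ` (S \<inter> W) \<subseteq> U \<and>
        smooth_on W g \<and> (\<forall>y \<in> S \<inter> W. g y = \<phi> (h y)) \<and>
        inj_on (frechet_derivative g (at x)) (span ((\<lambda>y. y - x) ` S))" if S: "S \<in> K" "x \<in> S" for S x
  proof -
    obtain U \<phi> W g where U: "(U, \<phi>) \<in> A"
      and W: "open W" "x \<in> W" "h ` (S \<inter> W) \<subseteq> U"
      and g: "smooth_on W g" "\<forall>y \<in> S \<inter> W. g y = \<phi> (h y)"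
        "inj_on (frechet_derivative g (at x)) (span ((\<lambda>y. y - x) ` S))"
      by (rule smooth_triangulationE[OF tri S])
    have "((\<lambda>y. R (g y)) has_derivative (\<lambda>v. R (frechet_derivative g (at x) v))) (at x)"
      by (rule bounded_linear.has_derivative[OF bR smooth_onD[OF g(1) W(2)]])
    from frechet_derivative_at[OF this]
    have fd: "frechet_derivative (\<lambda>y. R (g y)) (at x) = R \<circ> frechet_derivative g (at x)" by (simp add: comp_def)
    have "inj_on (frechet_derivative (\<lambda>y. R (g y)) (at x)) (span ((\<lambda>y. y - x) ` S))"
      unfolding fd by (rule comp_inj_on[OF g(3)]) (auto intro: inj_on_inverseI[of _ L])
    moreover have "smooth_on W (\<lambda>y. R (g y))" by (rule smooth_on_linear_compose[OF bR W(1) g(1)])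
    moreover have "(U, R \<circ> \<phi>) \<in> change_model R A" using U by (force simp: change_model_def)
    ultimately show ?thesis using W g(2) by (intro bexI[of _ "(U, R \<circ> \<phi>)"]) (auto intro!: exI[of _ W] exI[of _ "\<lambda>y. R (g y)"])
  qed
  then show ?thesis using tri by (simp add: smooth_triangulation_def)
qed

lemma smooth_function_change_model:
  assumes mfd: "closed_smooth_manifold M A" and f: "smooth_function A f"
  shows "smooth_function (change_model R A) f"
  unfolding smooth_function_def
proof (rule ballI)
  fix c assume "c \<in> change_model R A"
  then obtain U \<phi> where U: "(U, \<phi>) \<in> A" "c = (U, R \<circ> \<phi>)" by (auto simp: change_model_def)
  have "smooth_on (\<phi> ` U) (\<lambda>x. f (inv_into U \<phi> x))" using f U(1) unfolding smooth_function_def comp_def by blast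
  from smooth_on_chart_change[OF closed_smooth_manifold_chart(3)[OF mfd U(1)] subset_refl closed_smooth_manifold_chart(4)[OF mfd U(1)] this]
  show "case c of (U, \<phi>) \<Rightarrow> smooth_on (\<phi> ` U) (f \<circ> inv_into U \<phi>)"
    by (simp add: U(2) image_comp comp_def)
qed

lemma critical_point_change_model:
  assumes mfd: "closed_smooth_manifold M A" and f: "critical_point A f p"
  shows "critical_point (change_model R A) f p"
proof -
  obtain U \<phi> where U: "(U, \<phi>) \<in> A" "p \<in> U" and D: "((\<lambda>x. f (inv_into U \<phi> x)) has_derivative (\<lambda>_. 0)) (at (\<phi> p))"
    using f unfolding critical_point_def comp_def by blast
  note chart = closed_smooth_manifold_chart[OF mfd U(1)]
  have "((\<lambda>y. f (inv_into U \<phi> (L y))) has_derivative (\<lambda>_. 0)) (at (R (\<phi> p)))"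
    by (rule has_derivative_compose[OF bounded_linear_imp_has_derivative[OF bL]]) (use D in simp)
  then have "((\<lambda>y. f (inv_into U (R \<circ> \<phi>) y)) has_derivative (\<lambda>_. 0)) (at (R (\<phi> p)))"
    by (rule has_derivative_transform_within_open[OF _ open_image[OF chart(3)]])
       (use U(2) inv_chart[OF chart(4)] in auto)
  moreover have "(U, R \<circ> \<phi>) \<in> change_model R A" using U by (force simp: change_model_def)
  ultimately show ?thesis using U(2) unfolding critical_point_def by (auto simp: comp_def intro!: bexI[of _ "(U, R \<circ> \<phi>)"])
qed

end

theorem theorem1:
  fixes M :: "'a topology"
    and A :: "('a, 'e::real_normed_vector) chart set"
    and K L :: "'b::euclidean_space set set"
    and h :: "'b \<Rightarrow> 'a"
    and X :: "'a set"
  assumes "closed_smooth_manifold M A"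
    and "simplicial_subcomplex_via M A K h L X"
    and "X \<noteq> {}"
    and "X \<subset> topspace M"
  shows "\<exists>f :: 'a \<Rightarrow> real.
           smooth_function A f \<and> Reeb_function M A 0 1 f \<and> {p \<in> topspace M. f p = 0} = X"
proof (cases "\<exists>x::'e. x \<noteq> 0")
  case True
  have fin: "\<exists>B::'e set. finite B \<and> span B = UNIV" using assms(1) by (simp add: closed_smooth_manifold_def)
  obtain R :: "'e \<Rightarrow> real ^ 'e coord_ix" and J where iso: "model_iso R J"
    by (rule linear_iso_euclidean[OF fin True]) (rule that, rule model_iso.intro)
  interpret RJ: model_iso R J by (rule iso)
  interpret JR: model_iso J R by (rule RJ.swap)
  let ?A = "change_model R A"
  have "\<exists>B::(real ^ 'e coord_ix) set. finite B \<and> span B = UNIV"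
    by (intro exI[of _ Basis]) auto
  from RJ.closed_smooth_manifold_change_model[OF assms(1) this]
  have mfd: "closed_smooth_manifold M ?A" .
  interpret euclidean_manifold M ?A by unfold_locales (rule mfd)
  have "simplicial_subcomplex_via M ?A K h L X"
    using assms(2) RJ.smooth_triangulation_change_model by (auto simp: simplicial_subcomplex_via_def)
  from Reeb_function_of_subcomplex[OF this assms(3,4)] obtain f where f: "smooth_function ?A f"
    "Reeb_function M ?A 0 1 f" "{p \<in> topspace M. f p = 0} = X" by blast
  have sm: "smooth_function A f"
    using JR.smooth_function_change_model[OF mfd f(1)] by (simp add: RJ.change_model_back)
  \<comment> \<open>Both directions matter: the set of critical values has to be the same in the two
    models, neither smaller nor larger.\<close>
  have "critical_point A f p \<longleftrightarrow> critical_point ?A f p" for p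
    using RJ.critical_point_change_model[OF assms(1)] JR.critical_point_change_model[OF mfd]
    by (auto simp: RJ.change_model_back)
  then have "critical_values M A f = critical_values M ?A f" by (simp add: critical_values_def)
  then have "Reeb_function M A 0 1 f"
    using f(2) smooth_function_imp_Ck_function[OF sm] by (simp add: Reeb_function_def)
  then show ?thesis using sm f(3) by blast
next
  case False
  text \<open>In dimension zero every function is smooth and every point is critical.\<close>
  define f where "f p = (if p \<in> X then 0 else 1 :: real)" for p
  have const: "g = (\<lambda>x. g 0)" for g :: "'e \<Rightarrow> real" using False by (metis (full_types))
  have sm: "smooth_function A f"
    unfolding smooth_function_def
  proof (intro ballI, clarify)
    fix U and \<phi> :: "'a \<Rightarrow> 'e"
    show "smooth_on (\<phi> ` U) (f \<circ> inv_into U \<phi>)"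
      by (subst const) (rule smooth_on_const)
  qed
  have crit: "critical_point A f p" if "p \<in> topspace M" for p
  proof -
    obtain U \<phi> where U: "(U, \<phi>) \<in> A" "p \<in> U"
      using assms(1) \<open>p \<in> topspace M\<close> unfolding closed_smooth_manifold_def smooth_atlas_def by blast
    have "((f \<circ> inv_into U \<phi>) has_derivative (\<lambda>_. 0)) (at (\<phi> p))"
      by (subst const) (rule has_derivative_const)
    then show ?thesis using U unfolding critical_point_def by blast
  qed
  have "critical_values M A f = {0, 1}"
    using assms(3,4) crit by (force simp: critical_values_def f_def)
  then have "Reeb_function M A 0 1 f"
    using smooth_function_imp_Ck_function[OF sm] by (auto simp: Reeb_function_def f_def)
  moreover have "{p \<in> topspace M. f p = 0} = X" using assms(4) by (auto simp: f_def)
  ultimately show ?thesis using sm by blast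
qed

end
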